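(* Let $\lambda$ be a frequency, $(G,\beta)$ a $\lambda$-Dirichlet group, $k>0$, $f\in H_1^\lambda(G)$, and let $D=\sum\widehat f(h_{\lambda_n})e^{-\lambda_ns}$ be its associated Dirichlet series in $\mathcal H_1(\lambda)$. Then there is a null set $N\subset G$ such that for all $\omega\notin N$ $$\lim_{x\to\infty}R_x^{\lambda,k}(D^\omega)(0)=f(\omega),$$ $$\lim_{x\to\infty}R_x^{\lambda,k}(D^\omega)(it)=f_\omega(t)\quad\text{for almost all }t\in\mathbb R,$$ and $$\lim_{x\to\infty}R_x^{\lambda,k}(D^\omega)(u+it)=(f_\omega*P_u)(t)\quad\text{for all }u>0\text{ and almost all }t\in\mathbb R.$$
   Context: A frequency is a strictly increasing, unbounded sequence $\lambda=(\lambda_n)_{n\in\mathbb N}$ of non-negative real numbers. A Dirichlet group $(G,\beta)$ is a compact abelian group $G$ together with a continuous homomorphism $\beta:(\mathbb R,+)\to G$ with dense range; it is a $\lambda$-Dirichlet group if for every $n$ there is a (then unique) character $h_{\lambda_n}\in\widehat G$ with $h_{\lambda_n}(\beta(t))=e^{-i\lambda_nt}$ for all $t\in\mathbb R$. Null sets in $G$ and $L_1(G)$ refer to the normalized Haar measure $m$; $\widehat f(\gamma)=\int_Gf\,\overline\gamma\,dm$. $H_1^\lambda(G)$ is the space of all $f\in L_1(G)$ such that $\widehat f(\gamma)\neq0$ implies $\gamma=h_{\lambda_n}$ for some $n$, and $\mathcal H_1(\lambda)$ is the space of all formal series $\sum\widehat f(h_{\lambda_n})e^{-\lambda_ns}$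 with $f\in H_1^\lambda(G)$. For a formal $\lambda$-Dirichlet series $D=\sum a_ne^{-\lambda_ns}$ and $\omega\in G$, the vertical limit is $D^\omega=\sum a_nh_{\lambda_n}(\omega)e^{-\lambda_ns}$, and the first $(\lambda,k)$-Riesz mean of length $x>0$ is $R_x^{\lambda,k}(D)(s)=\sum_{\lambda_n<x}a_n(1-\frac{\lambda_n}{x})^ke^{-\lambda_ns}$. For $f\in L_1(G)$ (with a fixed representative), for almost all $\omega\in G$ there is a locally integrable $f_\omega:\mathbb R\to\mathbb C$ with $f_\omega(t)=f(\omega\beta(t))$ for almost all $t$. $P_u(t)=\frac1\pi\frac{u}{u^2+t^2}$ is the Poisson kernel and $*$ is convolution on $\mathbb R$. *)

theory Defs
  imports "HOL-Analysis.Analysis"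
begin

text \<open>
  Compact abelian groups are Hausdorff and are written additively: a type of class
  \<open>{topological_ab_group_add, t2_space}\<close> whose universe is compact. The product
  \<open>\<omega> \<beta>(t)\<close> of the multiplicative notation is therefore \<open>\<omega> + \<beta> t\<close>.
\<close>

definition frequency :: "(nat \<Rightarrow> real) \<Rightarrow> bool" where
  "frequency l \<longleftrightarrow> strict_mono l \<and> (\<forall>n. 0 \<le> l n) \<and> \<not> bdd_above (range l)"

definition continuous_character :: "('g::{topological_ab_group_add, t2_space} \<Rightarrow> complex) \<Rightarrow> bool" where
  "continuous_character \<gamma> \<longleftrightarrow>
     continuous_on UNIV \<gamma> \<and> (\<forall>x. norm (\<gamma> x) = 1) \<and> (\<forall>x y. \<gamma> (x + y) = \<gamma> x * \<gamma> y)"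

definition dirichlet_group :: "(real \<Rightarrow> 'g::{topological_ab_group_add, t2_space}) \<Rightarrow> bool" where
  "dirichlet_group \<beta> \<longleftrightarrow>
     compact (UNIV :: 'g set) \<and> continuous_on UNIV \<beta> \<and>
     (\<forall>s t. \<beta> (s + t) = \<beta> s + \<beta> t) \<and> closure (range \<beta>) = UNIV"

definition extends_frequency ::
  "(real \<Rightarrow> 'g::{topological_ab_group_add, t2_space}) \<Rightarrow> real \<Rightarrow> ('g \<Rightarrow> complex) \<Rightarrow> bool" where
  "extends_frequency \<beta> x \<gamma> \<longleftrightarrow>
     continuous_character \<gamma> \<and> (\<forall>t. \<gamma> (\<beta> t) = exp (- \<i> * of_real x * of_real t))"

definition lambda_dirichlet_group ::
  "(nat \<Rightarrow> real) \<Rightarrow> (real \<Rightarrow> 'g::{topological_ab_group_add, t2_space}) \<Rightarrow> bool" where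
  "lambda_dirichlet_group l \<beta> \<longleftrightarrow>
     dirichlet_group \<beta> \<and> (\<forall>n. \<exists>\<gamma>. extends_frequency \<beta> (l n) \<gamma>)"

definition freq_char ::
  "(real \<Rightarrow> 'g::{topological_ab_group_add, t2_space}) \<Rightarrow> real \<Rightarrow> 'g \<Rightarrow> complex" where
  "freq_char \<beta> x = (THE \<gamma>. extends_frequency \<beta> x \<gamma>)"

lemma extends_frequency_unique:
  fixes \<beta> :: "real \<Rightarrow> 'g::{topological_ab_group_add, t2_space}"
  assumes "dirichlet_group \<beta>" "extends_frequency \<beta> x \<gamma>" "extends_frequency \<beta> x \<delta>"
  shows "\<gamma> = \<delta>"
proof -
  have "closed {y. \<gamma> y = \<delta> y}"
    using assms(2,3) unfolding extends_frequency_def continuous_character_def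
    by (intro closed_Collect_eq) auto
  moreover have "range \<beta> \<subseteq> {y. \<gamma> y = \<delta> y}"
    using assms(2,3) by (auto simp: extends_frequency_def)
  ultimately have "closure (range \<beta>) \<subseteq> {y. \<gamma> y = \<delta> y}"
    by (rule closure_minimal[rotated])
  then show ?thesis
    using assms(1) by (auto simp: dirichlet_group_def)
qed

lemma freq_char_extends:
  assumes "lambda_dirichlet_group l \<beta>"
  shows "extends_frequency \<beta> (l n) (freq_char \<beta> (l n))"
  unfolding freq_char_def
  using assms extends_frequency_unique
  by (metis (mono_tags, lifting) lambda_dirichlet_group_def theI)

text \<open>
  Groups carrying a dense image of the reals need not be metrizable, so that regularity has to be
  required of a Borel measure in order to single out the Haar measure. For finite measures on a
  compact space, inner regularity on all Borel sets implies outer regularity.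
\<close>

definition normalized_haar :: "'g::{topological_ab_group_add, t2_space} measure \<Rightarrow> bool" where
  "normalized_haar m \<longleftrightarrow>
     sets m = sets borel \<and> emeasure m (space m) = 1 \<and>
     (\<forall>x. \<forall>A\<in>sets borel. emeasure m ((+) x ` A) = emeasure m A) \<and>
     (\<forall>A\<in>sets borel. emeasure m A = (SUP K\<in>{K. compact K \<and> K \<subseteq> A}. emeasure m K))"

definition fourier_coeff :: "'g measure \<Rightarrow> ('g \<Rightarrow> complex) \<Rightarrow> ('g \<Rightarrow> complex) \<Rightarrow> complex" where
  "fourier_coeff m f \<gamma> = (LINT \<omega>|m. f \<omega> * cnj (\<gamma> \<omega>))"

definition H1 ::
  "(nat \<Rightarrow> real) \<Rightarrow> (real \<Rightarrow> 'g::{topological_ab_group_add, t2_space}) \<Rightarrow> 'g measure \<Rightarrow>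
   ('g \<Rightarrow> complex) set" where
  "H1 l \<beta> m = {f. integrable m f \<and>
     (\<forall>\<gamma>. continuous_character \<gamma> \<and> fourier_coeff m f \<gamma> \<noteq> 0 \<longrightarrow> (\<exists>n. \<gamma> = freq_char \<beta> (l n)))}"

text \<open>A formal Dirichlet series over a given frequency is its sequence of coefficients.\<close>

type_synonym dirichlet_series = "nat \<Rightarrow> complex"

definition associated_series ::
  "(nat \<Rightarrow> real) \<Rightarrow> (real \<Rightarrow> 'g::{topological_ab_group_add, t2_space}) \<Rightarrow> 'g measure \<Rightarrow>
   ('g \<Rightarrow> complex) \<Rightarrow> dirichlet_series" where
  "associated_series l \<beta> m f = (\<lambda>n. fourier_coeff m f (freq_char \<beta> (l n)))"

definition vertical_limit ::
  "(nat \<Rightarrow> real) \<Rightarrow> (real \<Rightarrow> 'g::{topological_ab_group_add, t2_space}) \<Rightarrow>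
   dirichlet_series \<Rightarrow> 'g \<Rightarrow> dirichlet_series" where
  "vertical_limit l \<beta> D \<omega> = (\<lambda>n. D n * freq_char \<beta> (l n) \<omega>)"

definition riesz_mean ::
  "(nat \<Rightarrow> real) \<Rightarrow> real \<Rightarrow> real \<Rightarrow> dirichlet_series \<Rightarrow> complex \<Rightarrow> complex" where
  "riesz_mean l k x D s =
     (\<Sum>n | l n < x. D n * of_real ((1 - l n / x) powr k) * exp (- of_real (l n) * s))"

lemma frequency_finite_less:
  assumes "frequency l"
  shows "finite {n. l n < x}"
proof -
  obtain N where N: "x < l N"
    using assms unfolding frequency_def bdd_above_def by (auto simp: not_le)
  have "{n. l n < x} \<subseteq> {..<N}"
  proof
    fix n assume "n \<in> {n. l n < x}"
    then have "l n < l N" using N by simp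
    then show "n \<in> {..<N}"
      using assms by (simp add: frequency_def strict_mono_less)
  qed
  then show ?thesis using finite_subset by blast
qed

definition locally_integrable :: "(real \<Rightarrow> complex) \<Rightarrow> bool" where
  "locally_integrable g \<longleftrightarrow> (\<forall>K. compact K \<longrightarrow> set_integrable lebesgue K g)"

text \<open>The functions that may serve as \<open>f\<^sub>\<omega>\<close>; any two of them agree almost everywhere.\<close>

definition is_orbit_function ::
  "(real \<Rightarrow> 'g::{topological_ab_group_add, t2_space}) \<Rightarrow> ('g \<Rightarrow> complex) \<Rightarrow> 'g \<Rightarrow>
   (real \<Rightarrow> complex) \<Rightarrow> bool" where
  "is_orbit_function \<beta> f \<omega> g \<longleftrightarrow>
     locally_integrable g \<and> (AE t in lebesgue. g t = f (\<omega> + \<beta> t))"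

definition poisson_kernel :: "real \<Rightarrow> real \<Rightarrow> real" where
  "poisson_kernel u t = (1 / pi) * (u / (u\<^sup>2 + t\<^sup>2))"

text \<open>
  Since a divergent integral has the value 0, existence of a convolution at a point is expressed
  separately.
\<close>

definition convolution_exists :: "(real \<Rightarrow> complex) \<Rightarrow> (real \<Rightarrow> real) \<Rightarrow> real \<Rightarrow> bool" where
  "convolution_exists g p t \<longleftrightarrow> integrable lebesgue (\<lambda>y. g y * of_real (p (t - y)))"

definition convolution :: "(real \<Rightarrow> complex) \<Rightarrow> (real \<Rightarrow> real) \<Rightarrow> real \<Rightarrow> complex" where
  "convolution g p t = (LINT y|lebesgue. g y * of_real (p (t - y)))"

end

theory Submission
  imports Defs
begin

text \<open>
  Let \<open>K\<close> be the inverse Fourier transform of \<open>(1 - \<bar>y\<bar>)\<^sup>k\<close>, extended by 0 outside \<open>[-1, 1]\<close>. It is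
  bounded by a multiple of \<open>(1 + \<bar>t\<bar>) powr (- 1 - min k 1)\<close>. Since \<open>f\<close> has only non-negative
  frequencies, the \<open>x\<close>-th Riesz mean of \<open>f\<close> and its average \<open>\<integral> f(\<omega> + \<beta> s) x K(x s) ds\<close> along the flow have
  the same Fourier coefficients, hence agree for almost all \<open>\<omega>\<close>. On almost every orbit the
  averages converge at each Lebesgue point of \<open>f\<^sub>\<omega>\<close>, and Fubini's theorem turns convergence almost
  everywhere on the orbits into convergence almost everywhere on the group. For \<open>u > 0\<close> the Riesz means
  are convolutions of \<open>f\<^sub>\<omega>\<close> with \<open>P\<^sub>u * K\<^sub>x\<close>, and dominated convergence applies.

  Uniqueness of Fourier coefficients reduces to the existence of a character \<open>\<gamma>\<close> that is not
  orthogonal to a given continuous \<open>h = h\<^sup>* \<noteq> 0\<close>. The normalized convolution powers of \<open>h * h\<close> converge to an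
  idempotent \<open>e\<close>. If \<open>e\<close> is minimal, every hermitian \<open>p\<close> with \<open>p * e = p\<close> is a multiple of \<open>e\<close>; applied to
  combinations of translates of \<open>e\<close> this shows that \<open>e / e 0\<close> is a character.
\<close>

section \<open>Convolution on a compact abelian group\<close>

text \<open>The Riesz kernel oscillates, so at a Lebesgue point it is replaced by an even,
  decreasing, integrable majorant; any exponent below -1 would do. For \<open>k < 1\<close> the
  derivative of the profile is singular at 1, and this is where \<open>min k 1\<close> comes from.
  The delicate point is the order of quantifiers. For fixed \<open>x\<close> the Riesz mean and the
  average agree only off a null set that depends on \<open>x\<close>. The identity is therefore used
  for rational \<open>x\<close>, moved to almost every orbit, and only there extended to all
  \<open>x > 0\<close>, both sides being continuous in \<open>x\<close>. Rational lengths also make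
  the set of convergence measurable, as the return from the orbits to the group requires. The group
  need not be metrizable, so a Borel set of its square need not lie in the product algebra. With the
  real line as second factor this cannot happen, since one countable base suffices. Characters are
  built from continuous functions and uniform limits alone: convolution with a fixed continuous
  function turns L2 estimates into uniform ones.\<close>

locale haar_group =
  fixes m :: "'g::{topological_ab_group_add, t2_space} measure"
  assumes compact_group: "compact (UNIV :: 'g set)"
    and haar: "normalized_haar m"
begin

lemma sets_haar [measurable_cong]: "sets m = sets borel"
  using haar by (simp add: normalized_haar_def)

lemma space_haar [simp]: "space m = UNIV"
  using sets_eq_imp_space_eq[OF sets_haar] by simp

lemma borel_measurable_haar: "f \<in> borel_measurable m \<longleftrightarrow> f \<in> borel_measurable borel"
  by (rule measurable_cong_sets[THEN arg_cong[where f="\<lambda>S. f \<in> S"]]) (auto simp: sets_haar)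

sublocale haar: finite_measure m
  by (rule finite_measureI) (use haar in \<open>simp add: normalized_haar_def\<close>)

lemma measure_UNIV [simp]: "measure m UNIV = 1"
  using haar by (simp add: normalized_haar_def measure_def)

sublocale pair: pair_sigma_finite m m
  by standard

lemma continuous_measurable:
  fixes \<phi> :: "'g \<Rightarrow> 'a::{topological_space}"
  assumes "continuous_on UNIV \<phi>"
  shows "\<phi> \<in> borel_measurable m"
  using assms by (simp add: borel_measurable_haar borel_measurable_continuous_onI)

lemma translation_measurable [measurable]: "(\<lambda>x. a + x) \<in> m \<rightarrow>\<^sub>M m"
proof -
  have "(\<lambda>x. a + x) \<in> borel \<rightarrow>\<^sub>M (borel :: 'g measure)"
    by (intro borel_measurable_continuous_onI continuous_intros)
  then show ?thesis
    by (simp only: measurable_cong_sets[OF sets_haar sets_haar])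
qed

lemma distr_translation: "distr m m (\<lambda>x. a + x) = m"
proof (rule measure_eqI)
  fix A assume "A \<in> sets (distr m m (\<lambda>x. a + x))"
  then have A: "A \<in> sets m" "A \<in> sets borel" by (auto simp: sets_haar)
  have "emeasure (distr m m (\<lambda>x. a + x)) A = emeasure m ((\<lambda>x. a + x) -` A)"
    using A by (simp add: emeasure_distr)
  also have "(\<lambda>x. a + x) -` A = (+) (- a) ` A"
    by (auto simp: image_iff intro!: bexI[of _ "a + _"])
  also have "emeasure m \<dots> = emeasure m A"
    using A haar unfolding normalized_haar_def by blast
  finally show "emeasure (distr m m (\<lambda>x. a + x)) A = emeasure m A" .
qed simp

lemma nn_integral_translation:
  assumes "f \<in> borel_measurable m"
  shows "(\<integral>\<^sup>+ x. f (a + x) \<partial>m) = (\<integral>\<^sup>+ x. f x \<partial>m)"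
  using nn_integral_distr[OF translation_measurable, of f a] assms by (simp add: distr_translation)

lemma integral_translation:
  fixes f :: "'g \<Rightarrow> complex"
  assumes "f \<in> borel_measurable m"
  shows "(LINT x|m. f (a + x)) = (LINT x|m. f x)"
  using integral_distr[OF translation_measurable assms, of a] by (simp add: distr_translation)

lemma integral_translation_diff:
  fixes f :: "'g \<Rightarrow> complex"
  assumes "f \<in> borel_measurable m"
  shows "(LINT x|m. f (x - a)) = (LINT x|m. f x)"
  using integral_translation[OF assms, of "- a"] by simp

lemma continuous_bounded:
  fixes \<phi> :: "'g \<Rightarrow> complex"
  assumes "continuous_on UNIV \<phi>"
  obtains B where "B > 0" "\<And>x. norm (\<phi> x) \<le> B"
proof -
  have "bounded (range \<phi>)"
    using compact_continuous_image[OF assms compact_group] compact_imp_bounded by blast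
  then show ?thesis
    using that by (auto simp: bounded_pos)
qed

lemma integrable_mult_continuous:
  fixes \<phi> f :: "'g \<Rightarrow> complex"
  assumes f: "integrable m f" and "continuous_on UNIV \<phi>"
  shows "integrable m (\<lambda>x. f x * \<phi> x)"
proof -
  obtain B where B: "B > 0" "\<And>x. norm (\<phi> x) \<le> B"
    using continuous_bounded[OF assms(2)] by blast
  have [measurable]: "\<phi> \<in> borel_measurable m" "f \<in> borel_measurable m"
    using assms by (auto intro: continuous_measurable)
  show ?thesis
  proof (rule Bochner_Integration.integrable_bound[of _ "\<lambda>x. B * norm (f x)"])
    have "norm (f x * \<phi> x) \<le> norm (B * norm (f x))" for x
      using mult_left_mono[OF B(2)[of x] norm_ge_zero[of "f x"]] B(1)
      by (simp add: norm_mult abs_mult mult.commute[of B])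
    then show "AE x in m. norm (f x * \<phi> x) \<le> norm (B * norm (f x))"
      by simp
  qed (use f in auto)
qed

lemma continuous_integrable:
  fixes \<phi> :: "'g \<Rightarrow> complex"
  assumes "continuous_on UNIV \<phi>"
  shows "integrable m \<phi>"
  using integrable_mult_continuous[of "\<lambda>_. 1" \<phi>] assms by auto

text \<open>Compactness in \<open>y\<close> makes one neighbourhood of \<open>x0\<close> serve all
  \<open>y\<close> at once; this takes the place of uniform continuity in a metric space.\<close>

lemma continuous_translation_at:
  fixes \<phi> :: "'g \<Rightarrow> complex"
  assumes "continuous_on UNIV \<phi>" "e > 0"
  obtains U where "open U" "x0 \<in> U" "\<forall>x\<in>U. \<forall>y. norm (\<phi> (x - y) - \<phi> (x0 - y)) \<le> e"
proof -
  have "continuous_on (UNIV \<times> UNIV) (\<lambda>p::'g \<times> 'g. \<phi> (fst p - snd p))"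
    by (rule continuous_on_compose2[OF assms(1)]) (auto intro!: continuous_intros)
  then obtain U where "x0 \<in> U" "open U"
    "\<forall>x\<in>U \<inter> UNIV. \<forall>t\<in>UNIV. dist (\<phi> (fst (x, t) - snd (x, t))) (\<phi> (fst (x0, t) - snd (x0, t))) \<le> e"
    by (rule continuous_on_prod_compactE[OF _ compact_group UNIV_I assms(2)])
  then show ?thesis using that[of U] by (simp add: dist_norm)
qed

text \<open>Without a countable base, the Borel sets of the product may form a larger algebra than the product
  of the Borel algebras. The function is approximated uniformly by functions that are simple in
  the first variable.\<close>

lemma measurable_difference:
  fixes \<phi> :: "'g \<Rightarrow> complex"
  assumes "continuous_on UNIV \<phi>"
  shows "(\<lambda>p. \<phi> (fst p - snd p)) \<in> borel_measurable (m \<Otimes>\<^sub>M m)"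
proof -
  have "\<exists>F. F \<in> borel_measurable (m \<Otimes>\<^sub>M m) \<and> (\<forall>p. norm (F p - \<phi> (fst p - snd p)) \<le> e)"
    if "e > 0" for e :: real
  proof -
    have "\<exists>U. open U \<and> x \<in> U \<and> (\<forall>x'\<in>U. \<forall>y. norm (\<phi> (x' - y) - \<phi> (x - y)) \<le> e)" for x
      by (rule continuous_translation_at[OF assms that, of x]) blast
    then obtain U where U: "\<And>x. open (U x)" "\<And>x. x \<in> U x"
      "\<And>x x' y. x' \<in> U x \<Longrightarrow> norm (\<phi> (x' - y) - \<phi> (x - y)) \<le> e"
      by metis
    have "\<exists>D. D \<subseteq> UNIV \<and> finite D \<and> UNIV \<subseteq> (\<Union>x\<in>D. U x)"
      by (rule compactE_image[OF compact_group, of UNIV U]) (use U in auto)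
    then obtain D where D: "finite D" "UNIV = (\<Union>x\<in>D. U x)" by auto
    obtain xs where xs: "set xs = D" using D(1) finite_list by blast
    \<comment> \<open>The least index turns the finite cover into a measurable partition, so that
      the approximant is a finite sum of products of a function of the first variable and one of the
      second.\<close>
    define i where "i z = (LEAST j. z \<in> U (xs ! j))" for z
    have ex: "\<exists>j<length xs. z \<in> U (xs ! j)" for z
      using D(2) xs by (metis UNIV_I UN_E in_set_conv_nth)
    have i: "z \<in> U (xs ! i z)" "i z < length xs" for z
      using ex[of z] LeastI[of "\<lambda>j. z \<in> U (xs ! j)"] Least_le[of "\<lambda>j. z \<in> U (xs ! j)"]
      unfolding i_def by (blast, meson le_less_trans)
    have [measurable]: "U x \<in> sets m" for x
      by (simp add: sets_haar U)
    have i_meas [measurable]: "i \<in> measurable m (count_space UNIV)"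
      unfolding i_def by (measurable)
    have "(\<lambda>p. \<phi> (xs ! i (fst p) - snd p)) = (\<lambda>p. \<Sum>j<length xs. if i (fst p) = j then \<phi> (xs ! j - snd p) else 0)"
      using i(2) by (intro ext) simp
    moreover have "(\<lambda>p. \<Sum>j<length xs. if i (fst p) = j then \<phi> (xs ! j - snd p) else 0) \<in> borel_measurable (m \<Otimes>\<^sub>M m)"
    proof -
      have [measurable]: "(\<lambda>y. \<phi> (a - y)) \<in> borel_measurable m" for a
        by (rule continuous_measurable, rule continuous_on_compose2[OF assms(1)]) (auto intro!: continuous_intros)
      show ?thesis by measurable
    qed
    ultimately have "(\<lambda>p. \<phi> (xs ! i (fst p) - snd p)) \<in> borel_measurable (m \<Otimes>\<^sub>M m)" by simp
    moreover have "norm (\<phi> (xs ! i (fst p) - snd p) - \<phi> (fst p - snd p)) \<le> e" for p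
      using U(3)[OF i(1), of "fst p" "snd p"] by (simp add: norm_minus_commute)
    ultimately show ?thesis by blast
  qed
  then have "\<exists>F. \<forall>n::nat. F n \<in> borel_measurable (m \<Otimes>\<^sub>M m) \<and> (\<forall>p. norm (F n p - \<phi> (fst p - snd p)) \<le> inverse (Suc n))"
    by (intro choice allI) auto
  then obtain F where F: "\<And>n. F n \<in> borel_measurable (m \<Otimes>\<^sub>M m)"
    "\<And>n p. norm (F n p - \<phi> (fst p - snd p)) \<le> inverse (Suc n)" for n :: nat by blast
  show ?thesis
  proof (rule borel_measurable_LIMSEQ_metric[OF F(1)])
    fix p
    have "(\<lambda>n. F n p - \<phi> (fst p - snd p)) \<longlonglongrightarrow> 0"
      by (rule Lim_null_comparison[OF _ LIMSEQ_inverse_real_of_nat]) (use F(2) in auto)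
    then show "(\<lambda>n. F n p) \<longlonglongrightarrow> \<phi> (fst p - snd p)"
      using LIM_zero_iff by blast
  qed
qed

text \<open>Meant for integrable \<open>f\<close> and continuous \<open>\<phi>\<close>: the integral
  then exists at every point, not only almost everywhere, and depends continuously on
  \<open>x\<close>.\<close>

definition conv :: "('g \<Rightarrow> complex) \<Rightarrow> ('g \<Rightarrow> complex) \<Rightarrow> 'g \<Rightarrow> complex" where
  "conv f \<phi> x = (LINT y|m. f y * \<phi> (x - y))"

lemma continuous_diff:
  fixes \<phi> :: "'g \<Rightarrow> complex"
  assumes "continuous_on UNIV \<phi>"
  shows "continuous_on UNIV (\<lambda>y. \<phi> (x - y))" "continuous_on UNIV (\<lambda>y. \<phi> (y - x))"
    "continuous_on UNIV (\<lambda>y. \<phi> (- y))" "continuous_on UNIV (\<lambda>y. cnj (\<phi> (- y)))"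
proof -
  show "continuous_on UNIV (\<lambda>y. \<phi> (x - y))" "continuous_on UNIV (\<lambda>y. \<phi> (y - x))"
    and *: "continuous_on UNIV (\<lambda>y. \<phi> (- y))"
    by (auto intro!: continuous_intros continuous_on_compose2[OF assms(1)])
  show "continuous_on UNIV (\<lambda>y. cnj (\<phi> (- y)))"
    by (intro continuous_intros *)
qed

lemma integrable_conv:
  fixes f \<phi> :: "'g \<Rightarrow> complex"
  assumes "integrable m f" "continuous_on UNIV \<phi>"
  shows "integrable m (\<lambda>y. f y * \<phi> (x - y))"
  using assms by (intro integrable_mult_continuous continuous_diff)

lemma norm_conv_le:
  assumes f: "integrable m f" and \<phi>: "continuous_on UNIV \<phi>" and B: "\<And>x. norm (\<phi> x) \<le> B"
  shows "norm (conv f \<phi> x) \<le> B * (LINT y|m. norm (f y))"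
proof -
  have "norm (conv f \<phi> x) \<le> (LINT y|m. norm (f y * \<phi> (x - y)))"
    unfolding conv_def by (rule integral_norm_bound)
  also have "\<dots> \<le> (LINT y|m. B * norm (f y))"
  proof (rule integral_mono)
    show "integrable m (\<lambda>y. norm (f y * \<phi> (x - y)))"
      by (intro integrable_norm integrable_conv f \<phi>)
  qed (use f B in \<open>auto simp: norm_mult mult.commute[of B] intro!: mult_left_mono\<close>)
  finally show ?thesis by simp
qed

lemma continuous_conv:
  assumes f: "integrable m f" and \<phi>: "continuous_on UNIV \<phi>"
  shows "continuous_on UNIV (conv f \<phi>)"
  unfolding continuous_on_def
proof (intro ballI tendstoI)
  fix x0 and e :: real assume "e > 0"
  \<comment> \<open>Adding 1 keeps the divisor positive when \<open>f\<close> vanishes and makes the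
    final inequality strict.\<close>
  define A where "A = (LINT y|m. norm (f y)) + 1"
  have A: "A > 0" unfolding A_def by (simp add: add_nonneg_pos)
  obtain U where U: "open U" "x0 \<in> U" "\<forall>x\<in>U. \<forall>y. norm (\<phi> (x - y) - \<phi> (x0 - y)) \<le> e / A"
    by (rule continuous_translation_at[where ?x0.0 = x0, OF \<phi> divide_pos_pos[OF \<open>e > 0\<close> A]])
  have "dist (conv f \<phi> x) (conv f \<phi> x0) < e" if "x \<in> U" for x
  proof -
    have "conv f \<phi> x - conv f \<phi> x0 = (LINT y|m. f y * (\<phi> (x - y) - \<phi> (x0 - y)))"
      unfolding conv_def right_diff_distrib
      by (rule Bochner_Integration.integral_diff[symmetric]) (intro integrable_conv f \<phi>)+
    also have "norm \<dots> \<le> (LINT y|m. norm (f y * (\<phi> (x - y) - \<phi> (x0 - y))))"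
      by (rule integral_norm_bound)
    also have "\<dots> \<le> (LINT y|m. e / A * norm (f y))"
    proof (rule integral_mono)
      show "integrable m (\<lambda>y. norm (f y * (\<phi> (x - y) - \<phi> (x0 - y))))"
        unfolding right_diff_distrib by (intro integrable_norm Bochner_Integration.integrable_diff integrable_conv f \<phi>)
    next
      fix y
      show "norm (f y * (\<phi> (x - y) - \<phi> (x0 - y))) \<le> e / A * norm (f y)"
        unfolding norm_mult mult.commute[of "e / A"] by (intro mult_left_mono U(3)[rule_format] that) auto
    qed (use f in auto)
    also have "\<dots> = e / A * (A - 1)" by (simp add: A_def)
    also have "\<dots> < e" using A \<open>e > 0\<close> by (simp add: field_simps)
    finally show ?thesis by (simp add: dist_norm)
  qed
  then show "\<forall>\<^sub>F x in at x0 within UNIV. dist (conv f \<phi> x) (conv f \<phi> x0) < e"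
    unfolding eventually_at_topological using U by blast
qed

end

section \<open>Characters and uniqueness of Fourier coefficients\<close>

text \<open>Log-convexity makes the ratios \<open>d (Suc n) / d n\<close> increase and
  submultiplicativity bounds them by \<open>d 0\<close>; their limit is \<open>r\<close>, and the
  normalized sequence \<open>E\<close> decreases. Dividing
  \<open>E (n + Suc m) \<le> E n * E m\<close> by \<open>E n\<close> and letting \<open>n\<close>
  grow gives \<open>1 \<le> E m\<close>. Applied to squared L2 norms of convolution powers, this
  bound keeps the limit idempotent from vanishing.\<close>

lemma log_convex_submultiplicative_limit:
  fixes d :: "nat \<Rightarrow> real"
  assumes pos: "\<And>n. d n > 0"
    and convex: "\<And>n. (d (Suc n))\<^sup>2 \<le> d n * d (Suc (Suc n))"
    and submult: "\<And>n m. d (n + m + 1) \<le> d n * d m"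
  obtains r L where "r > 0" "L \<ge> 1" "(\<lambda>n. d n / r ^ Suc n) \<longlonglongrightarrow> L"
proof -
  define \<rho> where "\<rho> n = d (Suc n) / d n" for n
  have "\<rho> n \<le> \<rho> (Suc n)" for n
    using convex[of n] pos[of n] pos[of "Suc n"] by (simp add: \<rho>_def field_simps power2_eq_square)
  then have inc: "incseq \<rho>" by (rule incseq_SucI)
  have "\<rho> n \<le> d 0" for n
    using submult[of n 0] pos[of n] by (simp add: \<rho>_def field_simps)
  then obtain r where r: "\<rho> \<longlonglongrightarrow> r" "\<And>n. \<rho> n \<le> r"
    using incseq_convergent[OF inc, of "d 0"] by blast
  have r0: "r > 0"
    using r(2)[of 0] pos[of 0] pos[of 1] by (smt (verit) \<rho>_def divide_pos_pos One_nat_def)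
  define E where "E n = d n / r ^ Suc n" for n
  have Epos: "E n > 0" for n using pos r0 by (simp add: E_def)
  have ratio: "E (Suc n) = E n * (\<rho> n / r)" for n
    using pos[of n] r0 by (simp add: E_def \<rho>_def field_simps)
  have "E (Suc n) \<le> E n" for n
    unfolding ratio using Epos[of n] r(2)[of n] r0 by (simp add: mult_le_cancel_left1 field_simps)
  then have dec: "decseq E" by (rule decseq_SucI)
  have ratio1: "(\<lambda>n. E (n + j) / E n) \<longlonglongrightarrow> 1" for j
  proof (induction j)
    case 0
    show ?case using Epos by (simp add: less_imp_neq[THEN not_sym])
  next
    case (Suc j)
    have "(\<lambda>n. \<rho> (n + j) / r) \<longlonglongrightarrow> r / r"
      by (intro tendsto_divide LIMSEQ_ignore_initial_segment[OF r(1)] tendsto_const) (use r0 in auto)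
    from tendsto_mult[OF Suc this] r0 show ?case
      by (simp add: ratio mult.commute)
  qed
  have E1: "E m \<ge> 1" for m
  proof (rule LIMSEQ_le_const2[OF ratio1[of "Suc m"]], intro exI allI impI)
    fix n
    have "E (n + Suc m) \<le> E n * E m"
      using submult[of n m] r0 unfolding E_def
      by (simp add: field_simps power_add)
    then show "E (n + Suc m) / E n \<le> E m" using Epos[of n] by (simp add: field_simps)
  qed
  then obtain L where L: "E \<longlonglongrightarrow> L" "\<And>i. L \<le> E i"
    using decseq_convergent[OF dec, of 1] by blast
  have "L \<ge> 1" by (rule LIMSEQ_le_const[OF L(1)]) (use E1 in auto)
  with that[OF r0] L(1) show thesis unfolding E_def by blast
qed

context haar_group
begin

text \<open>Fubini in the one form that \<open>measurable_difference\<close> supports: the variables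
  are mixed only inside the continuous \<open>\<phi>\<close>, and the integrand is dominated by a
  multiple of \<open>norm (f z)\<close>. Associativity, invariance under inversion and the product
  rule for Fourier coefficients all follow from it.\<close>

lemma double_integral_difference:
  fixes f \<phi> g :: "'g \<Rightarrow> complex"
  assumes f: "integrable m f" and \<phi>: "continuous_on UNIV \<phi>" and g: "continuous_on UNIV g"
  shows "(LINT y|m. (LINT z|m. f z * \<phi> (y - z)) * g y) = (LINT z|m. f z * (LINT y|m. \<phi> (y - z) * g y))"
proof -
  obtain B where B: "B > 0" "\<And>x. norm (\<phi> x) \<le> B" using continuous_bounded[OF \<phi>] by blast
  obtain C where C: "C > 0" "\<And>x. norm (g x) \<le> C" using continuous_bounded[OF g] by blast
  have [measurable]: "f \<in> borel_measurable m" "g \<in> borel_measurable m"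
    using f g by (auto intro: continuous_measurable)
  note [measurable] = measurable_difference[OF \<phi>]
  have meas: "(\<lambda>p. f (snd p) * \<phi> (fst p - snd p) * g (fst p)) \<in> borel_measurable (m \<Otimes>\<^sub>M m)"
    by measurable
  have int_z: "integrable m (\<lambda>z. f z * \<phi> (y - z) * g y)" for y
    by (intro integrable_mult_left integrable_conv f \<phi>)
  have "integrable (m \<Otimes>\<^sub>M m) (\<lambda>p. f (snd p) * \<phi> (fst p - snd p) * g (fst p))"
  proof (rule pair.Fubini_integrable[OF meas])
    have "norm (LINT z|m. norm (f z * \<phi> (y - z) * g y)) \<le> (LINT z|m. norm (f z)) * B * C" for y
    proof -
      have "(LINT z|m. norm (f z * \<phi> (y - z) * g y)) \<le> (LINT z|m. norm (f z) * (B * C))"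
      proof (rule integral_mono)
        fix z
        have "norm (\<phi> (y - z)) * norm (g y) \<le> B * C" using B C by (intro mult_mono) (auto intro: less_imp_le)
        from mult_left_mono[OF this norm_ge_zero[of "f z"]]
        show "norm (f z * \<phi> (y - z) * g y) \<le> norm (f z) * (B * C)"
          by (simp add: norm_mult mult.assoc)
      qed (use int_z f in \<open>auto intro: integrable_norm\<close>)
      then show ?thesis by (simp add: mult.assoc)
    qed
    then show "integrable m (\<lambda>y. LINT z|m. norm (f (snd (y, z)) * \<phi> (fst (y, z) - snd (y, z)) * g (fst (y, z))))"
      by (intro haar.integrable_const_bound[of _ "(LINT z|m. norm (f z)) * B * C"])
        (auto simp: real_norm_def[symmetric] simp del: real_norm_def)
  qed (use int_z in simp)
  from pair.Fubini_integral[of "\<lambda>y z. f z * \<phi> (y - z) * g y"] this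
  have "(LINT z|m. (LINT y|m. f z * \<phi> (y - z) * g y)) = (LINT y|m. (LINT z|m. f z * \<phi> (y - z) * g y))"
    by (simp add: case_prod_beta')
  then show ?thesis
    by (simp add: mult.assoc flip: integral_mult_right_zero) (simp add: mult.assoc[symmetric])
qed

lemma conv_assoc:
  assumes f: "integrable m f" and \<phi>: "continuous_on UNIV \<phi>" and \<psi>: "continuous_on UNIV \<psi>"
  shows "conv (conv f \<phi>) \<psi> = conv f (conv \<phi> \<psi>)"
proof
  fix x
  have "(LINT y|m. \<phi> (y - z) * \<psi> (x - y)) = conv \<phi> \<psi> (x - z)" for z
  proof -
    have "(LINT y|m. \<phi> (y - z) * \<psi> (x - y)) = (LINT y|m. \<phi> ((z + y) - z) * \<psi> (x - (z + y)))"
      by (rule integral_translation[symmetric], rule continuous_measurable)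
        (intro continuous_intros continuous_diff \<phi> \<psi>)
    then show ?thesis by (simp add: conv_def diff_diff_add)
  qed
  then show "conv (conv f \<phi>) \<psi> x = conv f (conv \<phi> \<psi>) x"
    using double_integral_difference[OF f \<phi> continuous_diff(1)[OF \<psi>], of x] by (simp add: conv_def)
qed

text \<open>Invariance under inversion is not part of \<open>normalized_haar\<close>. Integrating
  \<open>\<phi> (y - z)\<close> over both variables gives the integral of
  \<open>\<phi> (- z)\<close> in one order and that of \<open>\<phi>\<close> in the other.\<close>

lemma integral_reflect:
  assumes \<phi>: "continuous_on UNIV (\<phi> :: 'g \<Rightarrow> complex)"
  shows "(LINT y|m. \<phi> (x - y)) = (LINT y|m. \<phi> y)"
proof -
  have *: "(LINT z|m. \<phi> (y - z)) = (LINT z|m. \<phi> (- z))" for y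
  proof -
    have "(LINT z|m. \<phi> (y - z)) = (LINT z|m. \<phi> (y - (y + z)))"
      by (rule integral_translation[symmetric], rule continuous_measurable) (intro continuous_diff \<phi>)
    then show ?thesis by simp
  qed
  have "(LINT z|m. \<phi> (- z)) = (LINT y|m. \<phi> y)"
    using double_integral_difference[of "\<lambda>_. 1" \<phi> "\<lambda>_. 1"] \<phi>
    by (simp add: * integral_translation_diff continuous_measurable)
  then show ?thesis using * by simp
qed

lemma conv_commute:
  assumes \<phi>: "continuous_on UNIV \<phi>" and \<psi>: "continuous_on UNIV \<psi>"
  shows "conv \<phi> \<psi> = conv \<psi> \<phi>"
proof
  fix x
  have "conv \<phi> \<psi> x = (LINT y|m. \<phi> (x - y) * \<psi> (x - (x - y)))"
    unfolding conv_def
    by (rule integral_reflect[symmetric]) (intro continuous_intros continuous_diff \<phi> \<psi>)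
  then show "conv \<phi> \<psi> x = conv \<psi> \<phi> x" by (simp add: conv_def mult.commute)
qed

lemma conv_linear:
  assumes "continuous_on UNIV \<phi>" "continuous_on UNIV \<phi>'" "continuous_on UNIV \<psi>"
  shows "conv (\<lambda>x. a * \<phi> x + b * \<phi>' x) \<psi> = (\<lambda>x. a * conv \<phi> \<psi> x + b * conv \<phi>' \<psi> x)"
proof
  fix x
  have i: "integrable m (\<lambda>y. \<phi> y * \<psi> (x - y))" "integrable m (\<lambda>y. \<phi>' y * \<psi> (x - y))"
    using assms by (auto intro: integrable_conv continuous_integrable)
  show "conv (\<lambda>x. a * \<phi> x + b * \<phi>' x) \<psi> x = a * conv \<phi> \<psi> x + b * conv \<phi>' \<psi> x"
    unfolding conv_def distrib_right mult.assoc
    by (subst Bochner_Integration.integral_add) (use i in auto)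
qed

lemma conv_scale:
  assumes "continuous_on UNIV \<phi>" "continuous_on UNIV \<psi>"
  shows "conv (\<lambda>x. a * \<phi> x) \<psi> = (\<lambda>x. a * conv \<phi> \<psi> x)"
  using conv_linear[OF assms(1,1,2), of a 0] by simp

section \<open>The involution and the squared L2 norm\<close>

definition star :: "('g \<Rightarrow> complex) \<Rightarrow> 'g \<Rightarrow> complex" where
  "star \<phi> x = cnj (\<phi> (- x))"

definition nsq :: "('g \<Rightarrow> complex) \<Rightarrow> real" where
  "nsq \<phi> = (LINT x|m. (norm (\<phi> x))\<^sup>2)"

lemma continuous_star: "continuous_on UNIV \<phi> \<Longrightarrow> continuous_on UNIV (star \<phi>)"
  unfolding star_def by (rule continuous_diff)

lemma star_star [simp]: "star (star \<phi>) = \<phi>"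
  by (simp add: star_def fun_eq_iff)

lemma star_conv:
  assumes \<phi>: "continuous_on UNIV \<phi>" and \<psi>: "continuous_on UNIV \<psi>"
  shows "star (conv \<phi> \<psi>) = conv (star \<phi>) (star \<psi>)"
proof
  fix x
  have "star (conv \<phi> \<psi>) x = (LINT y|m. cnj (\<phi> y * \<psi> (- x - y)))"
    unfolding star_def conv_def Bochner_Integration.integral_cnj ..
  also have "\<dots> = (LINT y|m. cnj (\<phi> (0 - y) * \<psi> (- x - (0 - y))))"
    by (rule integral_reflect[symmetric]) (intro continuous_intros continuous_diff \<phi> \<psi>)
  finally show "star (conv \<phi> \<psi>) x = conv (star \<phi>) (star \<psi>) x"
    by (simp add: star_def conv_def)
qed

lemma nsq_nonneg: "nsq \<phi> \<ge> 0"
  by (simp add: nsq_def)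

lemma integrable_square:
  assumes "continuous_on UNIV (\<phi> :: 'g \<Rightarrow> complex)"
  shows "integrable m (\<lambda>x. (norm (\<phi> x))\<^sup>2)"
  using integrable_norm[OF continuous_integrable[of "\<lambda>x. \<phi> x * \<phi> x"]] assms
  by (auto simp: norm_mult power2_eq_square intro: continuous_intros)

lemma of_real_nsq: "of_real (nsq \<phi>) = (LINT x|m. \<phi> x * cnj (\<phi> x))"
  unfolding nsq_def by (simp add: complex_norm_square[symmetric] flip: integral_complex_of_real)

lemma conv_star_zero: "conv \<phi> (star \<psi>) 0 = (LINT x|m. \<phi> x * cnj (\<psi> x))"
  by (simp add: conv_def star_def)

lemma nsq_eq_conv_star: "of_real (nsq \<phi>) = conv \<phi> (star \<phi>) 0"
  by (simp add: conv_star_zero of_real_nsq)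

text \<open>A nonempty open set has positive Haar measure, because finitely many of its translates
  cover the compact group. Hence the open set where \<open>\<phi>\<close> does not vanish must be
  empty if it is null.\<close>

lemma nsq_eq_0:
  assumes \<phi>: "continuous_on UNIV \<phi>" and "nsq \<phi> = 0"
  shows "\<phi> = (\<lambda>_. 0)"
proof (rule ccontr)
  assume "\<phi> \<noteq> (\<lambda>_. 0)"
  then obtain x0 where x0: "\<phi> x0 \<noteq> 0" by auto
  define U where "U = {x. \<phi> x \<noteq> 0}"
  have U: "open U" unfolding U_def by (intro open_Collect_neq \<phi> continuous_intros)
  have [measurable]: "\<phi> \<in> borel_measurable m" using \<phi> by (rule continuous_measurable)
  have "AE x in m. (norm (\<phi> x))\<^sup>2 = 0"
    using assms(2) integral_nonneg_eq_0_iff_AE[OF integrable_square[OF \<phi>]] by (simp add: nsq_def)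
  then have "AE x in m. x \<notin> U" by (simp add: U_def)
  then have U0: "emeasure m U = 0"
    using U by (subst (asm) AE_iff_measurable[of U]) (auto simp: sets_haar)
  have Ut: "open ((+) a ` U)" "emeasure m ((+) a ` U) = 0" for a
  proof -
    have "(+) a ` U = (\<lambda>x. - a + x) -` U"
      by (auto simp: image_iff intro!: bexI[of _ "- a + _"])
    also have "open \<dots>"
      by (intro open_vimage U continuous_intros)
    finally show "open ((+) a ` U)" .
    show "emeasure m ((+) a ` U) = 0"
      using U0 U haar by (simp add: normalized_haar_def)
  qed
  obtain D where D: "finite D" "UNIV \<subseteq> (\<Union>x\<in>D. (+) (x - x0) ` U)"
  proof (rule compactE_image[OF compact_group, of UNIV "\<lambda>x. (+) (x - x0) ` U"])
    show "UNIV \<subseteq> (\<Union>x\<in>UNIV. (+) (x - x0) ` U)"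
    proof
      fix x show "x \<in> (\<Union>x\<in>UNIV. (+) (x - x0) ` U)"
        using x0 by (intro UN_I[of x] image_eqI[of _ _ x0]) (auto simp: U_def)
    qed
  qed (use Ut in auto)
  have "emeasure m UNIV \<le> (\<Sum>x\<in>D. emeasure m ((+) (x - x0) ` U))"
    using D emeasure_subadditive_finite[OF D(1), of "\<lambda>x. (+) (x - x0) ` U" m] Ut
    by (simp add: sets_haar top.extremum_unique image_subset_iff)
  also have "\<dots> = 0" using Ut by simp
  finally show False using haar by (simp add: normalized_haar_def)
qed

lemma Cauchy_Schwarz:
  assumes \<phi>: "continuous_on UNIV \<phi>" and \<psi>: "continuous_on UNIV \<psi>"
  shows "norm (LINT x|m. \<phi> x * \<psi> x) \<le> sqrt (nsq \<phi>) * sqrt (nsq \<psi>)"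
proof -
  define C where "C = (LINT x|m. norm (\<phi> x) * norm (\<psi> x))"
  have iC: "integrable m (\<lambda>x. norm (\<phi> x) * norm (\<psi> x))"
    using integrable_norm[OF continuous_integrable[of "\<lambda>x. \<phi> x * \<psi> x"]] \<phi> \<psi>
    by (auto simp: norm_mult intro: continuous_intros)
  have C0: "C \<ge> 0" by (simp add: C_def)
  have quad: "0 \<le> nsq \<phi> - 2 * t * C + t\<^sup>2 * nsq \<psi>" for t
  proof -
    have "0 \<le> (LINT x|m. (norm (\<phi> x))\<^sup>2 - 2 * t * (norm (\<phi> x) * norm (\<psi> x)) + t\<^sup>2 * (norm (\<psi> x))\<^sup>2)"
    proof (rule Bochner_Integration.integral_nonneg)
      fix x
      have "(norm (\<phi> x))\<^sup>2 - 2 * t * (norm (\<phi> x) * norm (\<psi> x)) + t\<^sup>2 * (norm (\<psi> x))\<^sup>2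
        = (norm (\<phi> x) - t * norm (\<psi> x))\<^sup>2"
        by (simp add: power2_eq_square algebra_simps)
      then show "0 \<le> (norm (\<phi> x))\<^sup>2 - 2 * t * (norm (\<phi> x) * norm (\<psi> x)) + t\<^sup>2 * (norm (\<psi> x))\<^sup>2"
        by simp
    qed
    also have "\<dots> = nsq \<phi> - 2 * t * C + t\<^sup>2 * nsq \<psi>"
      using integrable_square[OF \<phi>] integrable_square[OF \<psi>] iC by (simp add: nsq_def C_def)
    finally show ?thesis .
  qed
  have "C\<^sup>2 \<le> nsq \<phi> * nsq \<psi>"
  proof (cases "nsq \<psi> = 0")
    case True
    then have "\<psi> = (\<lambda>_. 0)" by (rule nsq_eq_0[OF \<psi>])
    then show ?thesis by (simp add: C_def nsq_def)
  next
    case False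
    then have "nsq \<psi> > 0" using nsq_nonneg[of \<psi>] by simp
    \<comment> \<open>This value of \<open>t\<close> minimizes the quadratic.\<close>
    then show ?thesis using quad[of "C / nsq \<psi>"] by (simp add: power2_eq_square field_simps)
  qed
  then have "C \<le> sqrt (nsq \<phi> * nsq \<psi>)" by (rule real_le_rsqrt)
  moreover have "norm (LINT x|m. \<phi> x * \<psi> x) \<le> C"
    unfolding C_def norm_mult[symmetric] by (rule integral_norm_bound)
  ultimately show ?thesis by (simp add: real_sqrt_mult)
qed

text \<open>The bridge from L2 to the sup norm: convolving an L2-Cauchy sequence of continuous
  functions with a fixed continuous function makes it uniformly Cauchy.\<close>

lemma norm_conv_le_nsq:
  assumes \<phi>: "continuous_on UNIV \<phi>" and \<psi>: "continuous_on UNIV \<psi>"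
  shows "norm (conv \<phi> \<psi> x) \<le> sqrt (nsq \<phi>) * sqrt (nsq \<psi>)"
proof -
  have "of_real (nsq (\<lambda>y. \<psi> (x - y))) = (of_real (nsq \<psi>) :: complex)"
    unfolding of_real_nsq by (rule integral_reflect) (intro continuous_intros \<psi>)
  then show ?thesis
    using Cauchy_Schwarz[OF \<phi> continuous_diff(1)[OF \<psi>], of x] by (simp add: conv_def)
qed

lemma nsq_le_sup:
  assumes \<phi>: "continuous_on UNIV \<phi>" and B: "\<And>x. norm (\<phi> x) \<le> B"
  shows "nsq \<phi> \<le> B\<^sup>2"
proof -
  have "nsq \<phi> \<le> (LINT x|m. B\<^sup>2)"
    unfolding nsq_def by (rule integral_mono) (use integrable_square[OF \<phi>] B in \<open>auto intro: power_mono\<close>)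
  then show ?thesis by simp
qed

text \<open>Convolution with such an \<open>e\<close> is a nonzero orthogonal projection on L2, and
  \<open>e 0\<close> is its trace.\<close>

definition idempotent :: "('g \<Rightarrow> complex) \<Rightarrow> bool" where
  "idempotent e \<longleftrightarrow> continuous_on UNIV e \<and> star e = e \<and> conv e e = e \<and> e \<noteq> (\<lambda>_. 0)"

text \<open>The convolution bound applied to \<open>e = conv e e\<close> gives the sup bound; as the
  total mass is 1, it yields \<open>nsq e \<le> (nsq e)\<^sup>2\<close>. The resulting lower bound 1
  is what stops the descent to a minimal idempotent.\<close>

lemma idempotent_zero:
  assumes "idempotent e"
  shows "e 0 = of_real (nsq e)" "norm (e x) \<le> nsq e" "nsq e \<ge> 1"
proof -
  have e: "continuous_on UNIV e" "star e = e" "conv e e = e" "e \<noteq> (\<lambda>_. 0)"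
    using assms by (auto simp: idempotent_def)
  show "e 0 = of_real (nsq e)"
    using nsq_eq_conv_star[of e] by (simp add: e)
  show *: "norm (e x) \<le> nsq e" for x
    using norm_conv_le_nsq[OF e(1,1), of x] nsq_nonneg[of e] by (simp add: e(3))
  have "nsq e \<noteq> 0" using nsq_eq_0[OF e(1)] e(4) by auto
  moreover have "nsq e \<le> (nsq e)\<^sup>2" by (rule nsq_le_sup[OF e(1) *])
  ultimately show "nsq e \<ge> 1"
    using nsq_nonneg[of e] by (simp add: power2_eq_square mult_le_cancel_left1)
qed

text \<open>In spectral terms, \<open>(h * h)\<^sup>n / r\<^sup>n\<close> converges to the projection onto the eigenspace of
  the largest eigenvalue \<open>r\<close> of convolution by \<open>h * h\<close>.\<close>

lemma top_idempotent:
  assumes h: "continuous_on UNIV h" and herm: "star h = h" and nz: "h \<noteq> (\<lambda>_. 0)"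
  obtains e r where "idempotent e" "r > 0" "conv (conv h h) e = (\<lambda>x. of_real r * e x)"
proof -
  note ci = continuous_integrable
  define q where "q = conv h h"
  have q: "continuous_on UNIV q" unfolding q_def by (intro continuous_conv ci h)
  \<comment> \<open>\<open>P n\<close> is the convolution power of \<open>h\<close> with
    \<open>n + 1\<close> factors; hence the \<open>+ 1\<close> in the index rule \<open>PP\<close>
    and everywhere below.\<close>
  define P where "P n = ((\<lambda>\<phi>. conv h \<phi>) ^^ n) h" for n
  have P0: "P 0 = h" and PS: "P (Suc n) = conv h (P n)" for n by (simp_all add: P_def)
  have Pc: "continuous_on UNIV (P n)" for n
    by (induction n) (auto simp: P0 PS intro!: continuous_conv ci h)
  have Ph: "star (P n) = P n" for n
    by (induction n) (simp_all add: P0 PS herm star_conv h Pc)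
  have PP: "conv (P n) (P k) = P (n + k + 1)" for n k
    by (induction n) (simp_all add: P0 PS conv_assoc ci h Pc)
  define d where "d n = nsq (P n)" for n
  have d_P: "complex_of_real (d n) = P (2 * n + 1) 0" for n
    using nsq_eq_conv_star[of "P n"] by (simp add: d_def Ph PP mult_2)
  have inner: "(LINT x|m. P n x * cnj (P k x)) = P (n + k + 1) 0" for n k
    using conv_star_zero[of "P n" "P k"] by (simp add: Ph PP)
  have nzS: "conv h \<phi> \<noteq> (\<lambda>_. 0)" if "conv h \<phi> 0 \<noteq> 0" for \<phi> using that by auto
  \<comment> \<open>Two consecutive powers are carried along: the squared norm of
    \<open>P (Suc n)\<close> is the inner product of \<open>P n\<close> and
    \<open>P (n + 2)\<close>, so the latter cannot vanish either.\<close>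
  have Pnz: "P n \<noteq> (\<lambda>_. 0) \<and> P (Suc n) \<noteq> (\<lambda>_. 0)" for n
  proof (induction n)
    case 0
    have "complex_of_real (nsq h) = P (Suc 0) 0" using d_P[of 0] by (simp add: d_def P0)
    then show ?case using nz nsq_eq_0[OF h] by (auto simp: P0)
  next
    case (Suc n)
    have "complex_of_real (d (Suc n)) = (LINT x|m. P n x * cnj (P (n + 2) x))"
      by (simp add: d_P inner mult_2)
    moreover have "d (Suc n) \<noteq> 0" using Suc nsq_eq_0[OF Pc] by (auto simp: d_def)
    ultimately show ?case using Suc by auto
  qed
  have dpos: "d n > 0" for n
    using Pnz[of n] nsq_eq_0[OF Pc[of n]] nsq_nonneg[of "P n"] unfolding d_def by linarith
  \<comment> \<open>Log-convexity is the Cauchy-Schwarz inequality for the same inner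
    product.\<close>
  have "(d (Suc n))\<^sup>2 \<le> d n * d (Suc (Suc n))" for n
  proof -
    have "complex_of_real (d (Suc n)) = (LINT x|m. P n x * cnj (P (n + 2) x))"
      by (simp add: d_P inner mult_2)
    then have "complex_of_real (d (Suc n)) = (LINT x|m. P n x * star (P (n + 2)) (0 - x))"
      by (simp add: star_def)
    then have "complex_of_real (d (Suc n)) = conv (P n) (P (n + 2)) 0"
      by (simp only: Ph) (simp add: conv_def)
    then have "norm (complex_of_real (d (Suc n))) \<le> sqrt (d n) * sqrt (d (n + 2))"
      using norm_conv_le_nsq[OF Pc Pc, of n "n + 2" 0] by (simp only: d_def)
    then have "d (Suc n) \<le> sqrt (d n) * sqrt (d (n + 2))"
      using dpos[of "Suc n"] by simp
    then have "(d (Suc n))\<^sup>2 \<le> (sqrt (d n) * sqrt (d (n + 2)))\<^sup>2"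
      using dpos[of "Suc n"] by (intro power_mono) auto
    then show ?thesis using dpos[of n] dpos[of "n + 2"] by (simp add: power_mult_distrib)
  qed
  moreover have sup: "norm (P (2 * n + 1) x) \<le> d n" for n x
    using norm_conv_le_nsq[OF Pc Pc, of n n x] dpos[of n] by (simp add: PP d_def mult_2)
  \<comment> \<open>The left side is the value at 0 of the convolution of
    \<open>P (2 * n + 1)\<close> and \<open>P (2 * k + 1)\<close>. By \<open>sup\<close>, and since
    the total mass is 1, their L2 norms are at most \<open>d n\<close> and
    \<open>d k\<close>.\<close>
  have "d (n + k + 1) \<le> d n * d k" for n k
  proof -
    have "complex_of_real (d (n + k + 1)) = conv (P (2 * n + 1)) (P (2 * k + 1)) 0"
      unfolding d_P PP by (simp add: algebra_simps)
    then have "norm (complex_of_real (d (n + k + 1))) \<le> sqrt (nsq (P (2 * n + 1))) * sqrt (nsq (P (2 * k + 1)))"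
      using norm_conv_le_nsq[OF Pc Pc] by simp
    also have "\<dots> \<le> sqrt ((d n)\<^sup>2) * sqrt ((d k)\<^sup>2)"
      by (intro mult_mono real_sqrt_le_mono nsq_le_sup Pc sup) (auto simp: nsq_nonneg)
    finally show ?thesis using dpos less_imp_le[OF dpos] by simp
  qed
  ultimately obtain r L where r: "r > 0" and L: "L \<ge> 1" and lim: "(\<lambda>n. d n / r ^ Suc n) \<longlonglongrightarrow> L"
    using log_convex_submultiplicative_limit[of d] dpos by metis
  \<comment> \<open>Only the odd indices, that is, the powers of \<open>h * h\<close>, are used: a
    negative eigenvalue of convolution by \<open>h\<close> would make the powers of \<open>h\<close>
    itself alternate in sign.\<close>
  define s where "s n = (\<lambda>x. of_real (1 / r ^ Suc n) * P (2 * n + 1) x)" for n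
  have sc: "continuous_on UNIV (s n)" for n
    unfolding s_def by (intro continuous_intros Pc)
  have sh: "star (s n) = s n" for n
    using Ph[of "2 * n + 1"] by (simp add: s_def star_def fun_eq_iff)
  have ss: "conv (s n) (s k) = s (n + k + 1)" for n k
  proof -
    have "conv (s n) (s k) = (\<lambda>x. of_real (1 / r ^ Suc n) * conv (P (2 * n + 1)) (s k) x)"
      unfolding s_def[of n] by (intro conv_scale Pc sc)
    also have "conv (P (2 * n + 1)) (s k) = conv (s k) (P (2 * n + 1))"
      by (intro conv_commute Pc sc)
    also have "\<dots> = (\<lambda>x. of_real (1 / r ^ Suc k) * P (2 * (n + k + 1) + 1) x)"
      unfolding s_def[of k] by (subst conv_scale) (simp_all add: Pc PP algebra_simps)
    finally show ?thesis unfolding s_def by (auto simp: fun_eq_iff power_add)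
  qed
  define E where "E n = d n / r ^ Suc n" for n
  have s0: "s n 0 = of_real (E n)" for n
    using d_P[of n] by (simp add: s_def E_def)
  \<comment> \<open>All three values of \<open>E\<close> on the right tend to the same
    \<open>L\<close>, with coefficients 1, -2, 1; this is the Cauchy property in L2.\<close>
  have nsq_diff: "nsq (\<lambda>x. s n x - s k x) = E (2 * n + 1) - 2 * E (n + k + 1) + E (2 * k + 1)" for n k
  proof -
    have star_d: "star (\<lambda>x. s n x - s k x) = (\<lambda>x. s n x - s k x)"
      using sh[of n] sh[of k] by (simp add: star_def fun_eq_iff)
    have lin: "conv (\<lambda>x. s n x - s k x) \<phi> = (\<lambda>x. conv (s n) \<phi> x - conv (s k) \<phi> x)"
      if "continuous_on UNIV \<phi>" for \<phi>
      using conv_linear[OF sc sc that, of 1 n "-1" k] by simp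
    have "complex_of_real (nsq (\<lambda>x. s n x - s k x)) = conv (\<lambda>x. s n x - s k x) (\<lambda>x. s n x - s k x) 0"
      by (simp add: nsq_eq_conv_star star_d)
    also have "\<dots> = conv (\<lambda>x. s n x - s k x) (s n) 0 - conv (\<lambda>x. s n x - s k x) (s k) 0"
      using lin[OF continuous_on_diff[OF sc[of n] sc[of k]]]
        conv_commute[OF sc[of n] continuous_on_diff[OF sc[of n] sc[of k]]]
        conv_commute[OF sc[of k] continuous_on_diff[OF sc[of n] sc[of k]]] by metis
    also have "\<dots> = of_real (E (2 * n + 1) - 2 * E (n + k + 1) + E (2 * k + 1))"
      by (simp add: lin sc ss s0 add.commute[of k n] flip: mult_2)
    finally show ?thesis by (simp only: of_real_eq_iff)
  qed
  have EL: "E \<longlonglongrightarrow> L" using lim unfolding E_def .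
  \<comment> \<open>The shift matters: \<open>s (Suc n)\<close> is \<open>s n\<close> convolved with
    \<open>s 0\<close>, and this extra convolution turns L2 convergence into uniform
    convergence.\<close>
  have "uniformly_Cauchy_on UNIV (\<lambda>n. s (Suc n))"
    unfolding uniformly_Cauchy_on_def
  proof (intro allI impI)
    fix \<epsilon> :: real assume "\<epsilon> > 0"
    define c where "c = sqrt (nsq (s 0)) + 1"
    have c: "c > 0" by (simp add: c_def add_nonneg_pos nsq_nonneg)
    \<comment> \<open>The coefficients in \<open>nsq_diff\<close> have absolute sum 4, so that
      errors below \<open>\<delta>\<close> add up to less than the square of
      \<open>\<epsilon> / c\<close>.\<close>
    define \<delta> where "\<delta> = (\<epsilon> / c)\<^sup>2 / 4"
    have "\<delta> > 0" using \<open>\<epsilon> > 0\<close> c by (simp add: \<delta>_def)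
    then obtain M where M: "\<And>n. n \<ge> M \<Longrightarrow> \<bar>E n - L\<bar> < \<delta>"
      using LIMSEQ_D[OF EL, of \<delta>] by (auto simp: real_norm_def)
    have "dist (s (Suc n) x) (s (Suc k) x) < \<epsilon>" if "n \<ge> M" "k \<ge> M" for x n k
    proof -
      have "nsq (\<lambda>x. s n x - s k x) < 4 * \<delta>"
        unfolding nsq_diff using M[of "2 * n + 1"] M[of "n + k + 1"] M[of "2 * k + 1"] that by simp
      then have *: "sqrt (nsq (\<lambda>x. s n x - s k x)) < \<epsilon> / c"
        using \<open>\<epsilon> > 0\<close> c by (simp add: \<delta>_def real_less_lsqrt real_sqrt_less_iff)
      have "s (Suc n) x - s (Suc k) x = conv (\<lambda>x. s n x - s k x) (s 0) x"
        using conv_linear[OF sc sc sc, of 1 n "-1" k 0] ss[of n 0] ss[of k 0] by simp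
      also have "\<dots> = conv (s 0) (\<lambda>x. s n x - s k x) x"
        by (subst conv_commute[OF continuous_on_diff[OF sc[of n] sc[of k]] sc[of 0]]) (rule refl)
      also have "norm \<dots> \<le> sqrt (nsq (s 0)) * sqrt (nsq (\<lambda>x. s n x - s k x))"
        by (intro norm_conv_le_nsq continuous_on_diff sc)
      also have "\<dots> \<le> sqrt (nsq (s 0)) * (\<epsilon> / c)"
        using * by (intro mult_left_mono) (auto simp: nsq_nonneg)
      also have "\<dots> < \<epsilon>" using \<open>\<epsilon> > 0\<close> c by (simp add: c_def field_simps)
      finally show ?thesis by (simp add: dist_norm)
    qed
    then show "\<exists>M. \<forall>x\<in>UNIV. \<forall>n\<ge>M. \<forall>k\<ge>M. dist (s (Suc n) x) (s (Suc k) x) < \<epsilon>" by blast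
  qed
  then have "uniformly_convergent_on UNIV (\<lambda>n. s (Suc n))"
    by (simp add: uniformly_convergent_eq_Cauchy)
  then obtain e where e_unif: "uniform_limit UNIV (\<lambda>n. s (Suc n)) e sequentially"
    by (auto simp: uniformly_convergent_on_def)
  have ec: "continuous_on UNIV e"
    by (rule uniform_limit_theorem[OF _ e_unif]) (auto simp: sc)
  have e_lim: "(\<lambda>n. s (Suc n) x) \<longlonglongrightarrow> e x" for x
    using e_unif by (rule tendsto_uniform_limitI) simp
  have eh: "star e = e"
  proof
    fix x
    have "(\<lambda>n. cnj (s (Suc n) (- x))) \<longlonglongrightarrow> cnj (e (- x))"
      by (intro tendsto_cnj e_lim)
    moreover have "cnj (s (Suc n) (- x)) = s (Suc n) x" for n
      using sh[of "Suc n"] by (simp add: star_def fun_eq_iff)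
    ultimately show "star e x = e x"
      using e_lim[of x] by (simp add: star_def LIMSEQ_unique)
  qed
  have conv_lim: "(\<lambda>n. conv (s (Suc n)) \<phi> x) \<longlonglongrightarrow> conv e \<phi> x" if \<phi>: "continuous_on UNIV \<phi>" for \<phi> x
  proof -
    have "(\<lambda>n. conv (s (Suc n)) \<phi> x - conv e \<phi> x) \<longlonglongrightarrow> 0"
    proof (rule tendstoI)
      fix \<epsilon> :: real assume "\<epsilon> > 0"
      define A where "A = (LINT y|m. norm (\<phi> y)) + 1"
      have A: "A > 0" unfolding A_def by (simp add: add_nonneg_pos)
      have "\<forall>\<^sub>F n in sequentially. \<forall>x\<in>UNIV. dist (s (Suc n) x) (e x) < \<epsilon> / A"
        using e_unif A \<open>\<epsilon> > 0\<close> by (auto simp: uniform_limit_iff)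
      then show "\<forall>\<^sub>F n in sequentially. dist (conv (s (Suc n)) \<phi> x - conv e \<phi> x) 0 < \<epsilon>"
      proof (rule eventually_mono)
        fix n assume "\<forall>x\<in>UNIV. dist (s (Suc n) x) (e x) < \<epsilon> / A"
        then have b: "norm (s (Suc n) x - e x) \<le> \<epsilon> / A" for x by (auto simp: dist_norm less_imp_le)
        have "conv (s (Suc n)) \<phi> x - conv e \<phi> x = conv (\<lambda>x. s (Suc n) x - e x) \<phi> x"
          using conv_linear[OF sc ec \<phi>, of 1 "Suc n" "-1"] by simp
        also have "\<dots> = conv \<phi> (\<lambda>x. s (Suc n) x - e x) x"
          by (subst conv_commute) (auto intro: \<phi> sc ec continuous_on_diff)
        also have "norm \<dots> \<le> \<epsilon> / A * (LINT y|m. norm (\<phi> y))"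
          by (rule norm_conv_le) (use b in \<open>auto intro: ci \<phi> sc ec continuous_on_diff\<close>)
        also have "\<dots> = \<epsilon> / A * (A - 1)" by (simp add: A_def)
        also have "\<dots> < \<epsilon>" using A \<open>\<epsilon> > 0\<close> by (simp add: field_simps)
        finally show "dist (conv (s (Suc n)) \<phi> x - conv e \<phi> x) 0 < \<epsilon>" by simp
      qed
    qed
    then show ?thesis by (rule LIM_zero_cancel)
  qed
  have se: "conv (s k) e = e" for k
  proof
    fix x
    have "(\<lambda>n. conv (s (Suc n)) (s k) x) \<longlonglongrightarrow> conv e (s k) x" by (rule conv_lim[OF sc])
    moreover have "(\<lambda>n. conv (s (Suc n)) (s k) x) \<longlonglongrightarrow> e x"
      using LIMSEQ_ignore_initial_segment[OF e_lim[of x], of "k + 1"] by (simp add: ss)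
    ultimately show "conv (s k) e x = e x"
      using LIMSEQ_unique conv_commute[OF sc ec] by metis
  qed
  have ee: "conv e e = e"
  proof
    fix x
    have "(\<lambda>n. conv (s (Suc n)) e x) \<longlonglongrightarrow> conv e e x" by (rule conv_lim[OF ec])
    then show "conv e e x = e x" unfolding se by (simp add: LIMSEQ_const_iff)
  qed
  have "(\<lambda>n. s (Suc n) 0) \<longlonglongrightarrow> of_real L"
    unfolding s0 by (intro tendsto_of_real LIMSEQ_Suc EL)
  then have "e 0 = of_real L" using e_lim[of 0] LIMSEQ_unique by blast
  \<comment> \<open>Here the bound \<open>L \<ge> 1\<close> excludes a vanishing limit.\<close>
  then have "e \<noteq> (\<lambda>_. 0)" using L by auto
  then have "idempotent e" by (simp add: idempotent_def ec eh ee)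
  moreover have "conv (conv h h) e = (\<lambda>x. of_real r * e x)"
  proof -
    have "conv h h = (\<lambda>x. of_real r * s 0 x)"
      using r PS[of 0] by (simp add: s_def P0 fun_eq_iff)
    then show ?thesis using conv_scale[OF sc ec, of "of_real r" 0] by (simp add: se)
  qed
  ultimately show thesis using that r by blast
qed

end

text \<open>The error lives on \<open>U - K\<close> and is at most 1 there, so regularity of a
  measure turns it into a small integral. The same statement serves Haar and Lebesgue
  measure.\<close>

lemma Urysohn_indicator:
  fixes A :: "'a::topological_space set"
  assumes normal: "normal_space (euclidean :: 'a topology)"
    and KU: "closed K" "open U" "K \<subseteq> A" "A \<subseteq> U"
  obtains \<phi> :: "'a \<Rightarrow> real" where "continuous_on UNIV \<phi>" "\<And>x. 0 \<le> \<phi> x \<and> \<phi> x \<le> 1"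
    "\<And>x. \<bar>indicator A x - \<phi> x\<bar> \<le> indicator (U - K) x"
proof -
  have "disjnt (- U) K" using KU by (auto simp: disjnt_def)
  then obtain \<phi> where \<phi>: "continuous_map euclidean (top_of_set {0..1::real}) \<phi>" "\<phi> ` (- U) \<subseteq> {0}" "\<phi> ` K \<subseteq> {1}"
    using Urysohn_lemma[OF normal, of "- U" K 0 1] KU by auto
  have c: "continuous_on UNIV \<phi>" and b: "\<And>x. 0 \<le> \<phi> x \<and> \<phi> x \<le> 1"
    using \<phi>(1) by (auto simp: continuous_map_in_subtopology image_subset_iff)
  have "\<bar>indicator A x - \<phi> x\<bar> \<le> indicator (U - K) x" for x
    using b[of x] \<phi>(2,3) KU(3,4) by (auto simp: indicator_def)
  with that c b show thesis by blast
qed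

context haar_group
begin

text \<open>Descent on the natural number \<open>nat \<lfloor>nsq e\<rfloor>\<close>. The condition
  \<open>conv e' e = e'\<close> says that \<open>e'\<close> lies below \<open>e\<close> as a
  projection. If \<open>e' \<noteq> e\<close>, the difference \<open>v\<close> is again idempotent,
  and \<open>nsq v = nsq e - nsq e'\<close> is at least 1, so the floor drops.\<close>

lemma minimal_idempotent:
  assumes e1: "idempotent e1"
  obtains e where "idempotent e" "conv e e1 = e"
    "\<And>e'. idempotent e' \<Longrightarrow> conv e' e = e' \<Longrightarrow> e' = e"
proof -
  define Q where "Q e \<longleftrightarrow> idempotent e \<and> conv e e1 = e" for e
  have "Q e1" using e1 by (simp add: Q_def idempotent_def)
  then obtain e where e: "Q e" and min: "\<And>e'. Q e' \<Longrightarrow> nat \<lfloor>nsq e\<rfloor> \<le> nat \<lfloor>nsq e'\<rfloor>"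
    using ex_has_least_nat[of Q e1 "\<lambda>e. nat \<lfloor>nsq e\<rfloor>"] by blast
  have "e' = e" if e': "idempotent e'" and le: "conv e' e = e'" for e'
  proof (rule ccontr)
    assume "e' \<noteq> e"
    have E: "continuous_on UNIV e" "star e = e" "conv e e = e" "conv e e1 = e"
      and E': "continuous_on UNIV e'" "star e' = e'" "conv e' e' = e'" and e1c: "continuous_on UNIV e1"
      using e e' e1 by (auto simp: Q_def idempotent_def)
    have "conv e' e1 = e'"
      using conv_assoc[OF continuous_integrable[OF E'(1)] E(1) e1c] by (simp add: le E(4))
    then have "Q e'" by (simp add: Q_def e')
    define v where "v = (\<lambda>x. e x - e' x)"
    have v: "continuous_on UNIV v" unfolding v_def by (intro continuous_on_diff E E')
    have lin: "conv v \<phi> = (\<lambda>x. conv e \<phi> x - conv e' \<phi> x)" if "continuous_on UNIV \<phi>" for \<phi>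
      using conv_linear[OF E(1) E'(1) that, of 1 "-1"] by (simp add: v_def)
    have "conv v v = (\<lambda>x. conv v e x - conv v e' x)"
      using lin[OF v] conv_commute[OF v E(1)] conv_commute[OF v E'(1)] by simp
    also have "\<dots> = v"
      using conv_commute[OF E(1) E'(1)] by (simp add: lin E E' le) (simp add: v_def)
    finally have "idempotent v"
      using v \<open>e' \<noteq> e\<close> E(2) E'(2) by (auto simp: idempotent_def v_def star_def fun_eq_iff dest: sym)
    from idempotent_zero(1,3)[OF this] idempotent_zero(1)[OF e'] idempotent_zero(1)[of e] e
    have "complex_of_real (nsq v) = of_real (nsq e - nsq e')" "nsq v \<ge> 1"
      by (auto simp: v_def Q_def)
    then have "nsq e' + 1 \<le> nsq e" by (simp only: of_real_eq_iff)
    then have "\<lfloor>nsq e'\<rfloor> + 1 \<le> \<lfloor>nsq e\<rfloor>" using floor_mono by fastforce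
    then show False using min[OF \<open>Q e'\<close>] nsq_nonneg[of e'] nsq_nonneg[of e] by linarith
  qed
  with e that show thesis by (auto simp: Q_def)
qed

text \<open>If \<open>p * p = r e\<close> then \<open>(e \<plusminus> p / \<surd>r) / 2\<close> are idempotents with sum \<open>e\<close>, so that one of
  them vanishes.\<close>

lemma minimal_scalar:
  assumes e: "idempotent e" and min: "\<And>e'. idempotent e' \<Longrightarrow> conv e' e = e' \<Longrightarrow> e' = e"
    and p: "continuous_on UNIV p" "star p = p" "conv p e = p"
  obtains c :: real where "p = (\<lambda>x. of_real c * e x)"
proof (cases "p = (\<lambda>_. 0)")
  case True
  then show thesis using that[of 0] by simp
next
  case False
  have E: "continuous_on UNIV e" "star e = e" "conv e e = e" using e by (auto simp: idempotent_def)
  note ci = continuous_integrable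
  have pp: "continuous_on UNIV (conv p p)" by (intro continuous_conv ci p)
  have ppe: "conv (conv p p) e = conv p p" using conv_assoc[OF ci[OF p(1)] p(1) E(1)] by (simp add: p)
  \<comment> \<open>The eigenvalue equation makes \<open>e'\<close> a multiple of
    \<open>conv (conv p p) e'\<close>, and convolution by \<open>e\<close> fixes
    \<open>conv p p\<close>. So \<open>e'\<close> lies below \<open>e\<close>, minimality gives
    \<open>e' = e\<close>, and the equation itself becomes \<open>conv p p = r e\<close>.\<close>
  obtain e' r where e': "idempotent e'" and r: "r > 0" "conv (conv p p) e' = (\<lambda>x. of_real r * e' x)"
    by (rule top_idempotent[OF p(1,2) False])
  have E': "continuous_on UNIV e'" using e' by (simp add: idempotent_def)
  have re': "e' = (\<lambda>x. of_real (1 / r) * conv (conv p p) e' x)" using r by (simp add: fun_eq_iff)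
  have "conv (conv (conv p p) e') e = conv (conv p p) e'"
  proof -
    have "conv (conv (conv p p) e') e = conv (conv p p) (conv e e')"
      using conv_assoc[OF ci[OF pp] E' E(1)] conv_commute[OF E' E(1)] by simp
    also have "\<dots> = conv (conv p p) e'"
      using conv_assoc[OF ci[OF pp] E(1) E'] by (simp add: ppe)
    finally show ?thesis .
  qed
  then have "conv e' e = e'"
    using conv_scale[OF E' E(1), of "of_real r"] r by (simp add: fun_eq_iff)
  then have "e' = e" by (rule min[OF e'])
  then have ppr: "conv p p = (\<lambda>x. of_real r * e x)" using r(2) ppe by simp
  define s where "s = sqrt r"
  have s: "s > 0" "s * s = r" using r by (auto simp: s_def)
  define w where "w b = (\<lambda>x. of_real (1 / 2) * e x + of_real (b / (2 * s)) * p x)" for b :: real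
  have wc: "continuous_on UNIV (w b)" for b unfolding w_def by (intro continuous_intros E p)
  have lin: "conv (w b) \<phi> = (\<lambda>x. of_real (1 / 2) * conv e \<phi> x + of_real (b / (2 * s)) * conv p \<phi> x)"
    if "continuous_on UNIV \<phi>" for \<phi> b
    unfolding w_def by (rule conv_linear[OF E(1) p(1) that])
  have we: "conv (w b) e = w b" for b
    unfolding lin[OF E(1)] E p by (simp add: w_def)
  have ww: "conv (w b) (w b) = w b" if "b * b = 1" for b
  proof
    fix x
    have "conv (w b) p x = of_real (1 / 2) * p x + of_real (b / (2 * s)) * (of_real r * e x)"
      using conv_commute[OF E(1) p(1)] by (simp add: lin[OF p(1)] p ppr)
    moreover have "conv (w b) (w b) x = of_real (1 / 2) * conv (w b) e x + of_real (b / (2 * s)) * conv (w b) p x"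
      using lin[OF wc] conv_commute[OF wc E(1)] conv_commute[OF wc p(1)] by simp
    ultimately have "conv (w b) (w b) x = of_real (1 / 2) * (of_real (1 / 2) * e x + of_real (b / (2 * s)) * p x)
      + of_real (b / (2 * s)) * (of_real (1 / 2) * p x + of_real (b / (2 * s)) * (of_real r * e x))"
      by (simp add: we) (simp add: w_def)
    also have "\<dots> = of_real (1/4 + b * b / 4) * e x + of_real (b / (2 * s)) * p x"
      using s by (simp add: field_simps flip: s(2))
    also have "\<dots> = w b x" by (simp add: w_def that)
    finally show "conv (w b) (w b) x = w b x" .
  qed
  have ws: "star (w b) = w b" for b
    using E(2) p(2) by (simp add: w_def star_def fun_eq_iff)
  have *: "w b = (\<lambda>_. 0) \<or> w b = e" if "b * b = 1" for b
    using min[of "w b"] ww[OF that] ws we wc by (auto simp: idempotent_def)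
  consider "w 1 = (\<lambda>_. 0)" | "w 1 = e"
    using *[of 1] by auto
  then show thesis
  proof cases
    case 1
    then have "p = (\<lambda>x. of_real (- s) * e x)"
      using s by (auto simp: w_def fun_eq_iff field_simps add_eq_0_iff)
    with that show thesis by blast
  next
    case 2
    then have "p = (\<lambda>x. of_real s * e x)"
      using s by (auto simp: w_def fun_eq_iff field_simps)
    with that show thesis by blast
  qed
qed

text \<open>Convolution by \<open>e\<close> fixes every translate of \<open>e\<close>, and hermitian
  combinations of translates are multiples of \<open>e\<close> by \<open>minimal_scalar\<close>.
  Hence every translate is a multiple of \<open>e\<close>, which is multiplicativity up to the
  factor \<open>e 0\<close>. The sup bound gives modulus at most 1 at \<open>x\<close> and at
  \<open>- x\<close>, where the values have product 1.\<close>

lemma character_of_minimal_idempotent: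
  assumes e: "idempotent e" and min: "\<And>e'. idempotent e' \<Longrightarrow> conv e' e = e' \<Longrightarrow> e' = e"
  shows "continuous_character (\<lambda>x. e x / e 0)"
proof -
  have E: "continuous_on UNIV e" "star e = e" "conv e e = e" using e by (auto simp: idempotent_def)
  have cnj_e: "cnj (e x) = e (- x)" for x using fun_cong[OF E(2), of "- x"] by (simp add: star_def)
  have shift: "conv (\<lambda>x. e (x - a)) e = (\<lambda>x. e (x - a))" for a
  proof -
    have "conv e (\<lambda>x. e (x - a)) x = conv e e (x - a)" for x
      by (simp add: conv_def algebra_simps)
    then show ?thesis
      using conv_commute[OF continuous_diff(2)[OF E(1)] E(1)] by (simp add: E fun_eq_iff)
  qed
  have e0: "e 0 \<noteq> 0" using idempotent_zero[OF e] by auto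
  have scal: "\<exists>c. \<forall>x. e (x - a) = c * e x" for a
  proof -
    \<comment> \<open>\<open>star\<close> exchanges the translates by \<open>a\<close> and
      \<open>- a\<close>, so \<open>p u (cnj u)\<close> is hermitian. The choices \<open>1/2\<close>
      and \<open>\<i>/2\<close> for \<open>u\<close> give, up to sign, the hermitian and skew parts
      of one translate.\<close>
    define p where "p u v = (\<lambda>x. u * e (x - a) + v * e (x - - a))" for u v :: complex
    have pc: "continuous_on UNIV (p u v)" for u v
      unfolding p_def by (intro continuous_intros continuous_diff E)
    have pe: "conv (p u v) e = p u v" for u v
      unfolding p_def by (subst conv_linear) (use continuous_diff(2)[OF E(1), of a] continuous_diff(2)[OF E(1), of "- a"] E(1) in \<open>auto simp: shift[of a] shift[of "- a", simplified]\<close>)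
    have ps: "star (p u (cnj u)) = p u (cnj u)" for u
      by (auto simp: p_def star_def fun_eq_iff cnj_e algebra_simps)
    obtain c1 where c1: "p (1/2) (1/2) = (\<lambda>x. of_real c1 * e x)"
      using minimal_scalar[OF e min pc _ pe, of "1/2" "1/2"] ps[of "1/2"] by auto
    obtain c2 where c2: "p (\<i>/2) (- \<i>/2) = (\<lambda>x. of_real c2 * e x)"
      using minimal_scalar[OF e min pc _ pe, of "\<i>/2" "- \<i>/2"] ps[of "\<i>/2"] by force
    have "e (x - a) = p (1/2) (1/2) x - \<i> * p (\<i>/2) (- \<i>/2) x" for x
      unfolding p_def by (simp add: field_simps)
    then have "e (x - a) = (of_real c1 - \<i> * of_real c2) * e x" for x
      unfolding c1 c2 by (simp add: left_diff_distrib)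
    then show ?thesis by blast
  qed
  have mult: "e (x + y) * e 0 = e x * e y" for x y
  proof -
    obtain c where c: "\<And>x. e (x - - y) = c * e x" using scal[of "- y"] by blast
    show ?thesis using c[of x] c[of 0] by simp
  qed
  define \<gamma> where "\<gamma> x = e x / e 0" for x
  have g_mult: "\<gamma> (x + y) = \<gamma> x * \<gamma> y" for x y
    using mult[of x y] e0 by (simp add: \<gamma>_def field_simps)
  have le: "norm (\<gamma> x) \<le> 1" for x
    using idempotent_zero[OF e] idempotent_zero(2)[OF e, of x] by (simp add: \<gamma>_def norm_divide)
  have "norm (\<gamma> x) = 1" for x
  proof -
    have "\<gamma> x * \<gamma> (- x) = 1" using g_mult[of x "- x"] e0 by (simp add: \<gamma>_def)
    then have *: "norm (\<gamma> x) * norm (\<gamma> (- x)) = 1" by (metis norm_mult norm_one)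
    then have "1 \<le> norm (\<gamma> x)"
      using mult_left_mono[OF le[of "- x"] norm_ge_zero[of "\<gamma> x"]] by simp
    then show ?thesis using le[of x] by simp
  qed
  moreover have "continuous_on UNIV \<gamma>"
    unfolding \<gamma>_def using e0 by (intro continuous_intros E) auto
  ultimately show ?thesis
    using g_mult unfolding continuous_character_def \<gamma>_def by simp
qed

text \<open>A minimal idempotent below the top one inherits the eigenvalue \<open>r\<close>. Since
  \<open>e\<close> is hermitian, the Fourier coefficient of \<open>conv h h\<close> at
  \<open>e / e 0\<close> is the quotient of \<open>conv (conv h h) e\<close> and \<open>e\<close> at
  0, which is \<open>r\<close>.\<close>

lemma exists_character:
  assumes h: "continuous_on UNIV h" "star h = h" "h \<noteq> (\<lambda>_. 0)"
  obtains \<gamma> where "continuous_character \<gamma>" "fourier_coeff m (conv h h) \<gamma> \<noteq> 0"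
proof -
  note ci = continuous_integrable
  obtain e1 r where e1: "idempotent e1" and r: "r > 0" "conv (conv h h) e1 = (\<lambda>x. of_real r * e1 x)"
    by (rule top_idempotent[OF h])
  obtain e where e: "idempotent e" "conv e e1 = e" and min: "\<And>e'. idempotent e' \<Longrightarrow> conv e' e = e' \<Longrightarrow> e' = e"
    by (rule minimal_idempotent[OF e1]) blast
  have ec: "continuous_on UNIV e" "continuous_on UNIV e1" "star e = e"
    using e e1 by (auto simp: idempotent_def)
  have cnj_e: "cnj (e x) = e (- x)" for x using fun_cong[OF ec(3), of "- x"] by (simp add: star_def)
  have hh: "continuous_on UNIV (conv h h)" by (intro continuous_conv ci h)
  have "conv (conv h h) e = conv (conv h h) (conv e1 e)"
    using conv_commute[OF ec(1,2)] by (simp add: e(2))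
  also have "\<dots> = conv (conv (conv h h) e1) e"
    using conv_assoc[OF ci[OF hh] ec(2,1)] by simp
  also have "\<dots> = (\<lambda>x. of_real r * e x)"
    using conv_commute[OF ec(1,2)] by (simp add: r conv_scale ec e(2))
  finally have he: "conv (conv h h) e 0 = of_real r * e 0" by simp
  have e0: "e 0 \<noteq> 0" "cnj (e 0) = e 0" using idempotent_zero[OF e(1)] by auto
  have "fourier_coeff m (conv h h) (\<lambda>x. e x / e 0) = (LINT x|m. conv h h x * e (- x) / e 0)"
    by (simp add: fourier_coeff_def cnj_e e0)
  also have "\<dots> = conv (conv h h) e 0 / e 0"
    by (simp add: conv_def[of "conv h h"])
  finally have "fourier_coeff m (conv h h) (\<lambda>x. e x / e 0) = of_real r"
    using e0 by (simp add: he)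
  with that character_of_minimal_idempotent[OF e(1) min] r(1) show thesis by fastforce
qed

section \<open>Functions with vanishing Fourier coefficients\<close>

lemma fourier_coeff_conv:
  assumes f: "integrable m f" and \<phi>: "continuous_on UNIV \<phi>" and \<gamma>: "continuous_character \<gamma>"
  shows "fourier_coeff m (conv f \<phi>) \<gamma> = fourier_coeff m f \<gamma> * fourier_coeff m \<phi> \<gamma>"
proof -
  have c: "continuous_on UNIV (\<lambda>y. cnj (\<gamma> y))" and mult: "\<And>x y. \<gamma> (x + y) = \<gamma> x * \<gamma> y"
    using \<gamma> by (auto simp: continuous_character_def intro: continuous_on_cnj)
  have "(LINT y|m. \<phi> (y - z) * cnj (\<gamma> y)) = cnj (\<gamma> z) * fourier_coeff m \<phi> \<gamma>" for z
  proof -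
    have "(LINT y|m. \<phi> (y - z) * cnj (\<gamma> y)) = (LINT y|m. \<phi> ((z + y) - z) * cnj (\<gamma> (z + y)))"
      by (rule integral_translation[symmetric], rule continuous_measurable)
        (intro continuous_intros continuous_diff \<phi> c)
    also have "\<dots> = (LINT y|m. cnj (\<gamma> z) * (\<phi> y * cnj (\<gamma> y)))"
      by (simp add: mult mult_ac)
    finally show ?thesis by (simp add: fourier_coeff_def)
  qed
  then show ?thesis
    using double_integral_difference[OF f \<phi> c]
    by (simp add: fourier_coeff_def conv_def flip: mult.assoc)
qed

text \<open>For \<open>g = conv f \<phi>\<close> the function \<open>conv g (star g)\<close> is
  hermitian with value \<open>nsq g\<close> at 0, so if \<open>g\<close> is nonzero, some character
  detects it. But its Fourier coefficients contain those of \<open>f\<close> as a factor.\<close>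

lemma conv_eq_0:
  assumes f: "integrable m f" and \<phi>: "continuous_on UNIV \<phi>"
    and zero: "\<And>\<gamma>. continuous_character \<gamma> \<Longrightarrow> fourier_coeff m f \<gamma> = 0"
  shows "conv f \<phi> = (\<lambda>_. 0)"
proof (rule ccontr)
  note ci = continuous_integrable
  assume nz: "conv f \<phi> \<noteq> (\<lambda>_. 0)"
  define g where "g = conv f \<phi>"
  have g: "continuous_on UNIV g" unfolding g_def by (intro continuous_conv f \<phi>)
  define h where "h = conv g (star g)"
  have h: "continuous_on UNIV h" unfolding h_def by (intro continuous_conv ci g continuous_star)
  have "star h = h"
    using star_conv[OF g continuous_star[OF g]] conv_commute[OF g continuous_star[OF g]] by (simp add: h_def)
  moreover have "nsq g \<noteq> 0" using nsq_eq_0[OF g] nz by (auto simp: g_def)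
  then have "h \<noteq> (\<lambda>_. 0)" using nsq_eq_conv_star[of g] by (auto simp: h_def)
  ultimately obtain \<gamma> where \<gamma>: "continuous_character \<gamma>" "fourier_coeff m (conv h h) \<gamma> \<noteq> 0"
    using exists_character[OF h] by blast
  have "fourier_coeff m h \<gamma> = 0"
    unfolding h_def g_def
    by (subst fourier_coeff_conv) (auto intro!: ci continuous_conv continuous_star f \<phi> \<gamma> simp: fourier_coeff_conv[OF f \<phi> \<gamma>(1)] zero[OF \<gamma>(1)])
  then show False using \<gamma>(2) fourier_coeff_conv[OF ci[OF h] h \<gamma>(1)] by simp
qed

lemma closed_inner_regular:
  assumes A: "A \<in> sets borel" and "\<epsilon> > 0"
  shows "\<exists>K\<subseteq>A. closed K \<and> measure m (A - K) < \<epsilon>"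
proof (cases "measure m A < \<epsilon>")
  case True
  then show ?thesis by (intro exI[of _ "{}"]) auto
next
  case False
  have "emeasure m A = (SUP K\<in>{K. compact K \<and> K \<subseteq> A}. emeasure m K)"
    using haar A by (simp add: normalized_haar_def)
  moreover have "ennreal (measure m A - \<epsilon>) < emeasure m A"
    using \<open>\<epsilon> > 0\<close> False by (subst haar.emeasure_eq_measure) (simp add: ennreal_less_iff)
  ultimately obtain K where K: "compact K" "K \<subseteq> A" "ennreal (measure m A - \<epsilon>) < emeasure m K"
    by (auto simp: less_SUP_iff)
  have "K \<in> sets m" using compact_imp_closed[OF K(1)] by (simp add: sets_haar)
  moreover have "measure m A - \<epsilon> < measure m K"
    using K(3) False by (subst (asm) haar.emeasure_eq_measure) (simp add: ennreal_less_iff)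
  ultimately have "measure m (A - K) < \<epsilon>"
    using K(2) A by (subst haar.finite_measure_Diff) (auto simp: sets_haar)
  then show ?thesis using K compact_imp_closed by blast
qed

text \<open>The value at 0 of a convolution tests \<open>f\<close> against an arbitrary continuous
  function, so \<open>f\<close> annihilates all of these. Regularity of the Haar measure then passes
  from continuous functions to indicators of Borel sets.\<close>

theorem fourier_uniqueness:
  assumes f: "integrable m f"
    and zero: "\<And>\<gamma>. continuous_character \<gamma> \<Longrightarrow> fourier_coeff m f \<gamma> = 0"
  shows "AE x in m. f x = 0"
proof (rule haar.density_zero[OF f])
  have cont0: "(LINT x|m. f x * \<phi> x) = 0" if \<phi>: "continuous_on UNIV \<phi>" for \<phi>
    using fun_cong[OF conv_eq_0[OF f continuous_diff(3)[OF \<phi>] zero], of 0] by (simp add: conv_def)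
  have normal: "normal_space (euclidean :: 'g topology)"
    using compact_group hausdorff
    by (intro compact_Hausdorff_or_regular_imp_normal_space disjI1)
      (auto simp: compact_space_def Hausdorff_space_def disjnt_def)
  fix A assume "A \<in> sets m"
  then have A: "A \<in> sets borel" and [measurable]: "A \<in> sets m" by (auto simp: sets_haar)
  have "\<exists>\<phi>. continuous_on UNIV \<phi> \<and> (\<forall>x. 0 \<le> \<phi> x \<and> \<phi> x \<le> 1) \<and> (LINT x|m. \<bar>indicator A x - \<phi> x\<bar>) < inverse (Suc n)" for n
  proof -
    have half: "inverse (Suc n) / 2 > (0 :: real)" by simp
    obtain K where K: "K \<subseteq> A" "closed K" "measure m (A - K) < inverse (Suc n) / 2"
      using closed_inner_regular[OF A half] by auto
    \<comment> \<open>Inner regularity of the complement supplies the open superset of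
      \<open>A\<close> needed for Urysohn's lemma.\<close>
    obtain C where C: "C \<subseteq> - A" "closed C" "measure m (- A - C) < inverse (Suc n) / 2"
      using closed_inner_regular[OF borel_comp[OF A] half] by auto
    have [measurable]: "K \<in> sets m" "C \<in> sets m" "A \<in> sets m"
      using K C A by (auto simp: sets_haar)
    obtain \<phi> :: "'g \<Rightarrow> real" where \<phi>: "continuous_on UNIV \<phi>" "\<And>x. 0 \<le> \<phi> x \<and> \<phi> x \<le> 1"
      "\<And>x. \<bar>indicator A x - \<phi> x\<bar> \<le> indicator (- C - K) x"
      using Urysohn_indicator[OF normal K(2), of "- C" A] K(1) C(1,2) by auto
    have [measurable]: "\<phi> \<in> borel_measurable m" by (rule continuous_measurable[OF \<phi>(1)])
    have "(LINT x|m. \<bar>indicator A x - \<phi> x\<bar>) \<le> (LINT x|m. indicator (- C - K) x)"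
    proof (rule integral_mono)
      show "integrable m (\<lambda>x. \<bar>indicator A x - \<phi> x\<bar>)"
        by (rule haar.integrable_const_bound[of _ 1]) (use \<phi>(2) in \<open>auto simp: indicator_def intro!: AE_I2\<close>)
    qed (use \<phi>(3) K C in \<open>auto simp: sets_haar intro!: integrable_real_indicator haar.emeasure_finite[THEN top.not_eq_extremum[THEN iffD1]]\<close>)
    also have "\<dots> = measure m ((A - K) \<union> (- A - C))"
      using K(1) C(1) by (auto intro!: arg_cong[of _ _ "measure m"])
    also have "\<dots> \<le> measure m (A - K) + measure m (- A - C)"
      using K(2) C(2) A by (intro measure_Un_le) (auto simp: sets_haar)
    also have "\<dots> < inverse (Suc n)" using K(3) C(3) by simp
    finally show ?thesis using \<phi> by blast
  qed
  then obtain \<phi> where \<phi>: "\<And>n. continuous_on UNIV (\<phi> n)" "\<And>n x. 0 \<le> \<phi> n x \<and> \<phi> n x \<le> 1"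
    "\<And>n::nat. (LINT x|m. \<bar>indicator A x - \<phi> n x\<bar>) < inverse (Suc n)" for n
    by metis
  have [measurable]: "\<phi> n \<in> borel_measurable m" for n using \<phi>(1) by (rule continuous_measurable)
  have int: "integrable m (\<lambda>x. \<phi> n x - indicator A x)" for n
    by (rule haar.integrable_const_bound[of _ 1]) (use \<phi>(2) in \<open>auto simp: indicator_def intro!: AE_I2\<close>)
  have "(\<lambda>n. LINT x|m. norm (\<phi> n x - indicator A x)) \<longlonglongrightarrow> 0"
  proof (rule tendsto_sandwich[OF _ _ tendsto_const LIMSEQ_inverse_real_of_nat])
    show "\<forall>\<^sub>F n in sequentially. (LINT x|m. norm (\<phi> n x - indicator A x)) \<le> inverse (real (Suc n))"
      using \<phi>(3) by (auto simp: abs_minus_commute less_imp_le)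
  qed auto
  \<comment> \<open>Since \<open>f\<close> may be unbounded, L1 approximation of the indicator is
    not enough. Along an almost everywhere convergent subsequence \<open>norm (f x)\<close> is a
    dominating function.\<close>
  from tendsto_L1_AE_subseq[OF int this] obtain s where s: "strict_mono s"
    "AE x in m. (\<lambda>n. \<phi> (s n) x - indicator A x) \<longlonglongrightarrow> 0" by blast
  have "(\<lambda>n. LINT x|m. f x * of_real (\<phi> (s n) x)) \<longlonglongrightarrow> (LINT x|m. f x * of_real (indicator A x))"
  proof (rule integral_dominated_convergence[where w = "\<lambda>x. norm (f x)"])
    show "AE x in m. (\<lambda>n. f x * of_real (\<phi> (s n) x)) \<longlonglongrightarrow> f x * of_real (indicator A x)"
      using s(2) by eventually_elim (intro tendsto_intros, rule LIM_zero_cancel)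
    show "AE x in m. norm (f x * of_real (\<phi> (s n) x)) \<le> norm (f x)" for n
      using \<phi>(2) by (auto simp: norm_mult mult_left_le)
  qed (use f in auto)
  moreover have "(LINT x|m. f x * of_real (\<phi> (s n) x)) = 0" for n
    by (rule cont0) (intro continuous_intros \<phi>)
  ultimately have "(LINT x|m. f x * of_real (indicator A x)) = 0"
    by (simp add: LIMSEQ_const_iff)
  moreover have "f x * of_real (indicator A x) = indicator A x *\<^sub>R f x" for x
    by (simp add: scaleR_conv_of_real mult.commute)
  ultimately show "set_lebesgue_integral m A f = 0"
    unfolding set_lebesgue_integral_def by simp
qed

end

section \<open>Lebesgue points\<close>

lemma ball_measurable [measurable]: "ball (a :: real) r \<in> sets borel"
  by simp

text \<open>Induction over integrable functions. For an indicator, outer regularity of the set and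
  of its complement leaves only a thin layer in which Urysohn's function can differ from it.\<close>

lemma continuous_approx_L1:
  fixes f :: "real \<Rightarrow> complex"
  assumes "integrable lborel f" "\<epsilon> > 0"
  shows "\<exists>\<phi>. continuous_on UNIV \<phi> \<and> integrable lborel \<phi> \<and> (LINT x|lborel. norm (f x - \<phi> x)) < \<epsilon>"
  using assms
proof (induction arbitrary: \<epsilon> rule: integrable_induct)
  case (base A c)
  then have A: "A \<in> sets borel" "emeasure lborel A < \<infinity>" by auto
  \<comment> \<open>The layer \<open>U - - V\<close> has two pieces of measure below
    \<open>e\<close>; the \<open>+ 1\<close> covers the case \<open>c = 0\<close>.\<close>
  define e where "e = \<epsilon> / 2 / (norm c + 1)"
  have e: "e > 0" using \<open>\<epsilon> > 0\<close> by (simp add: e_def add_nonneg_pos)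
  obtain U where U: "open U" "A \<subseteq> U" "emeasure lborel (U - A) < e"
    by (rule outer_regular_lborel[OF A(1) e])
  obtain V where V: "open V" "- A \<subseteq> V" "emeasure lborel (V - - A) < e"
    by (rule outer_regular_lborel[OF borel_comp[OF A(1)] e])
  have normal: "normal_space (euclidean :: real topology)"
    by (intro metrizable_imp_normal_space metrizable_space_euclidean)
  obtain \<phi> :: "real \<Rightarrow> real" where \<phi>: "continuous_on UNIV \<phi>" "\<And>x. 0 \<le> \<phi> x \<and> \<phi> x \<le> 1"
    "\<And>x. \<bar>indicator A x - \<phi> x\<bar> \<le> indicator (U - - V) x"
    using Urysohn_indicator[OF normal, of "- V" U A] U V by auto
  have [measurable]: "\<phi> \<in> borel_measurable lborel" "A \<in> sets lborel" "U \<in> sets lborel" "V \<in> sets lborel"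
    using \<phi>(1) A U V by (auto intro: borel_measurable_continuous_onI)
  have "U - - V = (U - A) \<union> (V - - A)" using U V by auto
  then have "emeasure lborel (U - - V) \<le> emeasure lborel (U - A) + emeasure lborel (V - - A)"
    using A U V by (simp only:) (rule emeasure_subadditive, auto)
  also have "\<dots> < ennreal e + ennreal e" using U V by (intro add_strict_mono)
  also have "\<dots> = ennreal (2 * e)" using e by (simp flip: ennreal_plus)
  finally have em: "emeasure lborel (U - - V) < ennreal (2 * e)" .
  then have fin: "emeasure lborel (U - - V) < \<infinity>" by (rule less_trans) simp
  have int: "integrable lborel (indicator (U - - V) :: real \<Rightarrow> real)"
    using fin U V by (intro integrable_real_indicator) auto
  have meas: "measure lborel (U - - V) < 2 * e"
    using em fin e by (simp add: emeasure_eq_ennreal_measure ennreal_less_iff)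
  have intd: "integrable lborel (\<lambda>x. indicator A x - \<phi> x)"
    by (rule Bochner_Integration.integrable_bound[OF int]) (use \<phi>(3) in auto)
  have "integrable lborel (indicator A :: real \<Rightarrow> real)"
    using A by (intro integrable_real_indicator) auto
  from Bochner_Integration.integrable_diff[OF this intd] have i\<phi>: "integrable lborel \<phi>" by simp
  have "(LINT x|lborel. norm (indicator A x *\<^sub>R c - of_real (\<phi> x) * c)) = (LINT x|lborel. \<bar>indicator A x - \<phi> x\<bar> * norm c)"
    by (intro Bochner_Integration.integral_cong refl)
      (simp add: scaleR_conv_of_real norm_mult flip: left_diff_distrib of_real_diff)
  also have "\<dots> = (LINT x|lborel. \<bar>indicator A x - \<phi> x\<bar>) * norm c" by simp
  also have "\<dots> \<le> (LINT x|lborel. indicator (U - - V) x) * norm c"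
    using \<phi>(3) int intd by (intro mult_right_mono integral_mono) auto
  also have "\<dots> \<le> 2 * e * norm c" using meas by (intro mult_right_mono) auto
  also have "\<dots> < 2 * (e * (norm c + 1))" using e by simp
  also have "e * (norm c + 1) = \<epsilon> / 2"
    unfolding e_def by (rule nonzero_eq_divide_eq[THEN iffD1, OF _ refl]) (simp add: add_nonneg_eq_0_iff)
  also have "2 * (\<epsilon> / 2) = \<epsilon>" by simp
  finally show ?case
    using \<phi>(1) i\<phi> by (intro exI[of _ "\<lambda>x. of_real (\<phi> x) * c"]) (auto intro!: continuous_intros)
next
  case (add f g)
  obtain \<phi> \<psi> where \<phi>: "continuous_on UNIV \<phi>" "integrable lborel \<phi>" "(LINT x|lborel. norm (f x - \<phi> x)) < \<epsilon> / 2"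
    and \<psi>: "continuous_on UNIV \<psi>" "integrable lborel \<psi>" "(LINT x|lborel. norm (g x - \<psi> x)) < \<epsilon> / 2"
    using add.IH(1)[of "\<epsilon> / 2"] add.IH(2)[of "\<epsilon> / 2"] add.prems by auto
  have "(LINT x|lborel. norm (f x + g x - (\<phi> x + \<psi> x))) \<le> (LINT x|lborel. norm (f x - \<phi> x) + norm (g x - \<psi> x))"
  proof (rule integral_mono)
    show "norm (f x + g x - (\<phi> x + \<psi> x)) \<le> norm (f x - \<phi> x) + norm (g x - \<psi> x)" for x
      using norm_triangle_ineq[of "f x - \<phi> x" "g x - \<psi> x"] by (simp add: algebra_simps)
  qed (use add.hyps \<phi> \<psi> in auto)
  also have "\<dots> < \<epsilon>" using add.hyps \<phi> \<psi> by simp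
  finally show ?case
    using \<phi> \<psi> by (intro exI[of _ "\<lambda>x. \<phi> x + \<psi> x"]) (auto intro!: continuous_intros)
next
  case (lim f s)
  have "AE x in lborel. (\<lambda>i. norm (s i x - f x)) \<longlonglongrightarrow> 0"
    using lim.hyps(2) by (intro AE_I2 tendsto_norm_zero LIM_zero) simp
  \<comment> \<open>The approximants of the induction rule are bounded by
    \<open>2 * norm (f x)\<close>; adding \<open>f\<close> itself gives the factor 3.\<close>
  moreover have "norm (norm (s i x - f x)) \<le> 3 * norm (f x)" for i x
    using norm_triangle_ineq4[of "s i x" "f x"] lim.hyps(3)[of x i] by simp
  ultimately have "(\<lambda>i. LINT x|lborel. norm (s i x - f x)) \<longlonglongrightarrow> (LINT x|(lborel :: real measure). (0 :: real))"
    using lim.hyps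
    by (intro integral_dominated_convergence[of "\<lambda>_. 0" lborel "\<lambda>i x. norm (s i x - f x)" "\<lambda>x. 3 * norm (f x)"]) auto
  then have "\<forall>\<^sub>F i in sequentially. (LINT x|lborel. norm (s i x - f x)) < \<epsilon> / 2"
    using \<open>\<epsilon> > 0\<close> by (intro order_tendstoD(2)[of _ 0]) auto
  then obtain i where i: "(LINT x|lborel. norm (s i x - f x)) < \<epsilon> / 2"
    using eventually_happens'[OF sequentially_bot] by blast
  obtain \<phi> where \<phi>: "continuous_on UNIV \<phi>" "integrable lborel \<phi>" "(LINT x|lborel. norm (s i x - \<phi> x)) < \<epsilon> / 2"
    using lim.IH[of "\<epsilon> / 2" i] lim.prems by auto
  have "(LINT x|lborel. norm (f x - \<phi> x)) \<le> (LINT x|lborel. norm (s i x - f x) + norm (s i x - \<phi> x))"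
  proof (rule integral_mono)
    show "norm (f x - \<phi> x) \<le> norm (s i x - f x) + norm (s i x - \<phi> x)" for x
      using norm_triangle_ineq[of "f x - s i x" "s i x - \<phi> x"] by (simp add: norm_minus_commute)
  qed (use lim.hyps \<phi> in auto)
  also have "\<dots> < \<epsilon>" using lim.hyps \<phi> i by simp
  finally show ?case using \<phi> by blast
qed

text \<open>The weak type bound of Hardy and Littlewood. Vitali's lemma selects disjoint balls whose
  fivefold enlargements, of length \<open>10 * s i\<close>, still cover \<open>E\<close>; by
  disjointness their integrals add up to at most the L1 norm. The cap 1 gives Vitali's lemma bounded
  radii. An open superset is returned because nothing is assumed about measurability of
  \<open>E\<close>.\<close>

lemma maximal_inequality:
  fixes h :: "real \<Rightarrow> complex"
  assumes h: "integrable lborel h" and "\<alpha> > 0"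
    and E: "\<And>t. t \<in> E \<Longrightarrow> \<exists>s>0. s \<le> 1 \<and> (\<integral>\<^sup>+r\<in>ball t s. norm (h r) \<partial>lborel) > ennreal (\<alpha> * s)"
  obtains V where "open V" "E \<subseteq> V" "emeasure lborel V \<le> ennreal (10 / \<alpha> * (LINT r|lborel. norm (h r)))"
proof -
  obtain s where s: "\<And>t. t \<in> E \<Longrightarrow> 0 < s t \<and> s t \<le> 1"
    "\<And>t. t \<in> E \<Longrightarrow> (\<integral>\<^sup>+r\<in>ball t (s t). norm (h r) \<partial>lborel) > ennreal (\<alpha> * s t)"
    using E by metis
  have [measurable]: "h \<in> borel_measurable borel" using h by auto
  have "E \<subseteq> (\<Union>t\<in>E. ball t (s t))" using s by force
  then obtain C where C: "countable C" "C \<subseteq> E"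
    "pairwise (\<lambda>i j. disjnt (ball i (s i)) (ball j (s j))) C" "E \<subseteq> (\<Union>i\<in>C. ball i (5 * s i))"
    using Vitali_covering_lemma_balls[where S = E and K = E and a = "\<lambda>t. t" and r = s and B = 1] s by auto
  define V where "V = (\<Union>i\<in>C. ball i (5 * s i))"
  have "emeasure lborel V \<le> (\<integral>\<^sup>+i. emeasure lborel (ball i (5 * s i)) \<partial>count_space C)"
  proof -
    have "emeasure lborel V = (\<integral>\<^sup>+x. indicator V x \<partial>lborel)"
      using C(1) by (intro nn_integral_indicator[symmetric]) (auto simp: V_def intro!: sets.countable_UN'')
    also have "\<dots> \<le> (\<integral>\<^sup>+x. (\<integral>\<^sup>+i. indicator (ball i (5 * s i)) x \<partial>count_space C) \<partial>lborel)"
    proof (rule nn_integral_mono)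
      fix x :: real
      show "indicator V x \<le> (\<integral>\<^sup>+i. indicator (ball i (5 * s i)) x \<partial>count_space C)"
      proof (cases "x \<in> V")
        case True
        then obtain i where i: "i \<in> C" "x \<in> ball i (5 * s i)" by (auto simp: V_def)
        have "indicator V x = (indicator (ball i (5 * s i)) x :: ennreal)" using True i by simp
        also have "\<dots> \<le> (\<integral>\<^sup>+i. indicator (ball i (5 * s i)) x \<partial>count_space C)"
          by (rule nn_integral_ge_point[OF i(1)])
        finally show ?thesis .
      qed simp
    qed
    also have "\<dots> = (\<integral>\<^sup>+i. (\<integral>\<^sup>+x. indicator (ball i (5 * s i)) x \<partial>lborel) \<partial>count_space C)"
      using C(1) by (intro nn_integral_count_space_nn_integral borel_measurable_indicator) auto
    finally show ?thesis by simp
  qed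
  also have "\<dots> \<le> (\<integral>\<^sup>+i. ennreal (10 / \<alpha>) * (\<integral>\<^sup>+r\<in>ball i (s i). norm (h r) \<partial>lborel) \<partial>count_space C)"
  proof (rule nn_integral_mono)
    fix i assume "i \<in> space (count_space C)"
    then have i: "i \<in> E" using C by auto
    have "emeasure lborel (ball i (5 * s i)) = ennreal (10 * s i)"
      using s(1)[OF i] by (simp add: ball_eq_greaterThanLessThan)
    also have "\<dots> = ennreal (10 / \<alpha>) * ennreal (\<alpha> * s i)"
      using \<open>\<alpha> > 0\<close> s(1)[OF i] by (simp flip: ennreal_mult)
    also have "\<dots> \<le> ennreal (10 / \<alpha>) * (\<integral>\<^sup>+r\<in>ball i (s i). norm (h r) \<partial>lborel)"
      using s(2)[OF i] by (intro mult_left_mono) auto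
    finally show "emeasure lborel (ball i (5 * s i)) \<le> ennreal (10 / \<alpha>) * (\<integral>\<^sup>+r\<in>ball i (s i). norm (h r) \<partial>lborel)" .
  qed
  also have "\<dots> = ennreal (10 / \<alpha>) * (\<integral>\<^sup>+i. (\<integral>\<^sup>+r\<in>ball i (s i). norm (h r) \<partial>lborel) \<partial>count_space C)"
    by (rule nn_integral_cmult) simp
  also have "(\<integral>\<^sup>+i. (\<integral>\<^sup>+r\<in>ball i (s i). norm (h r) \<partial>lborel) \<partial>count_space C)
    = (\<integral>\<^sup>+i. emeasure (density lborel (\<lambda>r. ennreal (norm (h r)))) (ball i (s i)) \<partial>count_space C)"
    by (simp add: emeasure_density)
  also have "\<dots> = emeasure (density lborel (\<lambda>r. ennreal (norm (h r)))) (\<Union>i\<in>C. ball i (s i))"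
    using C by (intro emeasure_UN_countable[symmetric])
      (auto simp: disjoint_family_on_def pairwise_def disjnt_def)
  also have "\<dots> \<le> emeasure (density lborel (\<lambda>r. ennreal (norm (h r)))) UNIV"
    by (intro emeasure_mono) auto
  also have "\<dots> = ennreal (LINT r|lborel. norm (h r))"
    using h by (simp add: emeasure_density nn_integral_eq_integral)
  also have "ennreal (10 / \<alpha>) * \<dots> = ennreal (10 / \<alpha> * (LINT r|lborel. norm (h r)))"
    using \<open>\<alpha> > 0\<close> by (intro ennreal_mult[symmetric]) auto
  finally have "emeasure lborel V \<le> ennreal (10 / \<alpha> * (LINT r|lborel. norm (h r)))"
    by (simp add: mult_left_mono)
  with that[of V] C show thesis by (auto simp: V_def)
qed

text \<open>The non-negative integral avoids integrability side conditions. The bound uses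
  \<open>s\<close> in place of the length \<open>2 * s\<close> of the ball, which only rescales
  \<open>\<epsilon>\<close>.\<close>

definition lebesgue_point :: "(real \<Rightarrow> complex) \<Rightarrow> real \<Rightarrow> bool" where
  "lebesgue_point f t \<longleftrightarrow>
     (\<forall>\<epsilon>>0. \<exists>\<eta>>0. \<forall>s. 0 < s \<and> s \<le> \<eta> \<longrightarrow> (\<integral>\<^sup>+r\<in>ball t s. norm (f r - f t) \<partial>lborel) \<le> ennreal (\<epsilon> * s))"

text \<open>\<open>f\<close> is split into a continuous function and a remainder \<open>h\<close>
  that is small in L1. A point can fail only where some local average of \<open>norm (h r)\<close>,
  or its value at the point, is large; the maximal inequality and Markov's inequality bound these
  sets. Measurability of the exceptional set is bypassed by covering it with measurable sets of
  arbitrarily small measure.\<close>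

lemma AE_lebesgue_point_integrable:
  fixes f :: "real \<Rightarrow> complex"
  assumes f: "integrable lborel f"
  shows "AE t in lborel. lebesgue_point f t"
proof -
  define good where "good \<epsilon> t \<longleftrightarrow> (\<exists>\<eta>>0. \<forall>s. 0 < s \<and> s \<le> \<eta> \<longrightarrow>
    (\<integral>\<^sup>+r\<in>ball t s. norm (f r - f t) \<partial>lborel) \<le> ennreal (\<epsilon> * s))" for \<epsilon> t
  have [measurable]: "f \<in> borel_measurable borel" using f by auto
  have cover: "\<exists>W. W \<in> sets lborel \<and> {t. \<not> good \<epsilon> t} \<subseteq> W \<and> emeasure lborel W \<le> ennreal \<delta>"
    if "\<epsilon> > 0" "\<delta> > 0" for \<epsilon> \<delta>
  proof -
    \<comment> \<open>The sets \<open>V\<close> and \<open>H\<close> below cost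
      \<open>40 / \<epsilon>\<close> and \<open>8 / \<epsilon>\<close> times the L1 norm of
      \<open>h\<close>; the 100 absorbs their total of 48.\<close>
    obtain \<phi> where \<phi>: "continuous_on UNIV \<phi>" "integrable lborel \<phi>" "(LINT x|lborel. norm (f x - \<phi> x)) < \<delta> * \<epsilon> / 100"
      using continuous_approx_L1[OF f divide_pos_pos[OF mult_pos_pos[OF \<open>\<delta> > 0\<close> \<open>\<epsilon> > 0\<close>], of 100]] by auto
    define h where "h x = f x - \<phi> x" for x
    have h: "integrable lborel h" unfolding h_def using f \<phi> by simp
    have [measurable]: "h \<in> borel_measurable borel" "\<phi> \<in> borel_measurable borel" using h \<phi> by auto
    \<comment> \<open>Budget on a ball of length \<open>2 * s\<close>: off \<open>E\<close> the
      integral of \<open>norm (h r)\<close> is at most \<open>\<epsilon> / 4 * s\<close>, while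
      \<open>\<phi> r - \<phi> t\<close> and \<open>h t\<close> stay below
      \<open>\<epsilon> / 8\<close> each and together contribute
      \<open>\<epsilon> / 2 * s\<close>.\<close>
    define E where "E = {t. \<exists>s>0. s \<le> 1 \<and> (\<integral>\<^sup>+r\<in>ball t s. norm (h r) \<partial>lborel) > ennreal (\<epsilon> / 4 * s)}"
    obtain V where V: "open V" "E \<subseteq> V" "emeasure lborel V \<le> ennreal (10 / (\<epsilon> / 4) * (LINT r|lborel. norm (h r)))"
      by (rule maximal_inequality[OF h, of "\<epsilon> / 4" E]) (use \<open>\<epsilon> > 0\<close> in \<open>auto simp: E_def\<close>)
    define H where "H = {t \<in> space lborel. \<epsilon> / 8 \<le> norm (h t)}"
    have H_meas: "emeasure lborel H \<le> ennreal (8 / \<epsilon> * (LINT r|lborel. norm (h r)))"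
      unfolding H_def using integral_Markov_inequality[of lborel "\<lambda>t. norm (h t)" "\<epsilon> / 8"] h that by simp
    have "{t. \<not> good \<epsilon> t} \<subseteq> V \<union> H"
    proof (rule ccontr)
      assume "\<not> {t. \<not> good \<epsilon> t} \<subseteq> V \<union> H"
      then obtain t where "\<not> good \<epsilon> t" "t \<notin> V" "t \<notin> H" by blast
      then have t: "\<not> good \<epsilon> t" "t \<notin> E" "norm (h t) < \<epsilon> / 8"
        using V(2) by (auto simp: H_def)
      have "isCont \<phi> t" using \<phi>(1) continuous_on_eq_continuous_at by blast
      then obtain d where d: "d > 0" "\<And>r. dist r t < d \<Longrightarrow> dist (\<phi> r) (\<phi> t) < \<epsilon> / 8"
        unfolding continuous_at_eps_delta using \<open>\<epsilon> > 0\<close> by (meson divide_pos_pos zero_less_numeral)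
      have "(\<integral>\<^sup>+r\<in>ball t s. norm (f r - f t) \<partial>lborel) \<le> ennreal (\<epsilon> * s)" if s: "0 < s" "s \<le> min d 1" for s
      proof -
        have "(\<integral>\<^sup>+r\<in>ball t s. norm (f r - f t) \<partial>lborel)
          \<le> (\<integral>\<^sup>+r. ennreal (norm (h r)) * indicator (ball t s) r + ennreal (\<epsilon> / 4) * indicator (ball t s) r \<partial>lborel)"
        proof (rule nn_integral_mono)
          fix r
          have "norm (f r - f t) \<le> norm (h r) + \<epsilon> / 4" if "r \<in> ball t s"
          proof -
            have "norm (\<phi> r - \<phi> t) < \<epsilon> / 8" using d(2)[of r] that s by (auto simp: dist_norm norm_minus_commute)
            moreover have "f r - f t = h r + (\<phi> r - \<phi> t) - h t" by (simp add: h_def)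
            ultimately show ?thesis
              using t(3) norm_triangle_ineq[of "h r" "\<phi> r - \<phi> t"] norm_triangle_ineq4[of "h r + (\<phi> r - \<phi> t)" "h t"] by simp
          qed
          then show "ennreal (norm (f r - f t)) * indicator (ball t s) r
            \<le> ennreal (norm (h r)) * indicator (ball t s) r + ennreal (\<epsilon> / 4) * indicator (ball t s) r"
            using \<open>\<epsilon> > 0\<close> by (auto simp: indicator_def simp flip: ennreal_plus intro!: ennreal_leI)
        qed
        also have "\<dots> = (\<integral>\<^sup>+r\<in>ball t s. norm (h r) \<partial>lborel) + ennreal (\<epsilon> / 4) * emeasure lborel (ball t s)"
          by (subst nn_integral_add) (auto simp: nn_integral_cmult_indicator)
        also have "\<dots> \<le> ennreal (\<epsilon> / 4 * s) + ennreal (\<epsilon> / 4) * ennreal (2 * s)"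
          using t(2) s by (intro add_mono mult_left_mono) (auto simp: E_def ball_eq_greaterThanLessThan not_less)
        also have "\<dots> \<le> ennreal (\<epsilon> * s)"
          using s \<open>\<epsilon> > 0\<close> by (simp add: ennreal_leI flip: ennreal_plus ennreal_mult)
        finally show ?thesis .
      qed
      then have "good \<epsilon> t" unfolding good_def using d(1) by (intro exI[of _ "min d 1"]) auto
      with t(1) show False by simp
    qed
    moreover have "emeasure lborel (V \<union> H) \<le> ennreal \<delta>"
    proof -
      have "emeasure lborel (V \<union> H) \<le> emeasure lborel V + emeasure lborel H"
        using V(1) by (intro emeasure_subadditive) (auto simp: H_def)
      also have "\<dots> \<le> ennreal (10 / (\<epsilon> / 4) * (LINT r|lborel. norm (h r))) + ennreal (8 / \<epsilon> * (LINT r|lborel. norm (h r)))"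
        by (intro add_mono V H_meas)
      also have "\<dots> = ennreal (48 / \<epsilon> * (LINT r|lborel. norm (h r)))"
        using \<open>\<epsilon> > 0\<close> by (simp add: field_simps flip: ennreal_plus)
      also have "\<dots> \<le> ennreal \<delta>"
      proof (rule ennreal_leI)
        define I where "I = (LINT r|lborel. norm (h r))"
        have "0 \<le> I" unfolding I_def by simp
        moreover have "I < \<delta> * \<epsilon> / 100" using \<phi>(3) unfolding I_def h_def .
        ultimately have "48 * I \<le> \<delta> * \<epsilon>" by linarith
        then show "48 / \<epsilon> * (LINT r|lborel. norm (h r)) \<le> \<delta>"
          using \<open>\<epsilon> > 0\<close> unfolding I_def[symmetric] by (simp add: field_simps)
      qed
      finally show ?thesis .
    qed
    ultimately show ?thesis using V(1) by (intro exI[of _ "V \<union> H"]) (auto simp: H_def)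
  qed
  have "AE t in lborel. good \<epsilon> t" if "\<epsilon> > 0" for \<epsilon>
  proof -
    have "\<exists>W. W \<in> sets lborel \<and> {t. \<not> good \<epsilon> t} \<subseteq> W \<and> emeasure lborel W \<le> ennreal (inverse (Suc n))" for n
      by (rule cover[OF that]) simp
    then obtain W where W: "\<And>n::nat. W n \<in> sets lborel" "\<And>n. {t. \<not> good \<epsilon> t} \<subseteq> W n"
      "\<And>n. emeasure lborel (W n) \<le> ennreal (inverse (Suc n))"
      by metis
    have "emeasure lborel (\<Inter>n. W n) \<le> 0"
    proof (rule LIMSEQ_le_const)
      show "(\<lambda>n. ennreal (inverse (real (Suc n)))) \<longlonglongrightarrow> 0"
        using tendsto_ennrealI[OF LIMSEQ_inverse_real_of_nat] by simp
      show "\<exists>N. \<forall>n\<ge>N. emeasure lborel (\<Inter>n. W n) \<le> ennreal (inverse (real (Suc n)))"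
        by (intro exI allI impI order_trans[OF emeasure_mono W(3)]) (use W(1) in auto)
    qed
    then have "(\<Inter>n. W n) \<in> null_sets lborel" using W(1) by (intro null_setsI) auto
    then show ?thesis by (rule AE_I') (use W(2) in auto)
  qed
  then have "AE t in lborel. \<forall>n::nat. good (inverse (Suc n)) t"
    by (subst AE_all_countable) auto
  then show ?thesis
  proof eventually_elim
    case (elim t)
    show ?case unfolding lebesgue_point_def
    proof (intro allI impI)
      fix \<epsilon> :: real assume "\<epsilon> > 0"
      then obtain n where n: "inverse (real (Suc n)) < \<epsilon>" using reals_Archimedean by blast
      obtain \<eta> where \<eta>: "\<eta> > 0" "\<And>s. 0 < s \<Longrightarrow> s \<le> \<eta> \<Longrightarrow> (\<integral>\<^sup>+r\<in>ball t s. norm (f r - f t) \<partial>lborel) \<le> ennreal (inverse (Suc n) * s)"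
        using elim[rule_format, of n] unfolding good_def by blast
      have "ennreal (inverse (Suc n) * s) \<le> ennreal (\<epsilon> * s)" if "0 < s" for s
        using n that by (intro ennreal_leI mult_right_mono) auto
      with \<eta> show "\<exists>\<eta>>0. \<forall>s. 0 < s \<and> s \<le> \<eta> \<longrightarrow> (\<integral>\<^sup>+r\<in>ball t s. norm (f r - f t) \<partial>lborel) \<le> ennreal (\<epsilon> * s)"
        by (meson order_trans)
    qed
  qed
qed

text \<open>Being a Lebesgue point is a local property: for \<open>n > \<bar>t\<bar> + 1\<close> and
  \<open>s \<le> 1\<close> the truncation to \<open>ball 0 n\<close> does not change the integral
  over \<open>ball t s\<close>.\<close>

lemma AE_lebesgue_point:
  fixes f :: "real \<Rightarrow> complex"
  assumes f: "\<And>n::nat. integrable lborel (\<lambda>r. indicator (ball 0 n) r * f r)"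
  shows "AE t in lborel. lebesgue_point f t"
proof -
  have "AE t in lborel. \<forall>n::nat. lebesgue_point (\<lambda>r. indicator (ball 0 n) r * f r) t"
    by (subst AE_all_countable) (use AE_lebesgue_point_integrable[OF f] in auto)
  then show ?thesis
  proof eventually_elim
    case (elim t)
    obtain n :: nat where n: "\<bar>t\<bar> + 1 < n" using reals_Archimedean2 by blast
    have eq: "(\<integral>\<^sup>+r\<in>ball t s. norm (indicator (ball 0 n) r * f r - indicator (ball 0 n) t * f t) \<partial>lborel)
      = (\<integral>\<^sup>+r\<in>ball t s. norm (f r - f t) \<partial>lborel)" if "s \<le> 1" for s
    proof (rule nn_integral_cong)
      fix r
      show "ennreal (norm (indicator (ball 0 n) r * f r - indicator (ball 0 n) t * f t)) * indicator (ball t s) r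
        = ennreal (norm (f r - f t)) * indicator (ball t s) r"
        using n that by (auto simp: indicator_def dist_real_def)
    qed
    show ?case unfolding lebesgue_point_def
    proof (intro allI impI)
      fix \<epsilon> :: real assume "\<epsilon> > 0"
      then obtain \<eta> where \<eta>: "\<eta> > 0" "\<And>s. 0 < s \<Longrightarrow> s \<le> \<eta> \<Longrightarrow>
        (\<integral>\<^sup>+r\<in>ball t s. norm (indicator (ball 0 n) r * f r - indicator (ball 0 n) t * f t) \<partial>lborel) \<le> ennreal (\<epsilon> * s)"
        using elim unfolding lebesgue_point_def by meson
      have "(\<integral>\<^sup>+r\<in>ball t s. norm (f r - f t) \<partial>lborel) \<le> ennreal (\<epsilon> * s)" if "0 < s" "s \<le> min \<eta> 1" for s
        using \<eta>(2)[of s] eq[of s] that by simp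
      then show "\<exists>\<eta>>0. \<forall>s. 0 < s \<and> s \<le> \<eta> \<longrightarrow> (\<integral>\<^sup>+r\<in>ball t s. norm (f r - f t) \<partial>lborel) \<le> ennreal (\<epsilon> * s)"
        using \<eta>(1) by (intro exI[of _ "min \<eta> 1"] conjI allI impI) auto
    qed
  qed
qed

section \<open>Dilated kernels\<close>

text \<open>The majorant against which all kernels are measured, in the end with
  \<open>\<delta> = min k 1\<close>: even, decreasing in \<open>\<bar>t\<bar>\<close>, integrable
  for \<open>\<delta> > 0\<close> and comparable with its own translates.\<close>

definition weight :: "real \<Rightarrow> real \<Rightarrow> real" where
  "weight \<delta> t = (1 + \<bar>t\<bar>) powr (- (1 + \<delta>))"

lemma weight_pos: "weight \<delta> t > 0"
  by (simp add: weight_def)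

lemma weight_measurable [measurable]: "weight \<delta> \<in> borel_measurable borel"
  unfolding weight_def by measurable

lemma weight_le_1: "\<delta> \<ge> 0 \<Longrightarrow> weight \<delta> t \<le> 1"
  unfolding weight_def by (subst powr_minus) (auto simp: field_simps ge_one_powr_ge_zero)

lemma weight_minus [simp]: "weight \<delta> (- t) = weight \<delta> t"
  by (simp add: weight_def)

text \<open>From \<open>1 + \<bar>s + t\<bar> \<le> (1 + \<bar>t\<bar>) * (1 +
  \<bar>s\<bar>)\<close>. Integrability of an orbit against the weight therefore does not depend on
  the base point.\<close>

lemma weight_shift:
  assumes "\<delta> \<ge> 0"
  shows "weight \<delta> s \<le> (1 + \<bar>t\<bar>) powr (1 + \<delta>) * weight \<delta> (s + t)"
proof -
  have "1 + \<bar>s + t\<bar> \<le> (1 + \<bar>t\<bar>) * (1 + \<bar>s\<bar>)"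
    using mult_nonneg_nonneg[OF abs_ge_zero abs_ge_zero, of s t] abs_triangle_ineq[of s t]
    unfolding distrib_left distrib_right mult_1 mult_1_right mult.commute[of "\<bar>t\<bar>"] by linarith
  then have "((1 + \<bar>t\<bar>) * (1 + \<bar>s\<bar>)) powr (- (1 + \<delta>)) \<le> (1 + \<bar>s + t\<bar>) powr (- (1 + \<delta>))"
    using assms by (intro powr_mono2') auto
  then have "(1 + \<bar>t\<bar>) powr (- (1 + \<delta>)) * weight \<delta> s \<le> weight \<delta> (s + t)"
    by (simp add: weight_def powr_mult)
  then have "(1 + \<bar>t\<bar>) powr (1 + \<delta>) * ((1 + \<bar>t\<bar>) powr (- (1 + \<delta>)) * weight \<delta> s)
    \<le> (1 + \<bar>t\<bar>) powr (1 + \<delta>) * weight \<delta> (s + t)"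
    by (intro mult_left_mono) auto
  moreover have "(1 + \<bar>t\<bar>) powr (1 + \<delta>) * (1 + \<bar>t\<bar>) powr (- (1 + \<delta>)) = 1"
    by (simp flip: powr_add)
  ultimately show ?thesis by (simp flip: mult.assoc)
qed

text \<open>The least \<open>j\<close> with \<open>\<bar>y\<bar> < 2 ^ j\<close> alone contributes
  enough; the factor \<open>2 powr (1 + \<delta>)\<close> pays for the step from
  \<open>2 ^ (j - 1) \<le> \<bar>y\<bar>\<close> to \<open>2 ^ j\<close>. Integrals against the
  weight are thereby reduced to integrals over balls.\<close>

lemma weight_dyadic:
  assumes "\<delta> > 0"
  shows "ennreal (weight \<delta> y) \<le> (\<Sum>j. ennreal (2 powr (1 + \<delta>) * (2 powr (- (1 + \<delta>))) ^ j) * indicator (ball 0 (2 ^ j)) y)"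
proof -
  define a where "a = 1 + \<delta>"
  have a: "a > 0" using assms by (simp add: a_def)
  obtain N where N: "\<bar>y\<bar> < 2 ^ N" using real_arch_pow[of 2 "\<bar>y\<bar>"] by auto
  define j where "j = (LEAST j. \<bar>y\<bar> < 2 ^ j)"
  have j: "\<bar>y\<bar> < 2 ^ j" unfolding j_def by (rule LeastI[of "\<lambda>j. \<bar>y\<bar> < 2 ^ j" N]) (rule N)
  have "weight \<delta> y \<le> 2 powr a * (2 powr (- a)) ^ j"
  proof (cases j)
    case 0
    have "weight \<delta> y \<le> 1" using weight_le_1[of \<delta>] assms by simp
    also have "\<dots> \<le> 2 powr a" using a by (simp add: ge_one_powr_ge_zero)
    finally show ?thesis using 0 by simp
  next
    case (Suc i)
    have "\<not> \<bar>y\<bar> < 2 ^ i" using not_less_Least[of i "\<lambda>j. \<bar>y\<bar> < 2 ^ j"] Suc by (simp add: j_def)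
    then have "2 ^ i \<le> 1 + \<bar>y\<bar>" by simp
    then have "weight \<delta> y \<le> (2 ^ i) powr (- a)"
      unfolding weight_def a_def using assms by (intro powr_mono2') auto
    also have "\<dots> = (2 powr (- a)) ^ i"
      by (simp add: powr_powr mult.commute flip: powr_realpow)
    also have "\<dots> = 2 powr a * (2 powr (- a)) ^ j"
      by (simp add: Suc powr_minus)
    finally show ?thesis .
  qed
  then have "ennreal (weight \<delta> y) \<le> (\<Sum>k\<in>{j}. ennreal (2 powr a * (2 powr (- a)) ^ k) * indicator (ball 0 (2 ^ k)) y)"
    using j by (simp add: ennreal_leI)
  also have "\<dots> \<le> (\<Sum>k. ennreal (2 powr a * (2 powr (- a)) ^ k) * indicator (ball 0 (2 ^ k)) y)"
    by (rule sum_le_suminf) auto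
  finally show ?thesis by (simp add: a_def)
qed

lemma suminf_weight_dyadic:
  assumes "\<delta> > 0" "c \<ge> 0"
  shows "(\<Sum>j. ennreal (2 powr (1 + \<delta>) * (2 powr (- (1 + \<delta>))) ^ j) * ennreal (c * 2 ^ j))
    = ennreal (c * (2 powr (1 + \<delta>) / (1 - 2 powr (- \<delta>))))"
proof -
  have q: "2 powr (- (1 + \<delta>)) * 2 = 2 powr (- \<delta>)"
    using powr_add[of 2 "- (1 + \<delta>)" 1] by simp
  have lt1: "2 powr (- \<delta>) < (1 :: real)" using assms by (simp add: powr_less_one)
  have "ennreal (2 powr (1 + \<delta>) * (2 powr (- (1 + \<delta>))) ^ j) * ennreal (c * 2 ^ j)
    = ennreal (c * 2 powr (1 + \<delta>) * (2 powr (- \<delta>)) ^ j)" for j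
    using assms by (simp add: algebra_simps power_mult_distrib flip: ennreal_mult q)
  then have "(\<Sum>j. ennreal (2 powr (1 + \<delta>) * (2 powr (- (1 + \<delta>))) ^ j) * ennreal (c * 2 ^ j))
    = (\<Sum>j. ennreal (c * 2 powr (1 + \<delta>) * (2 powr (- \<delta>)) ^ j))"
    by (rule suminf_cong)
  moreover have "(\<lambda>j. c * 2 powr (1 + \<delta>) * (2 powr (- \<delta>)) ^ j) sums (c * 2 powr (1 + \<delta>) * (1 / (1 - 2 powr (- \<delta>))))"
    using lt1 by (intro sums_mult geometric_sums) auto
  then have "(\<Sum>j. ennreal (c * 2 powr (1 + \<delta>) * (2 powr (- \<delta>)) ^ j)) = ennreal (c * 2 powr (1 + \<delta>) * (1 / (1 - 2 powr (- \<delta>))))"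
    by (rule suminf_ennreal_eq[rotated]) (use assms in auto)
  ultimately show ?thesis by simp
qed

text \<open>The bounds over the balls grow like \<open>2 ^ j\<close> while the dyadic coefficients
  decay like \<open>2 powr (- (1 + \<delta>))\<close> to the power \<open>j\<close>; what remains is
  a geometric series of ratio \<open>2 powr (- \<delta>)\<close>.\<close>

lemma nn_integral_weight_le:
  assumes "\<delta> > 0" "c \<ge> 0" and [measurable]: "h \<in> borel_measurable borel"
    and le: "\<And>j::nat. (\<integral>\<^sup>+s. h s * indicator (ball 0 (2 ^ j)) (x * s) \<partial>lborel) \<le> ennreal (c * 2 ^ j)"
  shows "(\<integral>\<^sup>+s. h s * ennreal (weight \<delta> (x * s)) \<partial>lborel) \<le> ennreal (c * (2 powr (1 + \<delta>) / (1 - 2 powr (- \<delta>))))"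
proof -
  let ?b = "\<lambda>j::nat. ennreal (2 powr (1 + \<delta>) * (2 powr (- (1 + \<delta>))) ^ j)"
  have "(\<integral>\<^sup>+s. h s * ennreal (weight \<delta> (x * s)) \<partial>lborel)
    \<le> (\<integral>\<^sup>+s. (\<Sum>j. ?b j * (h s * indicator (ball 0 (2 ^ j)) (x * s))) \<partial>lborel)"
  proof (rule nn_integral_mono)
    fix s
    have "h s * ennreal (weight \<delta> (x * s)) \<le> h s * (\<Sum>j. ?b j * indicator (ball 0 (2 ^ j)) (x * s))"
      by (intro mult_left_mono weight_dyadic assms) auto
    also have "\<dots> = (\<Sum>j. h s * (?b j * indicator (ball 0 (2 ^ j)) (x * s)))"
      by (rule ennreal_suminf_cmult[symmetric])
    also have "\<dots> = (\<Sum>j. ?b j * (h s * indicator (ball 0 (2 ^ j)) (x * s)))"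
      by (intro suminf_cong mult.left_commute)
    finally show "h s * ennreal (weight \<delta> (x * s)) \<le> (\<Sum>j. ?b j * (h s * indicator (ball 0 (2 ^ j)) (x * s)))" .
  qed
  also have "\<dots> = (\<Sum>j. ?b j * (\<integral>\<^sup>+s. h s * indicator (ball 0 (2 ^ j)) (x * s) \<partial>lborel))"
    by (subst nn_integral_suminf, measurable, simp add: nn_integral_cmult)
  also have "\<dots> \<le> (\<Sum>j. ?b j * ennreal (c * 2 ^ j))"
    by (intro suminf_le mult_left_mono le) auto
  also have "\<dots> = ennreal (c * (2 powr (1 + \<delta>) / (1 - 2 powr (- \<delta>))))"
    by (rule suminf_weight_dyadic[OF assms(1,2)])
  finally show ?thesis .
qed

lemma integrable_weight:
  assumes "\<delta> > 0"
  shows "integrable lborel (weight \<delta>)"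
proof (rule integrableI_nonneg)
  have "(\<integral>\<^sup>+s. 1 * ennreal (weight \<delta> (1 * s)) \<partial>lborel) \<le> ennreal (2 * (2 powr (1 + \<delta>) / (1 - 2 powr (- \<delta>))))"
    by (rule nn_integral_weight_le) (use assms in \<open>auto simp: ball_eq_greaterThanLessThan ennreal_mult\<close>)
  then show "(\<integral>\<^sup>+s. ennreal (weight \<delta> s) \<partial>lborel) < \<infinity>"
    by (simp add: le_less_trans[OF _ ennreal_less_top])
qed (use weight_pos in \<open>auto simp: less_imp_le\<close>)

text \<open>Near 0 the smallness over balls is summed dyadically, with a bound that does not involve
  \<open>x\<close>. Away from 0 the dilated weight is \<open>x powr (- \<delta>)\<close> times a
  fixed multiple of the weight, against which \<open>g\<close> is integrable.\<close>

lemma weight_dilation_tendsto_0: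
  fixes g :: "real \<Rightarrow> complex"
  assumes \<delta>: "\<delta> > 0" and [measurable]: "g \<in> borel_measurable borel"
    and fin: "(\<integral>\<^sup>+s. norm (g s) * weight \<delta> s \<partial>lborel) < \<infinity>"
    and small: "\<And>\<epsilon>. \<epsilon> > 0 \<Longrightarrow> \<exists>\<eta>>0. \<forall>s. 0 < s \<and> s \<le> \<eta> \<longrightarrow> (\<integral>\<^sup>+r\<in>ball 0 s. norm (g r) \<partial>lborel) \<le> ennreal (\<epsilon> * s)"
    and "\<epsilon> > 0"
  shows "\<forall>\<^sub>F x in at_top. (\<integral>\<^sup>+s. norm (g s) * (x * weight \<delta> (x * s)) \<partial>lborel) \<le> ennreal \<epsilon>"
proof -
  define S where "S = 2 powr (1 + \<delta>) / (1 - 2 powr (- \<delta>))"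
  have S: "S > 0" using \<delta> by (simp add: S_def powr_less_one)
  \<comment> \<open>\<open>S\<close> is the sum of the dyadic series, so the part near 0 contributes
    exactly \<open>\<epsilon> / 2\<close>.\<close>
  obtain \<eta> where \<eta>: "\<eta> > 0" "\<And>s. 0 < s \<Longrightarrow> s \<le> \<eta> \<Longrightarrow>
    (\<integral>\<^sup>+r\<in>ball 0 s. norm (g r) \<partial>lborel) \<le> ennreal (\<epsilon> / (2 * S) * s)"
    using small[of "\<epsilon> / (2 * S)"] \<open>\<epsilon> > 0\<close> S by auto
  obtain A where A: "A \<ge> 0" "(\<integral>\<^sup>+s. norm (g s) * weight \<delta> s \<partial>lborel) = ennreal A"
    using fin by (metis ennreal_cases infinity_ennreal_def less_irrefl)
  \<comment> \<open>For \<open>\<bar>s\<bar> \<ge> \<eta>\<close> one has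
    \<open>1 + \<bar>s\<bar> \<le> (1 + 1 / \<eta>) * \<bar>s\<bar>\<close>, which compares the pure
    power of \<open>\<bar>s\<bar>\<close> with the weight.\<close>
  define c where "c = (1 + 1 / \<eta>) powr (1 + \<delta>)"
  have "((\<lambda>x. x powr (- \<delta>) * c * A) \<longlongrightarrow> 0 * c * A) at_top"
    using \<delta> by (intro tendsto_intros tendsto_neg_powr filterlim_ident) auto
  then have "\<forall>\<^sub>F x in at_top. x powr (- \<delta>) * c * A < \<epsilon> / 2"
    using \<open>\<epsilon> > 0\<close> by (intro order_tendstoD(2)) auto
  then show ?thesis
    using eventually_gt_at_top[of 0]
  proof eventually_elim
    case (elim x)
    then have x: "x > 0" by simp
    have near: "(\<integral>\<^sup>+s. ennreal (norm (g s)) * indicator (ball 0 \<eta>) s * ennreal (weight \<delta> (x * s)) \<partial>lborel)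
      \<le> ennreal (\<epsilon> / (2 * S) / x * S)"
    proof (rule nn_integral_weight_le[OF \<delta>, folded S_def])
      fix j :: nat
      \<comment> \<open>The radius of the intersection of \<open>ball 0 \<eta>\<close> with the ball
        of radius \<open>2 ^ j / x\<close>; it never exceeds \<open>\<eta>\<close>, so the
        hypothesis on small balls applies for every \<open>j\<close>.\<close>
      define s where "s = min \<eta> (2 ^ j / x)"
      have s: "0 < s" "s \<le> \<eta>" "s \<le> 2 ^ j / x" using \<eta>(1) x by (auto simp: s_def)
      have "indicator (ball 0 \<eta>) r * indicator (ball 0 (2 ^ j)) (x * r) = (indicator (ball 0 s) r :: ennreal)" for r
        using x by (auto simp: indicator_def s_def abs_mult field_simps)
      then have "(\<integral>\<^sup>+r. ennreal (norm (g r)) * indicator (ball 0 \<eta>) r * indicator (ball 0 (2 ^ j)) (x * r) \<partial>lborel)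
        = (\<integral>\<^sup>+r\<in>ball 0 s. norm (g r) \<partial>lborel)"
        by (simp add: mult.assoc)
      also have "\<dots> \<le> ennreal (\<epsilon> / (2 * S) * s)" by (rule \<eta>(2)[OF s(1,2)])
      also have "\<dots> \<le> ennreal (\<epsilon> / (2 * S) * (2 ^ j / x))"
        using s \<open>\<epsilon> > 0\<close> S by (intro ennreal_leI mult_left_mono) auto
      finally show "(\<integral>\<^sup>+r. ennreal (norm (g r)) * indicator (ball 0 \<eta>) r * indicator (ball 0 (2 ^ j)) (x * r) \<partial>lborel)
        \<le> ennreal (\<epsilon> / (2 * S) / x * 2 ^ j)"
        by simp
    qed (use \<open>\<epsilon> > 0\<close> S x in auto)
    have far: "x * weight \<delta> (x * s) \<le> x powr (- \<delta>) * c * weight \<delta> s" if "\<eta> \<le> \<bar>s\<bar>" for s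
    proof -
      have s: "\<bar>s\<bar> > 0" using \<eta>(1) that by simp
      have "weight \<delta> (x * s) \<le> (x * \<bar>s\<bar>) powr (- (1 + \<delta>))"
        unfolding weight_def using x s \<delta> by (intro powr_mono2') (auto simp: abs_mult)
      then have "x * weight \<delta> (x * s) \<le> x * (x powr (- (1 + \<delta>)) * \<bar>s\<bar> powr (- (1 + \<delta>)))"
        using x by (intro mult_left_mono) (auto simp: powr_mult)
      also have "\<dots> = x powr (- \<delta>) * \<bar>s\<bar> powr (- (1 + \<delta>))"
        using x powr_add[of x 1 "- (1 + \<delta>)"] by simp
      also have "\<dots> \<le> x powr (- \<delta>) * (c * weight \<delta> s)"
      proof (intro mult_left_mono)
        have "1 + \<bar>s\<bar> \<le> (1 + 1 / \<eta>) * \<bar>s\<bar>"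
          using that \<eta>(1) by (simp add: field_simps)
        then have "((1 + 1 / \<eta>) * \<bar>s\<bar>) powr (- (1 + \<delta>)) \<le> weight \<delta> s"
          unfolding weight_def using \<delta> s by (intro powr_mono2') auto
        then have "c * ((1 + 1 / \<eta>) powr (- (1 + \<delta>)) * \<bar>s\<bar> powr (- (1 + \<delta>))) \<le> c * weight \<delta> s"
          using \<eta>(1) by (intro mult_left_mono) (auto simp: powr_mult c_def)
        moreover have "c * (1 + 1 / \<eta>) powr (- (1 + \<delta>)) = 1"
          unfolding c_def using \<eta>(1) by (simp add: add_pos_pos less_imp_neq[THEN not_sym] flip: powr_add)
        ultimately show "\<bar>s\<bar> powr (- (1 + \<delta>)) \<le> c * weight \<delta> s"
          by (simp flip: mult.assoc)
      qed auto
      finally show ?thesis by (simp add: mult.assoc)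
    qed
    have "(\<integral>\<^sup>+s. norm (g s) * (x * weight \<delta> (x * s)) \<partial>lborel)
      \<le> (\<integral>\<^sup>+s. ennreal x * (ennreal (norm (g s)) * indicator (ball 0 \<eta>) s * ennreal (weight \<delta> (x * s)))
          + ennreal (x powr (- \<delta>) * c) * ennreal (norm (g s) * weight \<delta> s) \<partial>lborel)"
    proof (rule nn_integral_mono)
      fix s
      show "ennreal (norm (g s) * (x * weight \<delta> (x * s)))
        \<le> ennreal x * (ennreal (norm (g s)) * indicator (ball 0 \<eta>) s * ennreal (weight \<delta> (x * s)))
          + ennreal (x powr (- \<delta>) * c) * ennreal (norm (g s) * weight \<delta> s)"
      proof (cases "\<bar>s\<bar> < \<eta>")
        case True
        then have "ennreal (norm (g s) * (x * weight \<delta> (x * s)))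
          = ennreal x * (ennreal (norm (g s)) * indicator (ball 0 \<eta>) s * ennreal (weight \<delta> (x * s)))"
          using x weight_pos[of \<delta> "x * s"] by (simp add: mult_ac flip: ennreal_mult)
        then show ?thesis by (simp add: add_increasing2)
      next
        case False
        then have "norm (g s) * (x * weight \<delta> (x * s)) \<le> norm (g s) * (x powr (- \<delta>) * c * weight \<delta> s)"
          by (intro mult_left_mono far) auto
        then have "ennreal (norm (g s) * (x * weight \<delta> (x * s))) \<le> ennreal (x powr (- \<delta>) * c) * ennreal (norm (g s) * weight \<delta> s)"
          using weight_pos[of \<delta> s] by (simp add: c_def mult_ac ennreal_leI flip: ennreal_mult)
        then show ?thesis by (simp add: add_increasing)
      qed
    qed
    also have "\<dots> = ennreal x * (\<integral>\<^sup>+s. ennreal (norm (g s)) * indicator (ball 0 \<eta>) s * ennreal (weight \<delta> (x * s)) \<partial>lborel)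
        + ennreal (x powr (- \<delta>) * c) * ennreal A"
      by (subst nn_integral_add) (auto simp: nn_integral_cmult A(2))
    also have "\<dots> \<le> ennreal x * ennreal (\<epsilon> / (2 * S) / x * S) + ennreal (x powr (- \<delta>) * c) * ennreal A"
      by (intro add_mono mult_left_mono near) auto
    also have "\<dots> = ennreal (\<epsilon> / 2 + x powr (- \<delta>) * c * A)"
      using x S \<open>\<epsilon> > 0\<close> A(1) by (simp add: c_def flip: ennreal_mult ennreal_plus)
    also have "\<dots> \<le> ennreal \<epsilon>" using elim(1) by (intro ennreal_leI) simp
    finally show ?case .
  qed
qed

text \<open>Since \<open>K\<close> has integral 1, the error is the integral of
  \<open>g s = f (t + s) - f t\<close> against the dilated kernel. Only the majorant enters, so
  neither positivity nor monotonicity of \<open>K\<close> matters.\<close>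

lemma approximate_identity_lebesgue_point:
  fixes f :: "real \<Rightarrow> complex" and K :: "real \<Rightarrow> real"
  assumes \<delta>: "\<delta> > 0" and [measurable]: "f \<in> borel_measurable borel" "K \<in> borel_measurable borel"
    and fin: "(\<integral>\<^sup>+s. norm (f s) * weight \<delta> s \<partial>lborel) < \<infinity>"
    and K: "\<And>s. \<bar>K s\<bar> \<le> C * weight \<delta> s" "(LINT s|lborel. K s) = 1"
    and point: "lebesgue_point f t"
  shows "((\<lambda>x. LINT s|lborel. f (t + s) * of_real (x * K (x * s))) \<longlongrightarrow> f t) at_top"
proof -
  have "0 \<le> C * weight \<delta> 0" by (rule order_trans[OF abs_ge_zero K(1)])
  then have C: "C \<ge> 0" using weight_pos[of \<delta> 0] by (simp add: zero_le_mult_iff)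
  define g where "g s = f (t + s) - f t" for s
  have [measurable]: "g \<in> borel_measurable borel" unfolding g_def by measurable
  define c where "c = (1 + \<bar>t\<bar>) powr (1 + \<delta>)"
  have "c \<ge> 0" by (simp add: c_def)
  have w0: "weight \<delta> s \<ge> 0" for s using weight_pos[of \<delta> s] by simp
  obtain A where A: "A \<ge> 0" "(\<integral>\<^sup>+s. norm (f s) * weight \<delta> s \<partial>lborel) = ennreal A"
    using fin by (metis ennreal_cases infinity_ennreal_def less_irrefl)
  have g_fin: "(\<integral>\<^sup>+s. norm (g s) * weight \<delta> s \<partial>lborel) < \<infinity>"
  proof -
    have "(\<integral>\<^sup>+s. norm (g s) * weight \<delta> s \<partial>lborel)
      \<le> (\<integral>\<^sup>+s. ennreal c * ennreal (norm (f (t + 1 * s)) * weight \<delta> (t + 1 * s)) + ennreal (norm (f t)) * ennreal (weight \<delta> s) \<partial>lborel)"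
    proof (rule nn_integral_mono)
      fix s
      have "norm (g s) * weight \<delta> s \<le> norm (f (t + s)) * weight \<delta> s + norm (f t) * weight \<delta> s"
        unfolding g_def distrib_right[symmetric]
        by (intro mult_right_mono norm_triangle_ineq4 w0)
      also have "\<dots> \<le> norm (f (t + s)) * (c * weight \<delta> (t + s)) + norm (f t) * weight \<delta> s"
        using weight_shift[of \<delta> s t] \<delta> by (intro add_right_mono mult_left_mono) (auto simp: c_def add.commute)
      finally show "ennreal (norm (g s) * weight \<delta> s) \<le> ennreal c * ennreal (norm (f (t + 1 * s)) * weight \<delta> (t + 1 * s)) + ennreal (norm (f t)) * ennreal (weight \<delta> s)"
        using w0 \<open>c \<ge> 0\<close> by (simp add: ennreal_leI mult_ac flip: ennreal_mult ennreal_plus)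
    qed
    also have "\<dots> = ennreal c * (\<integral>\<^sup>+s. norm (f (t + 1 * s)) * weight \<delta> (t + 1 * s) \<partial>lborel) + ennreal (norm (f t)) * (\<integral>\<^sup>+s. weight \<delta> s \<partial>lborel)"
      by (subst nn_integral_add) (auto simp: nn_integral_cmult)
    also have "(\<integral>\<^sup>+s. norm (f (t + 1 * s)) * weight \<delta> (t + 1 * s) \<partial>lborel) = (\<integral>\<^sup>+s. norm (f s) * weight \<delta> s \<partial>lborel)"
      using nn_integral_real_affine[of "\<lambda>s. ennreal (norm (f s) * weight \<delta> s)" 1 t] by simp
    also have "(\<integral>\<^sup>+s. weight \<delta> s \<partial>lborel) = ennreal (LINT s|lborel. weight \<delta> s)"
      using integrable_weight[OF \<delta>] w0 by (intro nn_integral_eq_integral) auto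
    also have "ennreal c * (\<integral>\<^sup>+s. norm (f s) * weight \<delta> s \<partial>lborel) + ennreal (norm (f t)) * ennreal (LINT s|lborel. weight \<delta> s)
      = ennreal (c * A + norm (f t) * (LINT s|lborel. weight \<delta> s))"
      using A \<open>c \<ge> 0\<close> w0 by (simp add: ennreal_mult ennreal_plus)
    finally show ?thesis by (simp add: le_less_trans[OF _ ennreal_less_top])
  qed
  have Kint: "integrable lborel K"
    by (rule Bochner_Integration.integrable_bound[of _ "\<lambda>s. C * weight \<delta> s"])
      (use integrable_weight[OF \<delta>] K(1) C w0 in \<open>auto simp: abs_mult\<close>)
  have small: "\<exists>\<eta>>0. \<forall>s. 0 < s \<and> s \<le> \<eta> \<longrightarrow> (\<integral>\<^sup>+r\<in>ball 0 s. norm (g r) \<partial>lborel) \<le> ennreal (\<epsilon> * s)"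
    if "\<epsilon> > 0" for \<epsilon>
  proof -
    have "(\<integral>\<^sup>+r\<in>ball t s. norm (f r - f t) \<partial>lborel) = (\<integral>\<^sup>+r\<in>ball 0 s. norm (g r) \<partial>lborel)" for s
    proof -
      have "(\<integral>\<^sup>+r\<in>ball t s. norm (f r - f t) \<partial>lborel)
        = (\<integral>\<^sup>+r. ennreal (norm (f (t + 1 * r) - f t)) * indicator (ball t s) (t + 1 * r) \<partial>lborel)"
        using nn_integral_real_affine[of "\<lambda>r. ennreal (norm (f r - f t)) * indicator (ball t s) r" 1 t] by simp
      also have "\<dots> = (\<integral>\<^sup>+r\<in>ball 0 s. norm (g r) \<partial>lborel)"
        by (intro nn_integral_cong) (auto simp: g_def indicator_def dist_real_def)
      finally show ?thesis .
    qed
    then show ?thesis using point that unfolding lebesgue_point_def by simp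
  qed
  show ?thesis
  proof (rule tendstoI)
    fix \<epsilon> :: real assume "\<epsilon> > 0"
    \<comment> \<open>The \<open>+ 1\<close> ensures \<open>C * e < \<epsilon>\<close> and a
      positive divisor also when \<open>C = 0\<close>.\<close>
    define e where "e = \<epsilon> / (2 * (C + 1))"
    have e: "e > 0" "C * e < \<epsilon>" using \<open>\<epsilon> > 0\<close> C by (auto simp: e_def field_simps add_nonneg_pos intro: mult_strict_left_mono)
    have "\<forall>\<^sub>F x in at_top. (\<integral>\<^sup>+s. norm (g s) * (x * weight \<delta> (x * s)) \<partial>lborel) \<le> ennreal e"
      by (rule weight_dilation_tendsto_0[OF \<delta> \<open>g \<in> borel_measurable borel\<close> g_fin]) (use small e(1) in auto)
    then show "\<forall>\<^sub>F x in at_top. dist (LINT s|lborel. f (t + s) * of_real (x * K (x * s))) (f t) < \<epsilon>"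
      using eventually_gt_at_top[of 0]
    proof eventually_elim
      case (elim x)
      then have x: "x > 0" by simp
      have iK: "integrable lborel (\<lambda>s. x * K (x * s))"
        using lborel_integrable_real_affine[OF Kint, of x 0] x by simp
      have one: "(LINT s|lborel. x * K (x * s)) = 1"
        using lborel_integral_real_affine[of x K 0] x K(2) by simp
      have bound: "ennreal (norm (g s * of_real (x * K (x * s)))) \<le> ennreal C * ennreal (norm (g s) * (x * weight \<delta> (x * s)))" for s
      proof -
        have "norm (g s) * (x * \<bar>K (x * s)\<bar>) \<le> norm (g s) * (x * (C * weight \<delta> (x * s)))"
          using x by (intro mult_left_mono K) auto
        then show ?thesis using x C w0 by (simp add: norm_mult abs_mult ennreal_leI mult_ac flip: ennreal_mult)
      qed
      have "(\<integral>\<^sup>+s. norm (g s * of_real (x * K (x * s))) \<partial>lborel) \<le> (\<integral>\<^sup>+s. ennreal C * ennreal (norm (g s) * (x * weight \<delta> (x * s))) \<partial>lborel)"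
        by (rule nn_integral_mono) (rule bound)
      also have "\<dots> = ennreal C * (\<integral>\<^sup>+s. norm (g s) * (x * weight \<delta> (x * s)) \<partial>lborel)"
        by (simp add: nn_integral_cmult)
      also have "\<dots> \<le> ennreal C * ennreal e" by (intro mult_left_mono elim) auto
      also have "\<dots> = ennreal (C * e)" using C e by (simp add: ennreal_mult)
      finally have le: "(\<integral>\<^sup>+s. norm (g s * of_real (x * K (x * s))) \<partial>lborel) \<le> ennreal (C * e)" .
      have ig: "integrable lborel (\<lambda>s. g s * of_real (x * K (x * s)))"
      proof (rule integrableI_bounded)
        show "(\<integral>\<^sup>+s. norm (g s * of_real (x * K (x * s))) \<partial>lborel) < \<infinity>"
          by (rule le_less_trans[OF le]) simp
      qed measurable
      have "norm (LINT s|lborel. g s * of_real (x * K (x * s))) \<le> C * e"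
        using integral_norm_bound_ennreal[OF ig] le C e by (simp add: ennreal_le_iff[symmetric] del: ennreal_le_iff)
      moreover have "(LINT s|lborel. f (t + s) * of_real (x * K (x * s)))
        = (LINT s|lborel. g s * of_real (x * K (x * s)) + f t * of_real (x * K (x * s)))"
        by (intro Bochner_Integration.integral_cong refl) (simp add: g_def algebra_simps)
      moreover have "\<dots> = (LINT s|lborel. g s * of_real (x * K (x * s))) + f t"
      proof -
        have "(LINT s|lborel. f t * of_real (x * K (x * s))) = f t"
          using one by (simp only: integral_mult_right_zero integral_complex_of_real of_real_1 mult_1_right)
        moreover have "integrable lborel (\<lambda>s. f t * of_real (x * K (x * s)))"
          by (intro integrable_mult_right integrable_of_real iK)
        ultimately show ?thesis
          by (simp only: Bochner_Integration.integral_add[OF ig])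
      qed
      ultimately show ?case using e by (simp add: dist_norm)
    qed
  qed
qed

section \<open>Fourier inversion\<close>

lemma exp_half_line:
  fixes c :: complex
  assumes c: "Re c > 0"
  shows "integrable lborel (\<lambda>t. indicator {0<..} t *\<^sub>R exp (- c * of_real t))"
    and "(LINT t|lborel. indicator {0<..} t *\<^sub>R exp (- c * of_real t)) = 1 / c"
proof -
  have decay: "((\<lambda>t. exp (- (Re c * t))) \<longlongrightarrow> 0) at_top"
  proof (rule filterlim_compose[OF exp_at_bot])
    have "filterlim (\<lambda>t. Re c * t) at_top at_top"
      by (rule filterlim_tendsto_pos_mult_at_top[OF tendsto_const c filterlim_ident])
    then show "filterlim (\<lambda>t. - (Re c * t)) at_bot at_top"
      by (simp add: filterlim_uminus_at_bot)
  qed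
  have "set_integrable lborel (einterval 0 \<infinity>) (\<lambda>t. exp (- (Re c * t)))"
  proof (rule interval_integral_FTC_nonneg(1)[where F = "\<lambda>t. - exp (- (Re c * t)) / Re c"])
    show "((\<lambda>t. - exp (- (Re c * t)) / Re c) has_real_derivative exp (- (Re c * t))) (at t)" for t
      using c by (auto intro!: derivative_eq_intros)
    have "((\<lambda>t. - exp (- (Re c * t)) / Re c) \<longlongrightarrow> - exp (- (Re c * 0)) / Re c) (at_right 0)"
      using c by (intro tendsto_intros) auto
    then show "(((\<lambda>t. - exp (- (Re c * t)) / Re c) \<circ> real_of_ereal) \<longlongrightarrow> - exp (- (Re c * 0)) / Re c) (at_right 0)"
      unfolding zero_ereal_def by (simp add: ereal_tendsto_simps)
    have "((\<lambda>t. - exp (- (Re c * t)) / Re c) \<longlongrightarrow> - 0 / Re c) at_top"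
      using c decay by (intro tendsto_intros) auto
    then show "(((\<lambda>t. - exp (- (Re c * t)) / Re c) \<circ> real_of_ereal) \<longlongrightarrow> 0) (at_left \<infinity>)"
      by (simp add: ereal_tendsto_simps)
  qed (auto intro!: continuous_intros)
  then have "integrable lborel (\<lambda>t. indicator {0<..} t *\<^sub>R exp (- (Re c * t)))"
    by (simp add: set_integrable_def zero_ereal_def)
  then show int: "integrable lborel (\<lambda>t. indicator {0<..} t *\<^sub>R exp (- c * of_real t))"
    by (rule Bochner_Integration.integrable_bound) (auto simp: indicator_def)
  have c0: "c \<noteq> 0" using c by auto
  have "(LBINT t=0..\<infinity>. exp (- c * of_real t)) = 0 - (- (1 / c))"
  proof (rule interval_integral_FTC_integrable[where F = "\<lambda>t. - exp (- c * of_real t) / c"])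
    show "((\<lambda>t. - exp (- c * of_real t) / c) has_vector_derivative exp (- c * of_real t)) (at t)" for t
      using c0 by (auto intro!: derivative_eq_intros has_vector_derivative_real_field)
    show "set_integrable lborel (einterval 0 \<infinity>) (\<lambda>t. exp (- c * of_real t))"
      using int by (simp add: set_integrable_def zero_ereal_def)
    have "((\<lambda>t. - exp (- c * of_real t) / c) \<longlongrightarrow> - exp (- c * of_real 0) / c) (at_right 0)"
      using c0 by (intro tendsto_intros) auto
    then show "(((\<lambda>t. - exp (- c * of_real t) / c) \<circ> real_of_ereal) \<longlongrightarrow> - (1 / c)) (at_right 0)"
      unfolding zero_ereal_def by (simp add: ereal_tendsto_simps)
    have "((\<lambda>t. exp (- c * of_real t)) \<longlongrightarrow> 0) at_top"
      by (subst tendsto_norm_zero_iff[symmetric]) (use decay in simp)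
    then have "((\<lambda>t. - exp (- c * of_real t) / c) \<longlongrightarrow> - 0 / c) at_top"
      using c0 by (intro tendsto_intros) auto
    then show "(((\<lambda>t. - exp (- c * of_real t) / c) \<circ> real_of_ereal) \<longlongrightarrow> 0) (at_left \<infinity>)"
      by (simp add: ereal_tendsto_simps)
  qed (auto intro!: continuous_intros)
  then show "(LINT t|lborel. indicator {0<..} t *\<^sub>R exp (- c * of_real t)) = 1 / c"
    by (simp add: interval_lebesgue_integral_0_infty set_lebesgue_integral_def)
qed

text \<open>The two half lines contribute \<open>1 / c\<close> and \<open>1 / cnj c\<close> with
  \<open>c = Complex u (- s)\<close>. The result is \<open>2 * pi\<close> times the Poisson kernel,
  the origin of that kernel in the inversion below.\<close>

lemma fourier_exp_abs:
  assumes "u > 0"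
  shows "integrable lborel (\<lambda>t. of_real (exp (- u * \<bar>t\<bar>)) * cis (s * t))"
    and "(LINT t|lborel. of_real (exp (- u * \<bar>t\<bar>)) * cis (s * t)) = of_real (2 * u / (u\<^sup>2 + s\<^sup>2))"
proof -
  define c where "c = Complex u (- s)"
  have c: "Re c > 0" "Re (cnj c) > 0" using assms by (auto simp: c_def)
  let ?F = "\<lambda>c t. indicator {0<..} t *\<^sub>R exp (- c * complex_of_real t)"
  note F = exp_half_line[OF c(1)] exp_half_line[OF c(2)]
  have F2: "integrable lborel (\<lambda>t. ?F (cnj c) (- t))" "(LINT t|lborel. ?F (cnj c) (- t)) = 1 / cnj c"
    using lborel_integrable_real_affine[OF F(3), of "-1" 0] lborel_integral_real_affine[of "-1" "?F (cnj c)" 0] F(4)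
    by simp_all
  have e: "exp (- c * of_real t) = of_real (exp (- u * t)) * cis (s * t)"
    "exp (- cnj c * of_real (- t)) = of_real (exp (u * t)) * cis (s * t)" for t
    by (simp_all add: c_def complex_eq_iff exp_eq_polar Re_exp Im_exp)
  have ae: "AE t in lborel. ?F c t + ?F (cnj c) (- t) = of_real (exp (- u * \<bar>t\<bar>)) * cis (s * t)"
    using AE_lborel_singleton[of 0]
  proof eventually_elim
    case (elim t)
    then show ?case using e(1)[of t] e(2)[of t] by (cases "t > 0") (simp_all add: indicator_def)
  qed
  have meas: "(\<lambda>t. of_real (exp (- u * \<bar>t\<bar>)) * cis (s * t)) \<in> borel_measurable borel"
    by (intro borel_measurable_continuous_onI continuous_intros)
  have i: "integrable lborel (\<lambda>t. ?F c t + ?F (cnj c) (- t))"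
    by (intro Bochner_Integration.integrable_add F F2)
  show "integrable lborel (\<lambda>t. of_real (exp (- u * \<bar>t\<bar>)) * cis (s * t))"
    by (rule integrable_cong_AE_imp[OF i]) (use ae meas in auto)
  have "(LINT t|lborel. of_real (exp (- u * \<bar>t\<bar>)) * cis (s * t)) = (LINT t|lborel. ?F c t + ?F (cnj c) (- t))"
    by (rule integral_cong_AE) (use ae i meas in auto)
  also have "\<dots> = 1 / c + 1 / cnj c"
    using F F2 by (subst Bochner_Integration.integral_add) auto
  also have "\<dots> = of_real (2 * u / (u\<^sup>2 + s\<^sup>2))"
  proof -
    have "c * cnj c = of_real (u\<^sup>2 + s\<^sup>2)" by (simp add: complex_mult_cnj c_def)
    moreover have "c + cnj c = of_real (2 * u)" by (simp add: c_def complex_eq_iff)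
    moreover have "c \<noteq> 0" using c by auto
    ultimately show ?thesis
      by (simp add: add_divide_eq_iff divide_add_eq_iff add.commute)
  qed
  finally show "(LINT t|lborel. of_real (exp (- u * \<bar>t\<bar>)) * cis (s * t)) = of_real (2 * u / (u\<^sup>2 + s\<^sup>2))" .
qed

section \<open>The Poisson kernel as an approximate identity\<close>

lemma poisson_kernel_scale:
  assumes "u > 0"
  shows "poisson_kernel u t = 1 / u * poisson_kernel 1 (1 / u * t)"
  using assms by (simp add: poisson_kernel_def field_simps power2_eq_square)

lemma poisson_kernel_integral:
  assumes "u > 0"
  shows "integrable lborel (poisson_kernel u)" "(LINT t|lborel. poisson_kernel u t) = 1"
proof -
  have P1: "poisson_kernel 1 = (\<lambda>t. 1 / pi * inverse (1 + t\<^sup>2))"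
    by (simp add: poisson_kernel_def fun_eq_iff inverse_eq_divide)
  have "set_integrable lborel (einterval (-\<infinity>) \<infinity>) (\<lambda>t. inverse (1 + t\<^sup>2))"
    "(LBINT t=-\<infinity>..\<infinity>. inverse (1 + t\<^sup>2)) = pi / 2 - (- (pi / 2))"
    by (rule interval_integral_FTC_nonneg[where F = arctan];
        auto intro!: continuous_intros derivative_eq_intros tendsto_arctan_at_top tendsto_arctan_at_bot
          simp: ereal_tendsto_simps add_nonneg_eq_0_iff)+
  then have 1: "integrable lborel (poisson_kernel 1)" "(LINT t|lborel. poisson_kernel 1 t) = 1"
    by (simp_all add: P1 set_integrable_def interval_lebesgue_integral_def set_lebesgue_integral_def)
  have eq: "poisson_kernel u = (\<lambda>t. 1 / u * poisson_kernel 1 (0 + 1 / u * t))"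
    using poisson_kernel_scale[OF assms] by (simp add: fun_eq_iff)
  show "integrable lborel (poisson_kernel u)"
    unfolding eq using lborel_integrable_real_affine[OF 1(1), of "1 / u" 0] assms by simp
  show "(LINT t|lborel. poisson_kernel u t) = 1"
    unfolding eq using lborel_integral_real_affine[of "1 / u" "poisson_kernel 1" 0] 1(2) assms
    by (simp add: field_simps)
qed

lemma poisson_kernel_nonneg: "u > 0 \<Longrightarrow> poisson_kernel u t \<ge> 0"
  by (simp add: poisson_kernel_def)

lemma poisson_kernel_measurable [measurable]: "poisson_kernel u \<in> borel_measurable borel"
  unfolding poisson_kernel_def by measurable

lemma poisson_approximation:
  fixes \<phi> :: "real \<Rightarrow> complex"
  assumes \<phi>: "continuous_on UNIV \<phi>" and B: "\<And>y. norm (\<phi> y) \<le> B"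
  shows "(\<lambda>n. LINT z|lborel. \<phi> z * of_real (poisson_kernel (inverse (Suc n)) (z - y))) \<longlonglongrightarrow> \<phi> y"
proof -
  have [measurable]: "\<phi> \<in> borel_measurable borel" using \<phi> by (rule borel_measurable_continuous_onI)
  have P1: "integrable lborel (poisson_kernel 1)" "(LINT t|lborel. poisson_kernel 1 t) = 1"
    by (rule poisson_kernel_integral; simp)+
  have B0: "B \<ge> 0" using order_trans[OF norm_ge_zero B] .
  have "(LINT z|lborel. \<phi> z * of_real (poisson_kernel \<epsilon> (z - y)))
    = (LINT s|lborel. \<phi> (y + \<epsilon> * s) * of_real (poisson_kernel 1 s))" if "\<epsilon> > 0" for \<epsilon>
  proof -
    have "poisson_kernel \<epsilon> (\<epsilon> * s) = 1 / \<epsilon> * poisson_kernel 1 s" for s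
      using that poisson_kernel_scale[OF that, of "\<epsilon> * s"] by simp
    then show ?thesis
      using lborel_integral_real_affine[of \<epsilon> "\<lambda>z. \<phi> z * of_real (poisson_kernel \<epsilon> (z - y))" y] that
      by (simp add: scaleR_conv_of_real mult.left_commute[of _ "of_real \<epsilon>"])
  qed
  then have "(\<lambda>n. LINT z|lborel. \<phi> z * of_real (poisson_kernel (inverse (Suc n)) (z - y)))
    = (\<lambda>n. LINT s|lborel. \<phi> (y + inverse (Suc n) * s) * of_real (poisson_kernel 1 s))"
    by (intro ext) simp
  also have "\<dots> \<longlonglongrightarrow> (LINT s|lborel. \<phi> y * of_real (poisson_kernel 1 s))"
  proof (rule integral_dominated_convergence[where w = "\<lambda>s. B * poisson_kernel 1 s"])
    show "AE s in lborel. (\<lambda>n. \<phi> (y + inverse (Suc n) * s) * of_real (poisson_kernel 1 s)) \<longlonglongrightarrow> \<phi> y * of_real (poisson_kernel 1 s)"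
    proof (intro AE_I2 tendsto_mult tendsto_const)
      fix s
      have "(\<lambda>n. y + inverse (real (Suc n)) * s) \<longlonglongrightarrow> y + 0 * s"
        by (intro tendsto_intros LIMSEQ_inverse_real_of_nat)
      then show "(\<lambda>n. \<phi> (y + inverse (Suc n) * s)) \<longlonglongrightarrow> \<phi> y"
        using \<phi> by (intro continuous_on_tendsto_compose[OF \<phi>]) auto
    qed
    show "AE s in lborel. norm (\<phi> (y + inverse (Suc n) * s) * of_real (poisson_kernel 1 s)) \<le> B * poisson_kernel 1 s" for n
      by (intro AE_I2) (auto simp: norm_mult poisson_kernel_nonneg intro!: mult_right_mono B)
  qed (use P1 in auto)
  also have "(LINT s|lborel. \<phi> y * of_real (poisson_kernel 1 s)) = \<phi> y"
    using P1 by simp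
  finally show ?thesis .
qed

text \<open>The factor \<open>exp (- \<epsilon> * \<bar>t\<bar>)\<close> makes the double integral
  absolutely convergent. Exchanging the order produces the Poisson kernel, which recovers
  \<open>\<phi> y\<close> as \<open>\<epsilon>\<close> tends to 0, while integrability of
  \<open>K\<close> removes the factor on the other side.\<close>

theorem fourier_inversion:
  fixes \<phi> K :: "real \<Rightarrow> complex"
  assumes cont: "continuous_on UNIV \<phi>" and B: "\<And>y. norm (\<phi> y) \<le> B" and int: "integrable lborel \<phi>"
    and K: "\<And>t. K t = of_real (1 / (2 * pi)) * (LINT y|lborel. \<phi> y * cis (y * t))"
    and Kint: "integrable lborel K"
  shows "(LINT t|lborel. K t * cis (- (y * t))) = \<phi> y"
proof -
  have cis_meas: "(\<lambda>x::real. cis x) \<in> borel_measurable borel"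
    by (intro borel_measurable_continuous_onI continuous_intros)
  note [measurable] = measurable_compose[OF _ cis_meas]
  have [measurable]: "K \<in> borel_measurable borel" "\<phi> \<in> borel_measurable borel" using Kint int by auto
  define I where "I n = (LINT t|lborel. K t * cis (- (y * t)) * of_real (exp (- inverse (Suc n) * \<bar>t\<bar>)))" for n
  have "I \<longlonglongrightarrow> (LINT t|lborel. K t * cis (- (y * t)))"
    unfolding I_def
  proof (rule integral_dominated_convergence[where w = "\<lambda>t. norm (K t)"])
    show "AE t in lborel. (\<lambda>n. K t * cis (- (y * t)) * of_real (exp (- inverse (Suc n) * \<bar>t\<bar>))) \<longlonglongrightarrow> K t * cis (- (y * t))"
    proof (intro AE_I2)
      fix t
      have "(\<lambda>n. K t * cis (- (y * t)) * of_real (exp (- inverse (Suc n) * \<bar>t\<bar>))) \<longlonglongrightarrow> K t * cis (- (y * t)) * of_real (exp (- 0 * \<bar>t\<bar>))"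
        by (intro tendsto_intros LIMSEQ_inverse_real_of_nat)
      then show "(\<lambda>n. K t * cis (- (y * t)) * of_real (exp (- inverse (Suc n) * \<bar>t\<bar>))) \<longlonglongrightarrow> K t * cis (- (y * t))"
        by simp
    qed
    show "AE t in lborel. norm (K t * cis (- (y * t)) * of_real (exp (- inverse (Suc n) * \<bar>t\<bar>))) \<le> norm (K t)" for n
      by (intro AE_I2) (simp add: norm_mult mult_left_le)
  qed (use Kint in auto)
  moreover have I_eq: "I n = (LINT z|lborel. \<phi> z * of_real (poisson_kernel (inverse (Suc n)) (z - y)))" for n
  proof -
    define \<epsilon> where "\<epsilon> = inverse (real (Suc n))"
    have \<epsilon>: "\<epsilon> > 0" by (simp add: \<epsilon>_def)
    define H where "H t z = \<phi> z * (of_real (exp (- \<epsilon> * \<bar>t\<bar>)) * cis ((z - y) * t))" for t z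
    have [measurable]: "(\<lambda>p. H (fst p) (snd p)) \<in> borel_measurable (lborel \<Otimes>\<^sub>M lborel)"
      unfolding H_def by measurable
    have "K t * cis (- (y * t)) * of_real (exp (- \<epsilon> * \<bar>t\<bar>)) = of_real (1 / (2 * pi)) * (LINT z|lborel. H t z)" for t
    proof -
      have "H t z = \<phi> z * cis (z * t) * (cis (- (y * t)) * of_real (exp (- \<epsilon> * \<bar>t\<bar>)))" for z
        using cis_mult[of "z * t" "- (y * t)"] by (simp add: H_def algebra_simps)
      then show ?thesis by (simp add: K)
    qed
    then have "I n = of_real (1 / (2 * pi)) * (LINT t|lborel. (LINT z|lborel. H t z))"
      by (simp add: I_def \<epsilon>_def)
    also have "(LINT t|lborel. (LINT z|lborel. H t z)) = (LINT z|lborel. (LINT t|lborel. H t z))"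
    proof (rule lborel_pair.Fubini_integral[symmetric])
      have nH: "norm (H t z) = exp (- \<epsilon> * \<bar>t\<bar>) * norm (\<phi> z)" for t z
        by (simp add: H_def norm_mult)
      have "integrable (lborel \<Otimes>\<^sub>M lborel) (\<lambda>p. H (fst p) (snd p))"
      proof (rule lborel_pair.Fubini_integrable)
        have "integrable lborel (\<lambda>t. exp (- \<epsilon> * \<bar>t\<bar>))"
          using integrable_norm[OF fourier_exp_abs(1)[OF \<epsilon>, of 0]] by (simp add: norm_mult)
        then show "integrable lborel (\<lambda>x. LINT z|lborel. norm (H (fst (x, z)) (snd (x, z))))"
          by (simp add: nH)
        show "AE x in lborel. integrable lborel (\<lambda>z. H (fst (x, z)) (snd (x, z)))"
        proof (intro AE_I2)
          fix t
          have "(\<lambda>z. H t z) \<in> borel_measurable lborel" unfolding H_def by measurable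
          then show "integrable lborel (\<lambda>z. H (fst (t, z)) (snd (t, z)))"
            by (intro Bochner_Integration.integrable_bound[OF int]) (auto simp: nH mult_left_le_one_le \<epsilon> less_imp_le)
        qed
      qed simp
      then show "integrable (lborel \<Otimes>\<^sub>M lborel) (\<lambda>(t, z). H t z)"
        by (simp add: case_prod_beta')
    qed
    also have "\<dots> = (LINT z|lborel. \<phi> z * of_real (2 * \<epsilon> / (\<epsilon>\<^sup>2 + (z - y)\<^sup>2)))"
      unfolding H_def integral_mult_right_zero fourier_exp_abs(2)[OF \<epsilon>] ..
    also have "of_real (1 / (2 * pi)) * \<dots> = (LINT z|lborel. \<phi> z * of_real (poisson_kernel \<epsilon> (z - y)))"
      unfolding integral_mult_right_zero[symmetric]
      by (intro Bochner_Integration.integral_cong refl) (simp add: poisson_kernel_def)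
    finally show ?thesis by (simp add: \<epsilon>_def)
  qed
  moreover have "I \<longlonglongrightarrow> \<phi> y"
    using poisson_approximation[OF cont B, of y] by (simp only: I_eq[symmetric])
  ultimately show ?thesis by (intro LIMSEQ_unique)
qed

lemma fourier_poisson_kernel:
  assumes u: "u > 0"
  shows "(LINT t|lborel. of_real (poisson_kernel u t) * cis (- (y * t))) = of_real (exp (- u * \<bar>y\<bar>))"
proof (rule fourier_inversion[where \<phi> = "\<lambda>y. of_real (exp (- u * \<bar>y\<bar>))" and B = 1])
  show "integrable lborel (\<lambda>y. complex_of_real (exp (- u * \<bar>y\<bar>)))"
    using fourier_exp_abs(1)[OF u, of 0] by simp
  show "integrable lborel (\<lambda>t. complex_of_real (poisson_kernel u t))"
    using poisson_kernel_integral(1)[OF u] by simp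
  show "complex_of_real (poisson_kernel u t)
    = of_real (1 / (2 * pi)) * (LINT y|lborel. of_real (exp (- u * \<bar>y\<bar>)) * cis (y * t))" for t
    using fourier_exp_abs(2)[OF u, of t] by (simp add: poisson_kernel_def mult.commute)
qed (use u in \<open>auto intro!: continuous_intros\<close>)

section \<open>The Riesz kernel\<close>

text \<open>Riesz means only involve the values of the profile on \<open>[0, \<infinity>)\<close>. The even extension
  to the negative frequencies makes the kernel real and, for every \<open>k > 0\<close>, integrable.\<close>

definition riesz_profile :: "real \<Rightarrow> real \<Rightarrow> real" where
  "riesz_profile k y = max 0 (1 - \<bar>y\<bar>) powr k"

definition riesz_kernel :: "real \<Rightarrow> real \<Rightarrow> real" where
  "riesz_kernel k t = 1 / (2 * pi) * (LINT y|lborel. riesz_profile k y * cos (y * t))"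

lemma continuous_riesz_profile: "k > 0 \<Longrightarrow> continuous_on UNIV (riesz_profile k)"
  unfolding riesz_profile_def by (intro continuous_on_powr' continuous_intros) auto

lemma riesz_profile_bounds: "0 \<le> riesz_profile k y" "k > 0 \<Longrightarrow> riesz_profile k y \<le> 1"
  by (auto simp: riesz_profile_def powr_le1)

lemma riesz_profile_indicator: "indicator {-1..1} y * riesz_profile k y = riesz_profile k y"
  unfolding riesz_profile_def max_def by (auto simp: indicator_def)

lemma riesz_profile_minus [simp]: "riesz_profile k (- y) = riesz_profile k y"
  by (simp add: riesz_profile_def)

lemma integrable_riesz_profile_mult:
  fixes h :: "real \<Rightarrow> real"
  assumes "k > 0" "continuous_on UNIV h" 
  shows "integrable lborel (\<lambda>y. riesz_profile k y * h y)"
proof -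
  have "set_integrable lborel {-1..1} (\<lambda>y. riesz_profile k y * h y)"
    by (intro borel_integrable_atLeastAtMost' continuous_intros
        continuous_on_subset[OF assms(2)] continuous_on_subset[OF continuous_riesz_profile[OF assms(1)]]) auto
  moreover have "indicator {-1..1} y *\<^sub>R (riesz_profile k y * h y) = riesz_profile k y * h y" for y
    by (simp add: riesz_profile_indicator flip: mult.assoc)
  ultimately show ?thesis by (simp only: set_integrable_def)
qed

lemma riesz_kernel_fourier:
  assumes "k > 0"
  shows "of_real (riesz_kernel k t) = of_real (1 / (2 * pi)) * (LINT y|lborel. of_real (riesz_profile k y) * cis (y * t))"
proof -
  have i: "integrable lborel (\<lambda>y. riesz_profile k y * cos (y * t))" "integrable lborel (\<lambda>y. riesz_profile k y * sin (y * t))"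
    by (intro integrable_riesz_profile_mult assms continuous_intros)+
  have "(LINT y|lborel. riesz_profile k y * sin (y * t)) = - (LINT y|lborel. riesz_profile k y * sin (y * t))"
    using lborel_integral_real_affine[of "-1" "\<lambda>y. riesz_profile k y * sin (y * t)" 0] by simp
  then have "(LINT y|lborel. riesz_profile k y * sin (y * t)) = 0" by simp
  then have s0: "(LINT y|lborel. complex_of_real (riesz_profile k y * sin (y * t))) = 0"
    by (simp only: integral_complex_of_real of_real_0)
  have "of_real (riesz_profile k y) * cis (y * t)
    = complex_of_real (riesz_profile k y * cos (y * t)) + \<i> * complex_of_real (riesz_profile k y * sin (y * t))" for y
    by (simp add: complex_eq_iff)
  then have "(LINT y|lborel. of_real (riesz_profile k y) * cis (y * t))
    = (LINT y|lborel. complex_of_real (riesz_profile k y * cos (y * t)) + \<i> * complex_of_real (riesz_profile k y * sin (y * t)))"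
    by simp
  also have "\<dots> = (LINT y|lborel. complex_of_real (riesz_profile k y * cos (y * t)))"
    using i s0 by (subst Bochner_Integration.integral_add)
      (auto intro!: integrable_mult_right integrable_of_real simp del: of_real_mult)
  also have "\<dots> = complex_of_real (LINT y|lborel. riesz_profile k y * cos (y * t))"
    by (rule integral_complex_of_real)
  finally show ?thesis by (simp add: riesz_kernel_def)
qed

section \<open>Decay of the Riesz kernel\<close>

lemma riesz_kernel_eq_integral:
  assumes "k > 0"
  shows "riesz_kernel k t = 1 / pi * integral {0..1} (\<lambda>y. (1 - y) powr k * cos (y * t))"
proof -
  let ?g = "\<lambda>y. riesz_profile k y * cos (y * t)"
  have si: "set_integrable lborel {-1..1} ?g"
    by (intro borel_integrable_atLeastAtMost' continuous_intros continuous_on_subset[OF continuous_riesz_profile[OF assms]]) auto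
  have "indicator {-1..1} y *\<^sub>R ?g y = ?g y" for y
    by (simp add: riesz_profile_indicator flip: mult.assoc)
  then have "(LINT y|lborel. ?g y) = (LINT y:{-1..1}|lborel. ?g y)"
    by (simp only: set_lebesgue_integral_def)
  also have "\<dots> = integral {-1..1} ?g" by (rule set_borel_integral_eq_integral(2)[OF si])
  also have "\<dots> = integral {-1..0} ?g + integral {0..1} ?g"
    using set_borel_integral_eq_integral(1)[OF si] by (intro Henstock_Kurzweil_Integration.integral_combine[symmetric]) auto
  also have "integral {-1..0} ?g = integral {0..1} ?g"
    using Henstock_Kurzweil_Integration.integral_reflect_real[of 1 0 ?g] by simp
  also have "integral {0..1} ?g = integral {0..1} (\<lambda>y. (1 - y) powr k * cos (y * t))"
    by (intro integral_cong) (simp add: riesz_profile_def)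
  finally show ?thesis by (simp add: riesz_kernel_def)
qed

text \<open>By the second mean value theorem only the two endpoint values of \<open>g\<close> count,
  each multiplied by a sine integral of size at most \<open>2 / t\<close>. Both directions of
  monotonicity are needed: \<open>(1 - y) powr (k - 1)\<close> decreases for
  \<open>k \<ge> 1\<close> and increases for \<open>k < 1\<close>.\<close>

lemma integral_monotone_sin_bound:
  fixes g :: "real \<Rightarrow> real"
  assumes "a \<le> b" "t > 0" and nonneg: "g a \<ge> 0" "g b \<ge> 0"
    and mono: "mono_on {a..b} g \<or> antimono_on {a..b} g"
  shows "\<bar>integral {a..b} (\<lambda>y. g y * sin (y * t))\<bar> \<le> 2 / t * (g a + g b)"
proof -
  have int_sin: "\<bar>integral {c..d} (\<lambda>y. sin (y * t))\<bar> \<le> 2 / t" if "c \<le> d" for c d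
  proof -
    have "((\<lambda>y. sin (y * t)) has_integral (- cos (d * t) / t) - (- cos (c * t) / t)) {c..d}"
      using that \<open>t > 0\<close> by (intro fundamental_theorem_of_calculus)
        (auto intro!: derivative_eq_intros simp flip: has_real_derivative_iff_has_vector_derivative)
    then have "integral {c..d} (\<lambda>y. sin (y * t)) = (cos (c * t) - cos (d * t)) / t"
      by (simp add: integral_unique diff_divide_distrib)
    moreover have "\<bar>cos (c * t) - cos (d * t)\<bar> \<le> 2"
      using cos_le_one[of "c * t"] cos_le_one[of "d * t"] cos_ge_minus_one[of "c * t"] cos_ge_minus_one[of "d * t"] by linarith
    ultimately show ?thesis using \<open>t > 0\<close> by (simp add: abs_divide divide_right_mono)
  qed
  have si: "(\<lambda>y. sin (y * t)) integrable_on {a..b}"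
    by (intro integrable_continuous_real continuous_intros)
  have "\<exists>c\<in>{a..b}. integral {a..b} (\<lambda>y. g y * sin (y * t))
    = g a * integral {a..c} (\<lambda>y. sin (y * t)) + g b * integral {c..b} (\<lambda>y. sin (y * t))"
    using mono
  proof
    assume "mono_on {a..b} g"
    then have "g x \<le> g y" if "a \<le> x" "x \<le> y" "y \<le> b" for x y
      using that by (auto simp: mono_on_def)
    then obtain c where "c \<in> {a..b}" "integral {a..b} (\<lambda>y. g y * sin (y * t))
      = g a * integral {a..c} (\<lambda>y. sin (y * t)) + g b * integral {c..b} (\<lambda>y. sin (y * t))"
      by (rule second_mean_value_theorem[OF si \<open>a \<le> b\<close>])
    then show ?thesis by blast
  next
    assume "antimono_on {a..b} g"
    then have "- g x \<le> - g y" if "a \<le> x" "x \<le> y" "y \<le> b" for x y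
      using that by (auto simp: monotone_on_def)
    then obtain c where "c \<in> {a..b}" "integral {a..b} (\<lambda>y. - g y * sin (y * t))
      = - g a * integral {a..c} (\<lambda>y. sin (y * t)) + - g b * integral {c..b} (\<lambda>y. sin (y * t))"
      by (rule second_mean_value_theorem[OF si \<open>a \<le> b\<close>])
    then show ?thesis by (intro bexI[of _ c]) auto
  qed
  then obtain c where c: "c \<in> {a..b}" "integral {a..b} (\<lambda>y. g y * sin (y * t))
    = g a * integral {a..c} (\<lambda>y. sin (y * t)) + g b * integral {c..b} (\<lambda>y. sin (y * t))" by blast
  have "\<bar>g a * integral {a..c} (\<lambda>y. sin (y * t)) + g b * integral {c..b} (\<lambda>y. sin (y * t))\<bar>
    \<le> g a * \<bar>integral {a..c} (\<lambda>y. sin (y * t))\<bar> + g b * \<bar>integral {c..b} (\<lambda>y. sin (y * t))\<bar>"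
    using nonneg by (intro order_trans[OF abs_triangle_ineq]) (simp add: abs_mult)
  also have "\<dots> \<le> g a * (2 / t) + g b * (2 / t)"
    using c(1) nonneg by (intro add_mono mult_left_mono int_sin) auto
  finally show ?thesis unfolding c(2) by (simp add: algebra_simps add_divide_distrib)
qed

lemma continuous_one_minus_powr:
  assumes "k > 0"
  shows "continuous_on {a..1} (\<lambda>y::real. (1 - y) powr k)"
  using assms by (intro continuous_on_powr' continuous_intros) auto

text \<open>For \<open>k < 1\<close> the factor \<open>(1 - y) powr (k - 1)\<close> blows up at 1. The oscillation is used on
  \<open>[0, 1 - 1/t]\<close> only, and the remaining interval is estimated by the integral of the factor.\<close>

lemma integral_sin_powr_bound:
  assumes k: "k > 0" and t: "t \<ge> 1"
    and int: "(\<lambda>y::real. (1 - y) powr (k - 1) * sin (y * t)) integrable_on {0..1}"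
  shows "k * \<bar>integral {0..1} (\<lambda>y. (1 - y) powr (k - 1) * sin (y * t))\<bar> \<le> (4 * k + 1) * t powr (- min k 1)"
proof (cases "k \<ge> 1")
  case True
  have "antimono_on {0..1} (\<lambda>y::real. (1 - y) powr (k - 1))"
    using True by (intro monotone_onI powr_mono2) auto
  then have "\<bar>integral {0..1} (\<lambda>y. (1 - y) powr (k - 1) * sin (y * t))\<bar> \<le> 2 / t * ((1 - 0) powr (k - 1) + (1 - 1) powr (k - 1))"
    using t by (intro integral_monotone_sin_bound) auto
  then have "k * \<bar>integral {0..1} (\<lambda>y. (1 - y) powr (k - 1) * sin (y * t))\<bar> \<le> k * (2 / t)"
    using k by (intro mult_left_mono) auto
  also have "\<dots> \<le> (4 * k + 1) * t powr (- min k 1)"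
    using True t k by (simp add: min_def powr_minus field_simps)
  finally show ?thesis .
next
  case False
  \<comment> \<open>This cut balances the two parts: the factor equals \<open>t powr (1 - k)\<close>
    at \<open>b\<close>, so the oscillation yields the order \<open>t powr (- k)\<close>, and the
    integral of the factor over \<open>[b, 1]\<close> is \<open>t powr (- k) / k\<close>.\<close>
  define b where "b = 1 - 1 / t"
  have b: "0 \<le> b" "b \<le> 1" "1 - b = 1 / t" using t by (auto simp: b_def field_simps)
  have tk: "t powr (1 - k) / t = t powr (- k)" "(1 / t) powr (k - 1) = t powr (1 - k)" "(1 / t) powr k = t powr (- k)"
    "1 / t \<le> t powr (- k)"
  proof -
    show "t powr (1 - k) / t = t powr (- k)"
      using t powr_diff[of t "1 - k" 1] by simp
    show "(1 / t) powr (k - 1) = t powr (1 - k)" "(1 / t) powr k = t powr (- k)"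
      using t by (simp_all add: powr_divide powr_minus_divide[symmetric])
    have "t powr (- 1) \<le> t powr (- k)" using t False by (intro powr_mono) auto
    then show "1 / t \<le> t powr (- k)" using t by (simp add: powr_minus_divide)
  qed
  have "mono_on {0..b} (\<lambda>y::real. (1 - y) powr (k - 1))"
  proof -
    have "b < 1" using t by (simp add: b_def)
    then show ?thesis using False by (intro mono_onI powr_mono2') auto
  qed
  then have "\<bar>integral {0..b} (\<lambda>y. (1 - y) powr (k - 1) * sin (y * t))\<bar> \<le> 2 / t * ((1 - 0) powr (k - 1) + (1 - b) powr (k - 1))"
    using t b by (intro integral_monotone_sin_bound) auto
  also have "\<dots> = 2 * (1 / t) + 2 * (t powr (1 - k) / t)"
    unfolding b(3) tk(2) by (simp add: algebra_simps add_divide_distrib)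
  also have "\<dots> \<le> 4 * t powr (- k)"
    using tk by simp
  finally have 1: "\<bar>integral {0..b} (\<lambda>y. (1 - y) powr (k - 1) * sin (y * t))\<bar> \<le> 4 * t powr (- k)" .
  have "((\<lambda>y. (1 - y) powr (k - 1)) has_integral (- ((1 - 1) powr k) / k - - ((1 - b) powr k) / k)) {b..1}"
  proof (rule fundamental_theorem_of_calculus_interior[OF b(2)])
    show "continuous_on {b..1} (\<lambda>y. - ((1 - y) powr k) / k)"
      using k by (intro continuous_intros continuous_one_minus_powr) auto
    fix y assume "y \<in> {b<..<1}"
    then show "((\<lambda>y. - ((1 - y) powr k) / k) has_vector_derivative (1 - y) powr (k - 1)) (at y)"
      using k by (auto intro!: derivative_eq_intros simp flip: has_real_derivative_iff_has_vector_derivative)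
  qed
  then have g_int: "((\<lambda>y. (1 - y) powr (k - 1)) has_integral t powr (- k) / k) {b..1}"
    using b tk k by simp
  have "norm (integral {b..1} (\<lambda>y. (1 - y) powr (k - 1) * sin (y * t))) \<le> integral {b..1} (\<lambda>y. (1 - y) powr (k - 1))"
  proof (rule integral_norm_bound_integral)
    show "(\<lambda>y. (1 - y) powr (k - 1) * sin (y * t)) integrable_on {b..1}"
      by (rule integrable_on_subinterval[OF int]) (use b in auto)
    show "norm ((1 - y) powr (k - 1) * sin (y * t)) \<le> (1 - y) powr (k - 1)" for y
      by (simp add: abs_mult mult_left_le)
  qed (use g_int in auto)
  then have 2: "\<bar>integral {b..1} (\<lambda>y. (1 - y) powr (k - 1) * sin (y * t))\<bar> \<le> t powr (- k) / k"
    using g_int by (simp add: integral_unique)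
  have "integral {0..1} (\<lambda>y. (1 - y) powr (k - 1) * sin (y * t))
    = integral {0..b} (\<lambda>y. (1 - y) powr (k - 1) * sin (y * t)) + integral {b..1} (\<lambda>y. (1 - y) powr (k - 1) * sin (y * t))"
    using b int by (intro Henstock_Kurzweil_Integration.integral_combine[symmetric]) auto
  then have "\<bar>integral {0..1} (\<lambda>y. (1 - y) powr (k - 1) * sin (y * t))\<bar> \<le> 4 * t powr (- k) + t powr (- k) / k"
    using 1 2 by linarith
  then have "k * \<bar>integral {0..1} (\<lambda>y. (1 - y) powr (k - 1) * sin (y * t))\<bar> \<le> k * (4 * t powr (- k) + t powr (- k) / k)"
    using k by (intro mult_left_mono) auto
  also have "\<dots> = (4 * k + 1) * t powr (- min k 1)"
    using k False by (simp add: field_simps)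
  finally show ?thesis .
qed

text \<open>Integration by parts gains \<open>1 / t\<close> without boundary terms, since the power
  vanishes at 1 and the sine at 0. The remaining integral is that of
  \<open>integral_sin_powr_bound\<close>.\<close>

lemma riesz_kernel_decay:
  assumes k: "k > 0" and t: "t \<ge> 1"
  shows "\<bar>riesz_kernel k t\<bar> \<le> (4 * k + 1) * t powr (- (1 + min k 1))"
proof -
  define J where "J = integral {0..1} (\<lambda>y. (1 - y) powr k * cos (y * t))"
  have "((\<lambda>y. - k * (1 - y) powr (k - 1) * sin (y * t) + (1 - y) powr k * (cos (y * t) * t))
    has_integral ((1 - 1) powr k * sin (1 * t) - (1 - 0) powr k * sin (0 * t))) {0..1}"
  \<comment> \<open>The interior version is essential: for \<open>k < 1\<close> the power is
    continuous but not differentiable at 1.\<close>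
  proof (rule fundamental_theorem_of_calculus_interior)
    show "continuous_on {0..1} (\<lambda>y. (1 - y) powr k * sin (y * t))"
      by (intro continuous_intros continuous_one_minus_powr k)
    fix y :: real assume "y \<in> {0<..<1}"
    then show "((\<lambda>y. (1 - y) powr k * sin (y * t)) has_vector_derivative
      - k * (1 - y) powr (k - 1) * sin (y * t) + (1 - y) powr k * (cos (y * t) * t)) (at y)"
      by (auto intro!: derivative_eq_intros simp flip: has_real_derivative_iff_has_vector_derivative)
  qed simp
  then have 1: "((\<lambda>y. - k * (1 - y) powr (k - 1) * sin (y * t) + (1 - y) powr k * (cos (y * t) * t)) has_integral 0) {0..1}"
    using k by simp
  have "(\<lambda>y. (1 - y) powr k * cos (y * t)) integrable_on {0..1}"
    by (intro integrable_continuous_real continuous_intros continuous_one_minus_powr k)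
  then have "((\<lambda>y. (1 - y) powr k * cos (y * t)) has_integral J) {0..1}"
    unfolding J_def by (rule integrable_integral)
  from has_integral_mult_right[OF this, of t]
  have 2: "((\<lambda>y. (1 - y) powr k * (cos (y * t) * t)) has_integral t * J) {0..1}"
    by (simp add: mult_ac)
  have "((\<lambda>y. k * ((1 - y) powr (k - 1) * sin (y * t))) has_integral t * J) {0..1}"
    using has_integral_diff[OF 2 1] by (simp add: mult_ac)
  from has_integral_mult_right[OF this, of "1 / k"]
  have 3: "((\<lambda>y. (1 - y) powr (k - 1) * sin (y * t)) has_integral t * J / k) {0..1}"
    using k by simp
  have "\<bar>t * J\<bar> = k * \<bar>integral {0..1} (\<lambda>y. (1 - y) powr (k - 1) * sin (y * t))\<bar>"
    using k by (simp add: integral_unique[OF 3])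
  also have "\<dots> \<le> (4 * k + 1) * t powr (- min k 1)"
    using 3 by (intro integral_sin_powr_bound k t) auto
  finally have "\<bar>J\<bar> \<le> (4 * k + 1) * (t powr (- min k 1) / t)"
    using t by (simp add: abs_mult field_simps)
  also have "t powr (- min k 1) / t = t powr (- (1 + min k 1))"
  proof -
    have "- (1 + min k 1) = - min k 1 - 1" by simp
    then show ?thesis using t by (simp only: powr_diff) simp
  qed
  finally have J: "\<bar>J\<bar> \<le> (4 * k + 1) * t powr (- (1 + min k 1))" .
  have "\<bar>riesz_kernel k t\<bar> = 1 / pi * \<bar>J\<bar>"
    by (simp add: riesz_kernel_eq_integral[OF k] J_def abs_mult)
  also have "\<dots> \<le> 1 * \<bar>J\<bar>"
    using pi_gt3 by (intro mult_right_mono) auto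
  finally show ?thesis using J by simp
qed

lemma riesz_kernel_minus [simp]: "riesz_kernel k (- t) = riesz_kernel k t"
  by (simp add: riesz_kernel_def)

lemma two_powr_weight:
  assumes "0 < \<delta>" "\<delta> \<le> 1"
  shows "2 powr (1 + \<delta>) \<le> (4 :: real)" "1 \<le> 4 * 2 powr (- (1 + \<delta>))"
    "2 powr (1 + \<delta>) * 2 powr (- (1 + \<delta>)) = (1 :: real)"
proof -
  show 1: "2 powr (1 + \<delta>) \<le> (4 :: real)"
    using powr_mono[of "1 + \<delta>" 2 "2 :: real"] assms by simp
  show 2: "2 powr (1 + \<delta>) * 2 powr (- (1 + \<delta>)) = (1 :: real)"
    by (simp flip: powr_add)
  show "1 \<le> 4 * 2 powr (- (1 + \<delta>))"
    using mult_right_mono[OF 1, of "2 powr (- (1 + \<delta>))"] unfolding 2 by simp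
qed

lemma weight_half_le:
  assumes "0 < \<delta>" "\<delta> \<le> 1"
  shows "((1 + \<bar>t\<bar>) / 2) powr (- (1 + \<delta>)) \<le> 4 * weight \<delta> t"
proof -
  define a where "a = - (1 + \<delta>)"
  have "2 powr (1 + \<delta>) = 1 / 2 powr a"
    using powr_minus_divide[of "2 :: real" a] unfolding a_def by (simp add: add.commute)
  then have "((1 + \<bar>t\<bar>) / 2) powr a = 2 powr (1 + \<delta>) * weight \<delta> t"
    by (simp add: powr_divide weight_def a_def)
  also have "\<dots> \<le> 4 * weight \<delta> t"
    using two_powr_weight(1)[OF assms] weight_pos[of \<delta> t] by (intro mult_right_mono) auto
  finally show ?thesis by (simp only: a_def)
qed

text \<open>For \<open>\<bar>t\<bar> \<ge> 1\<close> one has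
  \<open>(1 + \<bar>t\<bar>) / 2 \<le> \<bar>t\<bar>\<close>, and replacing
  \<open>\<bar>t\<bar>\<close> costs \<open>2 powr (1 + \<delta>) \<le> 4\<close>. For smaller
  \<open>t\<close> the kernel is at most 1 and the weight at least \<open>1 / 4\<close>.\<close>

lemma riesz_kernel_bound:
  assumes k: "k > 0"
  shows "\<bar>riesz_kernel k t\<bar> \<le> 4 * (4 * k + 1) * weight (min k 1) t"
proof -
  define \<delta> where "\<delta> = min k 1"
  have \<delta>: "0 < \<delta>" "\<delta> \<le> 1" using k by (auto simp: \<delta>_def)
  show ?thesis
  proof (cases "\<bar>t\<bar> \<ge> 1")
    case True
    have "\<bar>t\<bar> powr (- (1 + \<delta>)) \<le> ((1 + \<bar>t\<bar>) / 2) powr (- (1 + \<delta>))"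
      using True \<delta> by (intro powr_mono2') auto
    also have "\<dots> \<le> 4 * weight \<delta> t" by (rule weight_half_le[OF \<delta>])
    finally have *: "\<bar>t\<bar> powr (- (1 + \<delta>)) \<le> 4 * weight \<delta> t" .
    have "\<bar>riesz_kernel k t\<bar> = \<bar>riesz_kernel k \<bar>t\<bar>\<bar>" by (cases "t \<ge> 0") auto
    also have "\<dots> \<le> (4 * k + 1) * \<bar>t\<bar> powr (- (1 + \<delta>))"
      unfolding \<delta>_def by (rule riesz_kernel_decay[OF k True])
    also have "\<dots> \<le> (4 * k + 1) * (4 * weight \<delta> t)"
      using * k by (intro mult_left_mono) auto
    finally show ?thesis by (simp add: \<delta>_def algebra_simps)
  next
    case False
    have c: "continuous_on {0..1} (\<lambda>y. (1 - y) powr k * cos (y * t))"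
      by (intro continuous_intros continuous_one_minus_powr k)
    have "norm (integral {0..1} (\<lambda>y. (1 - y) powr k * cos (y * t))) \<le> 1 * (1 - 0)"
    proof (rule integral_bound[OF _ c])
      fix y :: real assume "y \<in> {0..1}"
      then have "(1 - y) powr k * \<bar>cos (y * t)\<bar> \<le> 1 * 1"
        using k by (intro mult_mono powr_le1) auto
      then show "norm ((1 - y) powr k * cos (y * t)) \<le> 1" by (simp add: abs_mult)
    qed simp
    then have "1 / pi * \<bar>integral {0..1} (\<lambda>y. (1 - y) powr k * cos (y * t))\<bar> \<le> 1 * 1"
      using pi_gt3 by (intro mult_mono) auto
    then have "\<bar>riesz_kernel k t\<bar> \<le> 1"
      by (simp add: riesz_kernel_eq_integral[OF k] abs_mult)
    also have "1 \<le> 4 * weight \<delta> t"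
    proof -
      have "2 powr (- (1 + \<delta>)) \<le> weight \<delta> t"
        unfolding weight_def using False \<delta> by (intro powr_mono2') auto
      then show ?thesis using two_powr_weight(2)[OF \<delta>] by linarith
    qed
    also have "\<dots> \<le> (4 * k + 1) * (4 * weight \<delta> t)"
      using k weight_pos[of \<delta> t] by (simp add: mult_le_cancel_right1)
    finally show ?thesis by (simp add: \<delta>_def algebra_simps)
  qed
qed

lemma continuous_riesz_kernel:
  assumes k: "k > 0"
  shows "continuous_on UNIV (riesz_kernel k)"
proof -
  have "continuous_on UNIV (\<lambda>t. integral (cbox 0 1) (\<lambda>y. (1 - y) powr k * cos (y * t)))"
    by (rule integral_continuous_on_param)
      (auto simp: case_prod_beta' intro!: continuous_intros continuous_on_compose2[OF continuous_one_minus_powr[OF k, of 0]])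
  then show ?thesis
    unfolding riesz_kernel_eq_integral[OF k, abs_def] cbox_interval by (intro continuous_intros)
qed

lemma riesz_kernel_integrable:
  assumes k: "k > 0"
  shows "integrable lborel (riesz_kernel k)"
proof (rule Bochner_Integration.integrable_bound)
  show "integrable lborel (\<lambda>t. 4 * (4 * k + 1) * weight (min k 1) t)"
    using k by (intro integrable_mult_right integrable_weight) auto
  show "riesz_kernel k \<in> borel_measurable lborel"
    using borel_measurable_continuous_onI[OF continuous_riesz_kernel[OF k]] by simp
  show "AE t in lborel. norm (riesz_kernel k t) \<le> norm (4 * (4 * k + 1) * weight (min k 1) t)"
    using riesz_kernel_bound[OF k] by (intro AE_I2) (auto intro: order_trans[OF _ abs_ge_self])
qed

text \<open>Evaluated at \<open>l n / x\<close>, this identifies the Riesz factors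
  \<open>(1 - l n / x) powr k\<close> as Fourier multipliers of the dilated kernel.\<close>

lemma fourier_riesz_kernel:
  assumes k: "k > 0"
  shows "(LINT t|lborel. of_real (riesz_kernel k t) * cis (- (y * t))) = of_real (riesz_profile k y)"
proof (rule fourier_inversion[where \<phi> = "\<lambda>y. of_real (riesz_profile k y)" and B = 1])
  show "continuous_on UNIV (\<lambda>y. complex_of_real (riesz_profile k y))"
    by (intro continuous_intros continuous_riesz_profile k)
  show "norm (complex_of_real (riesz_profile k y)) \<le> 1" for y
    using riesz_profile_bounds[of k y] k by simp
  show "integrable lborel (\<lambda>y. complex_of_real (riesz_profile k y))"
    using integrable_riesz_profile_mult[OF k, of "\<lambda>_. 1"] by (simp add: continuous_intros)
  show "integrable lborel (\<lambda>t. complex_of_real (riesz_kernel k t))"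
    using riesz_kernel_integrable[OF k] by simp
qed (rule riesz_kernel_fourier[OF k])

lemma integral_riesz_kernel:
  assumes k: "k > 0"
  shows "(LINT t|lborel. riesz_kernel k t) = 1"
  using fourier_riesz_kernel[OF k, of 0] by (simp add: riesz_profile_def)

section \<open>Convolution of the Poisson kernel with dilated weights\<close>

lemma weight_antimono: "\<delta> \<ge> 0 \<Longrightarrow> \<bar>s\<bar> \<le> \<bar>t\<bar> \<Longrightarrow> weight \<delta> t \<le> weight \<delta> s"
  unfolding weight_def by (intro powr_mono2') auto

text \<open>The Poisson kernel decays only quadratically, so the condition
  \<open>\<delta> \<le> 1\<close> enters: \<open>(1 + \<bar>r\<bar>) powr (1 + \<delta>)\<close> is
  at most \<open>2 * (1 + r\<^sup>2)\<close>, and \<open>1 + r\<^sup>2\<close> is at most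
  \<open>(1 + 1 / u\<^sup>2) * (u\<^sup>2 + r\<^sup>2)\<close>.\<close>

lemma poisson_kernel_le_weight:
  assumes u: "u > 0" and \<delta>: "0 < \<delta>" "\<delta> \<le> 1"
  shows "poisson_kernel u r \<le> 2 * u * (1 + 1 / u\<^sup>2) * weight \<delta> r"
proof -
  have pos: "u\<^sup>2 + r\<^sup>2 > 0" using u by (simp add: add_pos_nonneg)
  define X where "X = (1 + \<bar>r\<bar>) powr (1 + \<delta>)"
  define Z where "Z = (1 + 1 / u\<^sup>2) * (u\<^sup>2 + r\<^sup>2)"
  have X: "X > 0" by (simp add: X_def)
  have w: "weight \<delta> r = 1 / X" unfolding weight_def X_def by (rule powr_minus_divide)
  have "X \<le> (1 + \<bar>r\<bar>) powr 2"
    unfolding X_def using \<delta> by (intro powr_mono) auto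
  also have "\<dots> = (1 + \<bar>r\<bar>)\<^sup>2" by simp
  also have "\<dots> \<le> 2 * (1 + r\<^sup>2)"
    using zero_le_power2[of "1 - \<bar>r\<bar>"] by (simp add: power2_eq_square algebra_simps)
  also have "\<dots> \<le> 2 * Z"
    unfolding Z_def using u by (simp add: field_simps)
  finally have "1 \<le> 2 * Z * weight \<delta> r"
    using X by (simp add: w)
  then have "1 \<le> 2 * ((1 + 1 / u\<^sup>2) * (u\<^sup>2 + r\<^sup>2)) * weight \<delta> r"
    unfolding Z_def .
  then have "u / (u\<^sup>2 + r\<^sup>2) * 1 \<le> u / (u\<^sup>2 + r\<^sup>2) * (2 * ((1 + 1 / u\<^sup>2) * (u\<^sup>2 + r\<^sup>2)) * weight \<delta> r)"
    using u pos by (intro mult_left_mono) auto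
  also have "\<dots> = 2 * u * (1 + 1 / u\<^sup>2) * weight \<delta> r"
    using pos by simp
  finally have "u / (u\<^sup>2 + r\<^sup>2) \<le> 2 * u * (1 + 1 / u\<^sup>2) * weight \<delta> r" by simp
  moreover have "1 / pi * (u / (u\<^sup>2 + r\<^sup>2)) \<le> 1 * (u / (u\<^sup>2 + r\<^sup>2))"
    using pi_gt3 u pos by (intro mult_right_mono) auto
  ultimately show ?thesis by (simp add: poisson_kernel_def)
qed

text \<open>\<open>s\<close> and \<open>t - s\<close> cannot both be small compared with
  \<open>t\<close>, so one of the two factors is at most a multiple of
  \<open>weight \<delta> t\<close>, and the other has an integral that does not depend on
  \<open>x\<close>. Uniformity in \<open>x \<ge> 1\<close> is what dominated convergence needs
  later.\<close>

lemma poisson_weight_convolution: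
  assumes u: "u > 0" and \<delta>: "0 < \<delta>" "\<delta> \<le> 1"
  shows "\<exists>C\<ge>0. \<forall>x\<ge>1. \<forall>t. integrable lborel (\<lambda>s. poisson_kernel u (t - s) * (x * weight \<delta> (x * s)))
    \<and> (LINT s|lborel. poisson_kernel u (t - s) * (x * weight \<delta> (x * s))) \<le> C * weight \<delta> t"
proof -
  define A where "A = 2 * u * (1 + 1 / u\<^sup>2)"
  have A: "A \<ge> 0" using u by (simp add: A_def)
  define W where "W = (LINT s|lborel. weight \<delta> s)"
  have W: "W \<ge> 0" unfolding W_def using weight_pos[of \<delta>] by (simp add: less_imp_le)
  define c where "c = 4 * A + 64"
  have c: "c \<ge> 0" using A by (simp add: c_def)
  have w0: "weight \<delta> t \<ge> 0" for t using weight_pos[of \<delta> t] by simp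
  have P0: "poisson_kernel u t \<ge> 0" for t by (rule poisson_kernel_nonneg[OF u])
  have half: "weight \<delta> (t / 2) \<le> 4 * weight \<delta> t" for t
  proof -
    have "weight \<delta> (t / 2) \<le> ((1 + \<bar>t\<bar>) / 2) powr (- (1 + \<delta>))"
      unfolding weight_def using \<delta> by (intro powr_mono2') auto
    then show ?thesis using weight_half_le[OF \<delta>, of t] by linarith
  qed
  have pw: "poisson_kernel u (t - s) * (x * weight \<delta> (x * s))
      \<le> c * weight \<delta> t * (x * weight \<delta> (x * s) + poisson_kernel u (t - s))" if x: "x \<ge> 1" for x t s
  proof -
    have Pw: "poisson_kernel u (t - s) \<le> A * weight \<delta> (t - s)"
      unfolding A_def by (rule poisson_kernel_le_weight[OF u \<delta>])
    \<comment> \<open>For \<open>\<bar>t\<bar> \<le> 1\<close> the Poisson factor is always the one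
      estimated, because \<open>x * weight \<delta> (x * s)\<close> is of size \<open>x\<close> near
      \<open>s = 0\<close>. Otherwise \<open>\<bar>s\<bar> > \<bar>t\<bar> / 2\<close> keeps
      \<open>s\<close> away from 0.\<close>
    consider "\<bar>s\<bar> \<le> \<bar>t\<bar> / 2 \<or> \<bar>t\<bar> \<le> 1" | "\<bar>s\<bar> > \<bar>t\<bar> / 2" "\<bar>t\<bar> > 1" by linarith
    then show ?thesis
    proof cases
      case 1
      have "weight \<delta> (t - s) \<le> 4 * weight \<delta> t"
        using 1
      proof
        assume "\<bar>s\<bar> \<le> \<bar>t\<bar> / 2"
        then have "weight \<delta> (t - s) \<le> weight \<delta> (t / 2)"
          using \<delta> by (intro weight_antimono) linarith+
        then show ?thesis using half[of t] by simp
      next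
        assume "\<bar>t\<bar> \<le> 1"
        have "2 powr (- (1 + \<delta>)) \<le> weight \<delta> t"
          unfolding weight_def using \<open>\<bar>t\<bar> \<le> 1\<close> \<delta> by (intro powr_mono2') auto
        then show ?thesis using two_powr_weight(2)[OF \<delta>] weight_le_1[of \<delta> "t - s"] \<delta> by linarith
      qed
      then have "poisson_kernel u (t - s) \<le> A * (4 * weight \<delta> t)"
        using Pw A by (intro order_trans[OF Pw] mult_left_mono) auto
      also have "\<dots> \<le> c * weight \<delta> t"
        using w0[of t] by (simp add: c_def algebra_simps)
      finally have "poisson_kernel u (t - s) * (x * weight \<delta> (x * s)) \<le> c * weight \<delta> t * (x * weight \<delta> (x * s))"
        using x w0 by (intro mult_right_mono) auto
      also have "\<dots> \<le> c * weight \<delta> t * (x * weight \<delta> (x * s) + poisson_kernel u (t - s))"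
        using c w0 P0 by (intro mult_left_mono) auto
      finally show ?thesis .
    next
      case 2
      have s: "\<bar>s\<bar> > 0" using 2 by simp
      have "x * weight \<delta> (x * s) \<le> x * (x * \<bar>s\<bar>) powr (- (1 + \<delta>))"
        unfolding weight_def using x s \<delta> by (intro mult_left_mono powr_mono2') (auto simp: abs_mult)
      also have "\<dots> = x powr (- \<delta>) * \<bar>s\<bar> powr (- (1 + \<delta>))"
        using x s powr_add[of x 1 "- (1 + \<delta>)"] by (simp add: powr_mult)
      also have "\<dots> \<le> 1 * \<bar>s\<bar> powr (- (1 + \<delta>))"
        using x \<delta> by (intro mult_right_mono) (auto simp: powr_minus field_simps ge_one_powr_ge_zero)
      also have "1 * \<bar>s\<bar> powr (- (1 + \<delta>)) \<le> ((1 + \<bar>(\<bar>t\<bar> - 1) / 2\<bar>) / 2) powr (- (1 + \<delta>))"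
        using 2 \<delta> by (simp only: mult_1) (intro powr_mono2', auto simp: field_simps)
      also have "\<dots> \<le> 4 * weight \<delta> ((\<bar>t\<bar> - 1) / 2)" by (rule weight_half_le[OF \<delta>])
      also have "weight \<delta> ((\<bar>t\<bar> - 1) / 2) = ((1 + \<bar>t\<bar>) / 2) powr (- (1 + \<delta>))"
      proof -
        have "1 + \<bar>(\<bar>t\<bar> - 1) / 2\<bar> = (1 + \<bar>t\<bar>) / 2" using 2 by (simp add: field_simps)
        then show ?thesis by (simp only: weight_def)
      qed
      also have "4 * \<dots> \<le> 64 * weight \<delta> t"
        using weight_half_le[OF \<delta>, of t] w0[of t] by linarith
      also have "\<dots> \<le> c * weight \<delta> t"
        using A w0 by (intro mult_right_mono) (auto simp: c_def)
      finally have "poisson_kernel u (t - s) * (x * weight \<delta> (x * s)) \<le> poisson_kernel u (t - s) * (c * weight \<delta> t)"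
        by (intro mult_left_mono P0)
      also have "\<dots> = c * weight \<delta> t * poisson_kernel u (t - s)" by simp
      also have "\<dots> \<le> c * weight \<delta> t * (x * weight \<delta> (x * s) + poisson_kernel u (t - s))"
        using x c w0 by (intro mult_left_mono) auto
      finally show ?thesis .
    qed
  qed
  have bound: "integrable lborel (\<lambda>s. c * weight \<delta> t * (x * weight \<delta> (x * s) + poisson_kernel u (t - s)))"
    "(LINT s|lborel. c * weight \<delta> t * (x * weight \<delta> (x * s) + poisson_kernel u (t - s))) = c * (W + 1) * weight \<delta> t"
    if x: "x \<ge> 1" for x t
  proof -
    have 1: "integrable lborel (\<lambda>s. x * weight \<delta> (x * s))" "(LINT s|lborel. x * weight \<delta> (x * s)) = W"
      using lborel_integrable_real_affine[OF integrable_weight[OF \<delta>(1)], of x 0]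
        lborel_integral_real_affine[of x "weight \<delta>" 0] x by (auto simp: W_def)
    have 2: "integrable lborel (\<lambda>s. poisson_kernel u (t - s))" "(LINT s|lborel. poisson_kernel u (t - s)) = 1"
      using lborel_integrable_real_affine[OF poisson_kernel_integral(1)[OF u], of "-1" t]
        lborel_integral_real_affine[of "-1" "poisson_kernel u" t] poisson_kernel_integral(2)[OF u] by auto
    show "integrable lborel (\<lambda>s. c * weight \<delta> t * (x * weight \<delta> (x * s) + poisson_kernel u (t - s)))"
      by (intro integrable_mult_right Bochner_Integration.integrable_add 1 2)
    have "(LINT s|lborel. x * weight \<delta> (x * s) + poisson_kernel u (t - s)) = W + 1"
      using 1 2 by (subst Bochner_Integration.integral_add) auto
    then show "(LINT s|lborel. c * weight \<delta> t * (x * weight \<delta> (x * s) + poisson_kernel u (t - s))) = c * (W + 1) * weight \<delta> t"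
      by (simp only: integral_mult_right_zero) simp
  qed
  have int: "integrable lborel (\<lambda>s. poisson_kernel u (t - s) * (x * weight \<delta> (x * s)))" if x: "x \<ge> 1" for x t
  proof (rule Bochner_Integration.integrable_bound[OF bound(1)[OF x]])
    show "AE s in lborel. norm (poisson_kernel u (t - s) * (x * weight \<delta> (x * s)))
      \<le> norm (c * weight \<delta> t * (x * weight \<delta> (x * s) + poisson_kernel u (t - s)))"
    proof (rule AE_I2)
      fix s
      have "0 \<le> poisson_kernel u (t - s) * (x * weight \<delta> (x * s))" using x w0 P0 by simp
      then show "norm (poisson_kernel u (t - s) * (x * weight \<delta> (x * s)))
        \<le> norm (c * weight \<delta> t * (x * weight \<delta> (x * s) + poisson_kernel u (t - s)))"
        using pw[OF x, of t s] unfolding real_norm_def by linarith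
    qed
  qed measurable
  show ?thesis
  proof (intro exI[of _ "c * (W + 1)"] conjI allI impI)
    show "0 \<le> c * (W + 1)" using c W by simp
    fix x t :: real assume x: "x \<ge> 1"
    show "integrable lborel (\<lambda>s. poisson_kernel u (t - s) * (x * weight \<delta> (x * s)))" by (rule int[OF x])
    show "(LINT s|lborel. poisson_kernel u (t - s) * (x * weight \<delta> (x * s))) \<le> c * (W + 1) * weight \<delta> t"
      unfolding bound(2)[OF x, of t, symmetric] by (intro integral_mono int bound pw x)
  qed
qed

section \<open>Riesz means along a line\<close>

lemma weight_dilation_le:
  assumes "\<delta> \<ge> 0" "a > 0" "a \<le> x"
  shows "weight \<delta> (x * s) \<le> (min 1 a) powr (- (1 + \<delta>)) * weight \<delta> s"
proof -
  have "min 1 a * \<bar>s\<bar> \<le> x * \<bar>s\<bar>" using assms by (intro mult_right_mono) auto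
  then have "min 1 a * (1 + \<bar>s\<bar>) \<le> 1 + \<bar>x * s\<bar>"
    using assms by (simp add: abs_mult distrib_left)
  then have "weight \<delta> (x * s) \<le> (min 1 a * (1 + \<bar>s\<bar>)) powr (- (1 + \<delta>))"
    unfolding weight_def using assms by (intro powr_mono2') auto
  then show ?thesis using assms by (simp add: powr_mult weight_def)
qed

text \<open>A term enters the Riesz mean at \<open>x = l n\<close> with factor 0. Hence the index
  set can be kept fixed for all \<open>x\<close> up to \<open>X\<close>, which makes continuity in
  \<open>x\<close> visible.\<close>

lemma riesz_mean_eq_sum:
  assumes "frequency l" "k > 0" "0 < x" "x \<le> X"
  shows "riesz_mean l k x D s = (\<Sum>n | l n < X. D n * of_real (max 0 (1 - l n / x) powr k) * exp (- of_real (l n) * s))"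
proof -
  have "(\<Sum>n | l n < X. D n * of_real (max 0 (1 - l n / x) powr k) * exp (- of_real (l n) * s))
    = (\<Sum>n | l n < x. D n * of_real (max 0 (1 - l n / x) powr k) * exp (- of_real (l n) * s))"
    using assms by (intro sum.mono_neutral_right frequency_finite_less) (auto simp: max_def field_simps)
  also have "\<dots> = riesz_mean l k x D s"
    unfolding riesz_mean_def using assms by (intro sum.cong) (auto simp: max_def field_simps)
  finally show ?thesis by simp
qed

lemma continuous_riesz_mean:
  assumes "frequency l" "k > 0"
  shows "continuous_on {0<..} (\<lambda>x. riesz_mean l k x D s)"
proof -
  have "isCont (\<lambda>x. riesz_mean l k x D s) x" if "x > 0" for x
  proof -
    have "\<forall>\<^sub>F y in nhds x. y \<in> {0<..<x + 1}"
      using that by (intro eventually_nhds_in_open) auto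
    then have "\<forall>\<^sub>F y in nhds x. riesz_mean l k y D s
      = (\<Sum>n | l n < x + 1. D n * of_real (max 0 (1 - l n / y) powr k) * exp (- of_real (l n) * s))"
    proof eventually_elim
      case (elim y)
      then show ?case by (intro riesz_mean_eq_sum assms) auto
    qed
    moreover have "isCont (\<lambda>y. \<Sum>n | l n < x + 1. D n * of_real (max 0 (1 - l n / y) powr k) * exp (- of_real (l n) * s)) x"
      using that assms(2) unfolding isCont_def
      by (intro tendsto_intros tendsto_powr') (auto intro!: always_eventually)
    ultimately show ?thesis using isCont_cong by fast
  qed
  then show ?thesis by (intro continuous_at_imp_continuous_on) auto
qed

lemma integrable_of_weight_finite:
  fixes g :: "real \<Rightarrow> complex"
  assumes \<delta>: "\<delta> > 0" and [measurable]: "g \<in> borel_measurable borel"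
    and fin: "(\<integral>\<^sup>+s. norm (g s) * weight \<delta> s \<partial>lborel) < \<infinity>"
  shows "integrable lborel (\<lambda>s. norm (g s) * weight \<delta> s)"
    and "integrable lborel (\<lambda>s. norm (g (t + s)) * weight \<delta> s)"
    and "integrable lborel (\<lambda>s. norm (g s) * weight \<delta> (t - s))"
    and "integrable lborel (\<lambda>r. indicator (ball 0 n) r * g r)"
proof -
  have w0: "weight \<delta> s \<ge> 0" for s using weight_pos[of \<delta> s] by simp
  show 1: "integrable lborel (\<lambda>s. norm (g s) * weight \<delta> s)"
    using fin w0 by (intro integrableI_nonneg) auto
  let ?c = "\<lambda>t. (1 + \<bar>t\<bar>) powr (1 + \<delta>)"
  have "integrable lborel (\<lambda>s. ?c t * (norm (g (t + 1 * s)) * weight \<delta> (t + 1 * s)))"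
    using lborel_integrable_real_affine[OF 1, of 1 t] by (intro integrable_mult_right) simp
  then show "integrable lborel (\<lambda>s. norm (g (t + s)) * weight \<delta> s)"
  proof (rule Bochner_Integration.integrable_bound)
    show "AE s in lborel. norm (norm (g (t + s)) * weight \<delta> s) \<le> norm (?c t * (norm (g (t + 1 * s)) * weight \<delta> (t + 1 * s)))"
      using w0 weight_shift[of \<delta> _ t] \<delta>
      by (intro AE_I2) (simp add: add.commute abs_mult mult.left_commute mult_left_mono)
  qed measurable
  have "integrable lborel (\<lambda>s. ?c t * (norm (g s) * weight \<delta> s))"
    by (intro integrable_mult_right 1)
  then show "integrable lborel (\<lambda>s. norm (g s) * weight \<delta> (t - s))"
  proof (rule Bochner_Integration.integrable_bound)
    show "AE s in lborel. norm (norm (g s) * weight \<delta> (t - s)) \<le> norm (?c t * (norm (g s) * weight \<delta> s))"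
    proof (intro AE_I2)
      fix s
      have "weight \<delta> (t - s) \<le> ?c t * weight \<delta> s"
        using weight_shift[of \<delta> "s - t" t] \<delta> weight_minus[of \<delta> "s - t"] by simp
      from mult_left_mono[OF this norm_ge_zero[of "g s"]]
      show "norm (norm (g s) * weight \<delta> (t - s)) \<le> norm (?c t * (norm (g s) * weight \<delta> s))"
        using w0 by (simp add: abs_mult mult.left_commute)
    qed
  qed measurable
  have "integrable lborel (\<lambda>s. ?c n * (norm (g s) * weight \<delta> s))"
    by (intro integrable_mult_right 1)
  then show "integrable lborel (\<lambda>r. indicator (ball 0 n) r * g r)"
  proof (rule Bochner_Integration.integrable_bound)
    show "AE s in lborel. norm (indicator (ball 0 n) s * g s) \<le> norm (?c n * (norm (g s) * weight \<delta> s))"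
    proof (intro AE_I2)
      fix s
      show "norm (indicator (ball 0 n) s * g s) \<le> norm (?c n * (norm (g s) * weight \<delta> s))"
      proof (cases "s \<in> ball 0 n")
        case True
        then have "(1 + \<bar>n\<bar>) powr (- (1 + \<delta>)) \<le> weight \<delta> s"
          unfolding weight_def using \<delta> by (intro powr_mono2') auto
        then have "?c n * (1 + \<bar>n\<bar>) powr (- (1 + \<delta>)) \<le> ?c n * weight \<delta> s"
          by (intro mult_left_mono) auto
        then have "1 \<le> ?c n * weight \<delta> s"
          by (simp add: add_nonneg_eq_0_iff flip: powr_add)
        from mult_left_mono[OF this norm_ge_zero[of "g s"]] True w0 show ?thesis
          by (simp add: abs_mult mult.left_commute)
      qed simp
    qed
  qed measurable
qed

lemma riesz_kernel_measurable [measurable]: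
  "k > 0 \<Longrightarrow> riesz_kernel k \<in> borel_measurable borel"
  by (intro borel_measurable_continuous_onI continuous_riesz_kernel)

lemma rational_sequence_from_right:
  fixes x :: real
  shows "\<exists>q. (\<forall>j. q j \<in> \<rat> \<and> x < q j \<and> q j < x + inverse (real (Suc j))) \<and> q \<longlonglongrightarrow> x"
proof -
  have "\<exists>q\<in>\<rat>. x < q \<and> q < x + inverse (real (Suc j))" for j
    by (intro Rats_dense_in_real) simp
  then obtain q where q: "\<And>j. q j \<in> \<rat>" "\<And>j. x < q j" "\<And>j. q j < x + inverse (real (Suc j))"
    by metis
  have qx: "q \<longlonglongrightarrow> x"
  proof (rule tendsto_sandwich[OF _ _ tendsto_const])
    show "(\<lambda>j. x + inverse (real (Suc j))) \<longlonglongrightarrow> x"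
      using tendsto_add[OF tendsto_const LIMSEQ_inverse_real_of_nat, of x] by simp
  qed (use q in \<open>auto intro!: always_eventually less_imp_le\<close>)
  with q show ?thesis by blast
qed

text \<open>Both sides are continuous in \<open>x\<close>. Rationals approaching from the right stay
  in \<open>[x, x + 1]\<close>, where one multiple of the weight dominates all dilated
  kernels.\<close>

lemma riesz_kernel_average_rational_limit:
  fixes g :: "real \<Rightarrow> complex"
  assumes l: "frequency l" and k: "k > 0" and [measurable]: "g \<in> borel_measurable borel"
    and fin: "(\<integral>\<^sup>+s. norm (g s) * weight (min k 1) s \<partial>lborel) < \<infinity>"
    and rat: "\<And>q. q \<in> \<rat> \<Longrightarrow> q > 0 \<Longrightarrow>
      riesz_mean l k q D z = (LINT s|lborel. g (t + s) * of_real (q * riesz_kernel k (q * s)))"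
    and x: "x > 0"
  shows "riesz_mean l k x D z = (LINT s|lborel. g (t + s) * of_real (x * riesz_kernel k (x * s)))"
proof -
  define \<delta> where "\<delta> = min k 1"
  have \<delta>: "\<delta> > 0" using k by (simp add: \<delta>_def)
  note [measurable] = riesz_kernel_measurable[OF k]
  have w0: "weight \<delta> s \<ge> 0" for s using weight_pos[of \<delta> s] by simp
  define C where "C = 4 * (4 * k + 1)"
  have C: "C \<ge> 0" "\<And>s. \<bar>riesz_kernel k s\<bar> \<le> C * weight \<delta> s"
    using k riesz_kernel_bound[OF k] by (auto simp: C_def \<delta>_def)
  obtain q where q: "\<And>j. q j \<in> \<rat>" "\<And>j. x < q j" "\<And>j. q j < x + inverse (real (Suc j))" and qx: "q \<longlonglongrightarrow> x"
    using rational_sequence_from_right by metis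
  have "(\<lambda>j. riesz_mean l k (q j) D z) \<longlonglongrightarrow> riesz_mean l k x D z"
    by (rule continuous_on_tendsto_compose[OF continuous_riesz_mean[OF l k] qx])
      (use x q(2) in \<open>auto intro!: always_eventually less_trans[OF x]\<close>)
  moreover have "(\<lambda>j. LINT s|lborel. g (t + s) * of_real (q j * riesz_kernel k (q j * s)))
    \<longlonglongrightarrow> (LINT s|lborel. g (t + s) * of_real (x * riesz_kernel k (x * s)))"
  proof (rule integral_dominated_convergence)
    \<comment> \<open>The factors bound, in this order, \<open>q j\<close>, the kernel by the
      weight, and the weight dilated by \<open>q j \<ge> x\<close> by the weight itself.\<close>
    define a where "a = (x + 1) * C * (min 1 x) powr (- (1 + \<delta>))"
    show "integrable lborel (\<lambda>s. a * (norm (g (t + s)) * weight \<delta> s))"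
      using integrable_of_weight_finite(2)[OF \<delta>] fin by (intro integrable_mult_right) (simp add: \<delta>_def)
    show "AE s in lborel. (\<lambda>j. g (t + s) * of_real (q j * riesz_kernel k (q j * s))) \<longlonglongrightarrow> g (t + s) * of_real (x * riesz_kernel k (x * s))"
    proof (intro AE_I2 tendsto_mult tendsto_const tendsto_of_real qx)
      fix s
      show "(\<lambda>j. riesz_kernel k (q j * s)) \<longlonglongrightarrow> riesz_kernel k (x * s)"
        by (rule continuous_on_tendsto_compose[OF continuous_riesz_kernel[OF k]])
          (use tendsto_mult[OF qx tendsto_const] in auto)
    qed
    show "AE s in lborel. norm (g (t + s) * of_real (q j * riesz_kernel k (q j * s))) \<le> a * (norm (g (t + s)) * weight \<delta> s)" for j
    proof (intro AE_I2)
      fix s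
      have qj: "0 < q j" "x \<le> q j" "q j \<le> x + 1"
        using q(2,3)[of j] x inverse_le_1_iff[of "real (Suc j)"] by auto
      have "\<bar>q j * riesz_kernel k (q j * s)\<bar> \<le> (x + 1) * (C * ((min 1 x) powr (- (1 + \<delta>)) * weight \<delta> s))"
        unfolding abs_mult using qj x C \<delta> weight_dilation_le[of \<delta> x "q j" s]
        by (intro mult_mono order_trans[OF C(2)] mult_left_mono) auto
      from mult_left_mono[OF this norm_ge_zero[of "g (t + s)"]]
      show "norm (g (t + s) * of_real (q j * riesz_kernel k (q j * s))) \<le> a * (norm (g (t + s)) * weight \<delta> s)"
        by (simp add: norm_mult a_def mult_ac abs_mult)
    qed
  qed measurable
  moreover have "riesz_mean l k (q j) D z = (LINT s|lborel. g (t + s) * of_real (q j * riesz_kernel k (q j * s)))" for j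
    using q(1) x q(2)[of j] by (intro rat) auto
  ultimately show ?thesis by (simp add: LIMSEQ_unique)
qed

lemma riesz_mean_line_tendsto:
  fixes g :: "real \<Rightarrow> complex"
  assumes k: "k > 0" and [measurable]: "g \<in> borel_measurable borel"
    and fin: "(\<integral>\<^sup>+s. norm (g s) * weight (min k 1) s \<partial>lborel) < \<infinity>"
    and eq: "AE t in lborel. \<forall>x>0.
      R x t = (LINT s|lborel. g (t + s) * of_real (x * riesz_kernel k (x * s)))"
  shows "AE t in lborel. ((\<lambda>x. R x t) \<longlongrightarrow> g t) at_top"
proof -
  have \<delta>: "min k 1 > 0" using k by simp
  have "AE t in lborel. lebesgue_point g t"
    using integrable_of_weight_finite(4)[OF \<delta> _ fin] by (intro AE_lebesgue_point) simp
  then show ?thesis using eq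
  proof eventually_elim
    case (elim t)
    have "((\<lambda>x. LINT s|lborel. g (t + s) * of_real (x * riesz_kernel k (x * s))) \<longlongrightarrow> g t) at_top"
      by (rule approximate_identity_lebesgue_point[OF \<delta> _ _ fin riesz_kernel_bound[OF k] integral_riesz_kernel[OF k] elim(1)])
        (use riesz_kernel_measurable[OF k] in auto)
    then show ?case
      by (rule Lim_transform_eventually) (use elim(2) in \<open>auto intro: eventually_mono[OF eventually_gt_at_top[of 0]]\<close>)
  qed
qed

text \<open>The Poisson kernel multiplies the oscillation of frequency \<open>a\<close> by
  \<open>exp (- u * \<bar>a\<bar>)\<close>. As frequencies are non-negative, this is
  \<open>exp (- u * a)\<close>, the factor acquired by moving from real part 0 to real part
  \<open>u\<close>.\<close>

lemma riesz_mean_poisson: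
  assumes l: "frequency l" and u: "u > 0"
  shows "(LINT s|lborel. of_real (poisson_kernel u (t - s)) * riesz_mean l k x D (\<i> * of_real s))
    = riesz_mean l k x D (of_real u + \<i> * of_real t)"
proof -
  have cis_meas: "(\<lambda>x::real. cis x) \<in> borel_measurable borel"
    by (intro borel_measurable_continuous_onI continuous_intros)
  note [measurable] = measurable_compose[OF _ cis_meas]
  have l0: "l n \<ge> 0" for n using l by (simp add: frequency_def)
  have exp_cis: "exp (- complex_of_real a * (\<i> * of_real s)) = cis (- (a * s))" for a s
    by (simp add: cis_conv_exp mult_ac)
  have int: "integrable lborel (\<lambda>s. of_real (poisson_kernel u (t - s)) * cis (- (a * s)))" for a
  proof (rule Bochner_Integration.integrable_bound)
    show "integrable lborel (\<lambda>s. poisson_kernel u (t - s))"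
      using lborel_integrable_real_affine[OF poisson_kernel_integral(1)[OF u], of "-1" t] by simp
  qed (auto simp: norm_mult)
  have one: "(LINT s|lborel. of_real (poisson_kernel u (t - s)) * cis (- (a * s))) = exp (- of_real a * (of_real u + \<i> * of_real t))"
    if "a \<ge> 0" for a
  proof -
    have "(LINT s|lborel. of_real (poisson_kernel u (t - s)) * cis (- (a * s)))
      = (LINT v|lborel. of_real (poisson_kernel u v) * cis (- (a * (t - v))))"
      using lborel_integral_real_affine[of "-1" "\<lambda>s. of_real (poisson_kernel u (t - s)) * cis (- (a * s))" t] by simp
    also have "\<dots> = (LINT v|lborel. cis (- (a * t)) * (of_real (poisson_kernel u v) * cis (- ((- a) * v))))"
    proof (intro Bochner_Integration.integral_cong refl)
      fix v
      have "cis (- (a * (t - v))) = cis (- (a * t)) * cis (- ((- a) * v))"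
        by (simp add: cis_mult algebra_simps)
      then show "of_real (poisson_kernel u v) * cis (- (a * (t - v))) = cis (- (a * t)) * (of_real (poisson_kernel u v) * cis (- ((- a) * v)))"
        by simp
    qed
    also have "\<dots> = cis (- (a * t)) * of_real (exp (- u * \<bar>- a\<bar>))"
      by (simp only: integral_mult_right_zero fourier_poisson_kernel[OF u])
    also have "\<dots> = exp (- of_real a * (of_real u + \<i> * of_real t))"
      using that by (simp add: cis_conv_exp exp_of_real[symmetric] distrib_left exp_add[symmetric] mult_ac)
    finally show ?thesis .
  qed
  have "(LINT s|lborel. of_real (poisson_kernel u (t - s)) * riesz_mean l k x D (\<i> * of_real s))
    = (LINT s|lborel. (\<Sum>n | l n < x. D n * of_real ((1 - l n / x) powr k) * (of_real (poisson_kernel u (t - s)) * cis (- (l n * s)))))"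
    unfolding riesz_mean_def exp_cis sum_distrib_left by (simp only: mult_ac)
  also have "\<dots> = (\<Sum>n | l n < x. D n * of_real ((1 - l n / x) powr k) * (LINT s|lborel. of_real (poisson_kernel u (t - s)) * cis (- (l n * s))))"
    by (subst Bochner_Integration.integral_sum) (auto intro!: integrable_mult_right int simp only: integral_mult_right_zero)
  also have "\<dots> = riesz_mean l k x D (of_real u + \<i> * of_real t)"
    unfolding riesz_mean_def by (simp only: one[OF l0])
  finally show ?thesis .
qed

text \<open>The averaging identity is known only for almost all \<open>s\<close>, but
  \<open>riesz_mean_poisson\<close> uses it under an integral. Convergence therefore holds at every
  \<open>t\<close>, with no exceptional set depending on \<open>u\<close>.\<close>

lemma riesz_mean_right_half_plane_tendsto:
  fixes g :: "real \<Rightarrow> complex"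
  assumes l: "frequency l" and k: "k > 0" and u: "u > 0" and [measurable]: "g \<in> borel_measurable borel"
    and fin: "(\<integral>\<^sup>+s. norm (g s) * weight (min k 1) s \<partial>lborel) < \<infinity>"
    and eq: "AE s in lborel. \<forall>x>0. riesz_mean l k x D (\<i> * of_real s)
      = (LINT \<sigma>|lborel. g (s + \<sigma>) * of_real (x * riesz_kernel k (x * \<sigma>)))"
  shows "integrable lborel (\<lambda>y. g y * of_real (poisson_kernel u (t - y)))"
    and "((\<lambda>x. riesz_mean l k x D (of_real u + \<i> * of_real t))
      \<longlongrightarrow> (LINT y|lborel. g y * of_real (poisson_kernel u (t - y)))) at_top"
proof -
  define \<delta> where "\<delta> = min k 1"
  have \<delta>: "0 < \<delta>" "\<delta> \<le> 1" using k by (auto simp: \<delta>_def)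
  note [measurable] = riesz_kernel_measurable[OF k]
  have w0: "weight \<delta> s \<ge> 0" for s using weight_pos[of \<delta> s] by simp
  have P0: "poisson_kernel u s \<ge> 0" for s by (rule poisson_kernel_nonneg[OF u])
  note gw = integrable_of_weight_finite(3)[OF \<delta>(1) \<open>g \<in> borel_measurable borel\<close> fin[folded \<delta>_def]]
  define A where "A = 2 * u * (1 + 1 / u\<^sup>2)"
  have A: "A \<ge> 0" "poisson_kernel u s \<le> A * weight \<delta> s" for s
    using u poisson_kernel_le_weight[OF u \<delta>] by (auto simp: A_def)
  show "integrable lborel (\<lambda>y. g y * of_real (poisson_kernel u (t - y)))"
  proof (rule Bochner_Integration.integrable_bound)
    show "integrable lborel (\<lambda>s. A * (norm (g s) * weight \<delta> (t - s)))"
      by (intro integrable_mult_right gw)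
    show "AE s in lborel. norm (g s * of_real (poisson_kernel u (t - s))) \<le> norm (A * (norm (g s) * weight \<delta> (t - s)))"
    proof (rule AE_I2)
      fix s
      show "norm (g s * of_real (poisson_kernel u (t - s))) \<le> norm (A * (norm (g s) * weight \<delta> (t - s)))"
        using mult_left_mono[OF A(2)[of "t - s"] norm_ge_zero[of "g s"]] A(1) w0 P0
        by (simp add: norm_mult abs_mult mult.left_commute)
    qed
  qed measurable
  define C where "C = 4 * (4 * k + 1)"
  have C: "C \<ge> 0" "\<And>s. \<bar>riesz_kernel k s\<bar> \<le> C * weight \<delta> s"
    using k riesz_kernel_bound[OF k] by (auto simp: C_def \<delta>_def)
  define Kx where "Kx x s = x * riesz_kernel k (x * s)" for x s
  have [measurable]: "Kx x \<in> borel_measurable borel" for x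
    unfolding Kx_def by measurable
  \<comment> \<open>The averages are taken at \<open>s + \<sigma>\<close>, a convolution needs
    \<open>s - \<rho>\<close>; evenness of the kernel reconciles the two.\<close>
  have Kx_even: "Kx x (- s) = Kx x s" for x s by (simp add: Kx_def)
  have Kx_le: "\<bar>Kx x s\<bar> \<le> C * (x * weight \<delta> (x * s))" if "x \<ge> 1" for x s
    using mult_left_mono[OF C(2)[of "x * s"], of x] that by (simp add: Kx_def abs_mult mult_ac)
  obtain C' where "C' \<ge> 0" and C'_all: "\<forall>x\<ge>1. \<forall>t. integrable lborel (\<lambda>s. poisson_kernel u (t - s) * (x * weight \<delta> (x * s)))
      \<and> (LINT s|lborel. poisson_kernel u (t - s) * (x * weight \<delta> (x * s))) \<le> C' * weight \<delta> t"
    using poisson_weight_convolution[OF u \<delta>] by blast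
  then have C': "C' \<ge> 0"
    "\<And>x t. x \<ge> 1 \<Longrightarrow> integrable lborel (\<lambda>s. poisson_kernel u (t - s) * (x * weight \<delta> (x * s)))"
    "\<And>x t. x \<ge> 1 \<Longrightarrow> (LINT s|lborel. poisson_kernel u (t - s) * (x * weight \<delta> (x * s))) \<le> C' * weight \<delta> t"
    by auto
  define Q where "Q x v = (LINT s|lborel. poisson_kernel u (v - s) * Kx x s)" for x v
  have PK_le: "\<bar>poisson_kernel u (v - s) * Kx x s\<bar> \<le> C * (poisson_kernel u (v - s) * (x * weight \<delta> (x * s)))"
    if "x \<ge> 1" for x v s
    using mult_left_mono[OF Kx_le[OF that, of s] P0[of "v - s"]] P0[of "v - s"] by (simp add: abs_mult mult_ac)
  have PK_int: "integrable lborel (\<lambda>s. poisson_kernel u (v - s) * Kx x s)" if "x \<ge> 1" for x v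
  proof (rule Bochner_Integration.integrable_bound)
    show "integrable lborel (\<lambda>s. C * (poisson_kernel u (v - s) * (x * weight \<delta> (x * s))))"
      by (intro integrable_mult_right C'(2) that)
    show "AE s in lborel. norm (poisson_kernel u (v - s) * Kx x s) \<le> norm (C * (poisson_kernel u (v - s) * (x * weight \<delta> (x * s))))"
      using PK_le[OF that] unfolding real_norm_def by (intro AE_I2 order_trans[OF _ abs_ge_self]) auto
  qed measurable
  \<comment> \<open>Fubini below needs the integral of the absolute value, not merely a bound for
    \<open>Q\<close> itself.\<close>
  have Qabs: "(LINT s|lborel. \<bar>poisson_kernel u (v - s) * Kx x s\<bar>) \<le> C * C' * weight \<delta> v" if "x \<ge> 1" for x v
  proof -
    have "(LINT s|lborel. \<bar>poisson_kernel u (v - s) * Kx x s\<bar>) \<le> (LINT s|lborel. C * (poisson_kernel u (v - s) * (x * weight \<delta> (x * s))))"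
      by (intro integral_mono integrable_abs PK_int PK_le integrable_mult_right C'(2) that)
    also have "\<dots> \<le> C * (C' * weight \<delta> v)"
      unfolding integral_mult_right_zero by (intro mult_left_mono C'(3) C(1) that)
    finally show ?thesis by simp
  qed
  have Q_le: "\<bar>Q x v\<bar> \<le> C * C' * weight \<delta> v" if "x \<ge> 1" for x v
    using integral_norm_bound[of lborel "\<lambda>s. poisson_kernel u (v - s) * Kx x s"] Qabs[OF that, of v]
    unfolding Q_def real_norm_def by linarith
  \<comment> \<open>After rescaling \<open>s\<close> by \<open>1 / x\<close> the Riesz kernel is
    fixed and integrable, and the Poisson factor is bounded and continuous.\<close>
  have Q_lim: "((\<lambda>x. Q x v) \<longlongrightarrow> poisson_kernel u v) at_top" for v
  proof -
    have "((\<lambda>x. LINT s|lborel. poisson_kernel u (v - 1 / x * s) * riesz_kernel k s) \<longlongrightarrow> (LINT s|lborel. poisson_kernel u v * riesz_kernel k s)) at_top"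
    proof (rule integral_dominated_convergence_at_top)
      show "integrable lborel (\<lambda>s. A * \<bar>riesz_kernel k s\<bar>)"
        by (intro integrable_mult_right integrable_abs riesz_kernel_integrable k)
      show "AE s in lborel. ((\<lambda>x. poisson_kernel u (v - 1 / x * s) * riesz_kernel k s) \<longlongrightarrow> poisson_kernel u v * riesz_kernel k s) at_top"
      proof (intro AE_I2 tendsto_mult tendsto_const)
        fix s
        have "((\<lambda>x. v - 1 / x * s) \<longlongrightarrow> v - 0 * s) at_top"
          by (intro tendsto_intros tendsto_divide_0[OF tendsto_const] filterlim_at_top_imp_at_infinity filterlim_ident)
        moreover have "isCont (poisson_kernel u) (v - 0 * s)"
          unfolding poisson_kernel_def using u by (intro continuous_intros) (simp add: add_pos_nonneg less_imp_neq[THEN not_sym])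
        ultimately show "((\<lambda>x. poisson_kernel u (v - 1 / x * s)) \<longlongrightarrow> poisson_kernel u v) at_top"
          using isCont_tendsto_compose by fastforce
      qed
      show "\<forall>\<^sub>F x in at_top. AE s in lborel. norm (poisson_kernel u (v - 1 / x * s) * riesz_kernel k s) \<le> A * \<bar>riesz_kernel k s\<bar>"
      proof (intro always_eventually allI AE_I2)
        fix x s :: real
        have "poisson_kernel u (v - 1 / x * s) \<le> A * 1"
          using weight_le_1[of \<delta>] \<delta> A(1) by (intro order_trans[OF A(2)] mult_left_mono) auto
        then show "norm (poisson_kernel u (v - 1 / x * s) * riesz_kernel k s) \<le> A * \<bar>riesz_kernel k s\<bar>"
          using P0 by (simp add: abs_mult mult_right_mono)
      qed
    qed measurable
    moreover have "(LINT s|lborel. poisson_kernel u v * riesz_kernel k s) = poisson_kernel u v"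
      using integral_riesz_kernel[OF k] by simp
    moreover have "\<forall>\<^sub>F x in at_top. (LINT s|lborel. poisson_kernel u (v - 1 / x * s) * riesz_kernel k s) = Q x v"
      using eventually_gt_at_top[of 0]
    proof eventually_elim
      case (elim x)
      then show ?case
        using lborel_integral_real_affine[of "1 / x" "\<lambda>s. poisson_kernel u (v - s) * Kx x s" 0]
        by (simp add: Q_def Kx_def mult.left_commute[of _ x])
    qed
    ultimately show ?thesis using Lim_transform_eventually by fastforce
  qed
  have main: "riesz_mean l k x D (of_real u + \<i> * of_real t) = (LINT \<rho>|lborel. g \<rho> * of_real (Q x (t - \<rho>)))"
    if x: "x \<ge> 1" for x
  proof -
    define H where "H \<rho> s = g \<rho> * of_real (poisson_kernel u (t - s) * Kx x (s - \<rho>))" for \<rho> s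
    have [measurable]: "(\<lambda>p. H (fst p) (snd p)) \<in> borel_measurable (lborel \<Otimes>\<^sub>M lborel)"
      unfolding H_def by measurable
    have shift: "integrable lborel (\<lambda>s. poisson_kernel u (t - s) * Kx x (s - \<rho>))"
      "(LINT s|lborel. poisson_kernel u (t - s) * Kx x (s - \<rho>)) = Q x (t - \<rho>)"
      "(LINT s|lborel. \<bar>poisson_kernel u (t - s) * Kx x (s - \<rho>)\<bar>) = (LINT s|lborel. \<bar>poisson_kernel u (t - \<rho> - s) * Kx x s\<bar>)" for \<rho>
      using lborel_integrable_real_affine[OF PK_int[OF x, of "t - \<rho>"], of 1 "- \<rho>"]
        lborel_integral_real_affine[of 1 "\<lambda>s. poisson_kernel u (t - \<rho> - s) * Kx x s" "- \<rho>"]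
        lborel_integral_real_affine[of 1 "\<lambda>s. \<bar>poisson_kernel u (t - \<rho> - s) * Kx x s\<bar>" "- \<rho>"]
      by (simp_all add: Q_def)
    have "riesz_mean l k x D (of_real u + \<i> * of_real t)
      = (LINT s|lborel. of_real (poisson_kernel u (t - s)) * riesz_mean l k x D (\<i> * of_real s))"
      by (rule riesz_mean_poisson[OF l u, symmetric])
    also have "\<dots> = (LINT s|lborel. (LINT \<rho>|lborel. H \<rho> s))"
    proof (rule integral_cong_AE)
      show "AE s in lborel. of_real (poisson_kernel u (t - s)) * riesz_mean l k x D (\<i> * of_real s) = (LINT \<rho>|lborel. H \<rho> s)"
        using eq
      proof eventually_elim
        case (elim s)
        have "(LINT \<sigma>|lborel. g (s + \<sigma>) * of_real (Kx x \<sigma>)) = (LINT \<rho>|lborel. g \<rho> * of_real (Kx x (\<rho> - s)))"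
          using lborel_integral_real_affine[of 1 "\<lambda>\<rho>. g \<rho> * of_real (Kx x (\<rho> - s))" s] by simp
        then have "riesz_mean l k x D (\<i> * of_real s) = (LINT \<rho>|lborel. g \<rho> * of_real (Kx x (s - \<rho>)))"
          using elim[rule_format, of x] x Kx_even[of x "s - _"] by (simp add: Kx_def)
        then show ?case by (simp add: H_def mult_ac flip: integral_mult_right_zero)
      qed
      have "(\<lambda>s. riesz_mean l k x D (\<i> * of_real s)) \<in> borel_measurable borel"
        unfolding riesz_mean_def by (intro borel_measurable_continuous_onI continuous_intros)
      then show "(\<lambda>s. of_real (poisson_kernel u (t - s)) * riesz_mean l k x D (\<i> * of_real s)) \<in> borel_measurable lborel"
        by measurable
      have [measurable]: "(\<lambda>p. H (snd p) (fst p)) \<in> borel_measurable (lborel \<Otimes>\<^sub>M lborel)"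
        unfolding H_def by measurable
      then show "(\<lambda>s. LINT \<rho>|lborel. H \<rho> s) \<in> borel_measurable lborel"
        using lborel.borel_measurable_lebesgue_integral[of "\<lambda>s \<rho>. H \<rho> s" lborel] by (simp add: case_prod_beta')
    qed
    also have "\<dots> = (LINT \<rho>|lborel. (LINT s|lborel. H \<rho> s))"
    proof (rule lborel_pair.Fubini_integral)
      have nH: "norm (H \<rho> s) = norm (g \<rho>) * \<bar>poisson_kernel u (t - s) * Kx x (s - \<rho>)\<bar>" for \<rho> s
        by (simp add: H_def norm_mult abs_mult)
      have "integrable (lborel \<Otimes>\<^sub>M lborel) (\<lambda>p. H (fst p) (snd p))"
      proof (rule lborel_pair.Fubini_integrable)
        have "integrable lborel (\<lambda>\<rho>. LINT s|lborel. norm (H \<rho> s))"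
        proof (rule Bochner_Integration.integrable_bound)
          show "integrable lborel (\<lambda>\<rho>. C * C' * (norm (g \<rho>) * weight \<delta> (t - \<rho>)))"
            by (intro integrable_mult_right gw)
          show "AE \<rho> in lborel. norm (LINT s|lborel. norm (H \<rho> s)) \<le> norm (C * C' * (norm (g \<rho>) * weight \<delta> (t - \<rho>)))"
          proof (rule AE_I2)
            fix \<rho>
            have "(LINT s|lborel. norm (H \<rho> s)) = norm (g \<rho>) * (LINT s|lborel. \<bar>poisson_kernel u (t - \<rho> - s) * Kx x s\<bar>)"
              unfolding nH integral_mult_right_zero shift ..
            also have "\<dots> \<le> norm (g \<rho>) * (C * C' * weight \<delta> (t - \<rho>))"
              by (intro mult_left_mono Qabs x) simp
            finally have "(LINT s|lborel. norm (H \<rho> s)) \<le> C * C' * (norm (g \<rho>) * weight \<delta> (t - \<rho>))"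
              by (simp add: mult_ac)
            moreover have "0 \<le> (LINT s|lborel. norm (H \<rho> s))" by simp
            ultimately show "norm (LINT s|lborel. norm (H \<rho> s)) \<le> norm (C * C' * (norm (g \<rho>) * weight \<delta> (t - \<rho>)))"
              unfolding real_norm_def by linarith
          qed
          show "(\<lambda>\<rho>. LINT s|lborel. norm (H \<rho> s)) \<in> borel_measurable lborel"
            using lborel.borel_measurable_lebesgue_integral[of "\<lambda>\<rho> s. norm (H \<rho> s)" lborel] by (simp add: case_prod_beta')
        qed
        then show "integrable lborel (\<lambda>\<rho>. LINT s|lborel. norm (H (fst (\<rho>, s)) (snd (\<rho>, s))))" by simp
        show "AE \<rho> in lborel. integrable lborel (\<lambda>s. H (fst (\<rho>, s)) (snd (\<rho>, s)))"
          unfolding H_def fst_conv snd_conv by (intro AE_I2 integrable_mult_right integrable_of_real shift)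
      qed simp
      then show "integrable (lborel \<Otimes>\<^sub>M lborel) (\<lambda>(\<rho>, s). H \<rho> s)"
        by (simp add: case_prod_beta')
    qed
    also have "\<dots> = (LINT \<rho>|lborel. g \<rho> * of_real (Q x (t - \<rho>)))"
      unfolding H_def integral_mult_right_zero integral_complex_of_real shift ..
    finally show ?thesis .
  qed
  have "((\<lambda>x. LINT \<rho>|lborel. g \<rho> * of_real (Q x (t - \<rho>))) \<longlongrightarrow> (LINT \<rho>|lborel. g \<rho> * of_real (poisson_kernel u (t - \<rho>)))) at_top"
  proof (rule integral_dominated_convergence_at_top)
    show "integrable lborel (\<lambda>\<rho>. C * C' * (norm (g \<rho>) * weight \<delta> (t - \<rho>)))"
      by (intro integrable_mult_right gw)
    show "AE \<rho> in lborel. ((\<lambda>x. g \<rho> * of_real (Q x (t - \<rho>))) \<longlongrightarrow> g \<rho> * of_real (poisson_kernel u (t - \<rho>))) at_top"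
      by (intro AE_I2 tendsto_intros Q_lim)
    show "\<forall>\<^sub>F x in at_top. AE \<rho> in lborel. norm (g \<rho> * of_real (Q x (t - \<rho>))) \<le> C * C' * (norm (g \<rho>) * weight \<delta> (t - \<rho>))"
      using eventually_ge_at_top[of 1]
    proof eventually_elim
      case (elim x)
      show ?case
      proof (rule AE_I2)
        fix \<rho>
        show "norm (g \<rho> * of_real (Q x (t - \<rho>))) \<le> C * C' * (norm (g \<rho>) * weight \<delta> (t - \<rho>))"
          using mult_left_mono[OF Q_le[OF elim, of "t - \<rho>"] norm_ge_zero[of "g \<rho>"]]
          by (simp add: norm_mult mult_ac)
      qed
    qed
    have "Q x \<in> borel_measurable borel" for x
      unfolding Q_def by measurable
    then show "(\<lambda>\<rho>. g \<rho> * of_real (Q x (t - \<rho>))) \<in> borel_measurable lborel" for x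
      by measurable
  qed measurable
  then show "((\<lambda>x. riesz_mean l k x D (of_real u + \<i> * of_real t))
      \<longlongrightarrow> (LINT y|lborel. g y * of_real (poisson_kernel u (t - y)))) at_top"
    by (rule Lim_transform_eventually)
      (use main in \<open>auto intro: eventually_mono[OF eventually_ge_at_top[of 1]]\<close>)
qed

section \<open>The flow on a Dirichlet group\<close>

text \<open>For each basic open \<open>V\<close> the union of all open \<open>U\<close> with
  \<open>U \<times> V \<subseteq> W\<close> is open, however many such \<open>U\<close> there are.
  Only the number of sets \<open>V\<close> has to be countable, so nothing is asked of the first
  factor.\<close>

lemma open_in_sets_pair_borel:
  fixes W :: "('a::topological_space \<times> 'b::second_countable_topology) set"
  assumes "open W"
  shows "W \<in> sets (borel \<Otimes>\<^sub>M borel)"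
proof -
  obtain B :: "'b set set" where B: "countable B" "topological_basis B"
    using ex_countable_basis by blast
  define U where "U V = \<Union>{U :: 'a set. open U \<and> U \<times> V \<subseteq> W}" for V
  have "W = (\<Union>V\<in>B. U V \<times> V)"
  proof (intro equalityI subsetI)
    fix p assume p: "p \<in> W"
    obtain U0 V0 where 1: "open U0" "open V0" "p \<in> U0 \<times> V0" "U0 \<times> V0 \<subseteq> W"
      by (rule open_prod_elim[OF assms p])
    then obtain V where V: "V \<in> B" "snd p \<in> V" "V \<subseteq> V0"
      using topological_basisE[OF B(2), of V0 "snd p"] by (auto simp: mem_Times_iff)
    then have "fst p \<in> U V" using 1 by (auto simp: U_def mem_Times_iff intro!: exI[of _ U0])
    then show "p \<in> (\<Union>V\<in>B. U V \<times> V)" using V by (auto simp: mem_Times_iff intro!: bexI[of _ V])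
  qed (auto simp: U_def)
  moreover have "(\<Union>V\<in>B. U V \<times> V) \<in> sets (borel \<Otimes>\<^sub>M borel)"
  proof (rule sets.countable_UN''[OF B(1)], rule pair_measureI)
    fix V assume "V \<in> B"
    then show "V \<in> sets borel" using topological_basis_open[OF B(2)] by simp
    show "U V \<in> sets borel" by (intro borel_open) (auto simp: U_def)
  qed
  ultimately show ?thesis by simp
qed

locale dirichlet_flow = haar_group m
  for m :: "'g::{topological_ab_group_add, t2_space} measure" +
  fixes \<beta> :: "real \<Rightarrow> 'g"
  assumes dirichlet: "dirichlet_group \<beta>"
begin

sublocale line: pair_sigma_finite m lborel
  by standard

lemma flow_measurable [measurable]: "(\<lambda>p. fst p + \<beta> (snd p)) \<in> m \<Otimes>\<^sub>M lborel \<rightarrow>\<^sub>M m"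
proof -
  have \<beta>: "continuous_on UNIV \<beta>" using dirichlet by (simp add: dirichlet_group_def)
  have s: "sets (m \<Otimes>\<^sub>M lborel) = sets (borel \<Otimes>\<^sub>M borel)"
    by (intro sets_pair_measure_cong sets_haar sets_lborel)
  have "(\<lambda>p. fst p + \<beta> (snd p)) \<in> borel_measurable (m \<Otimes>\<^sub>M lborel)"
  proof (rule borel_measurableI)
    fix S :: "'g set" assume "open S"
    then have "open ((\<lambda>p. fst p + \<beta> (snd p)) -` S)"
      by (intro open_vimage continuous_intros continuous_on_compose2[OF \<beta>]) auto
    then show "(\<lambda>p. fst p + \<beta> (snd p)) -` S \<inter> space (m \<Otimes>\<^sub>M lborel) \<in> sets (m \<Otimes>\<^sub>M lborel)"
      unfolding s by (simp add: space_pair_measure open_in_sets_pair_borel)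
  qed
  then show ?thesis by (simp add: measurable_cong_sets[OF refl sets_haar])
qed

lemma orbit_measurable:
  assumes "f \<in> borel_measurable m"
  shows "(\<lambda>t. f (\<omega> + \<beta> t)) \<in> borel_measurable borel"
proof -
  have "(\<lambda>t. (\<omega>, t)) \<in> lborel \<rightarrow>\<^sub>M m \<Otimes>\<^sub>M lborel" by measurable
  from measurable_compose[OF measurable_compose[OF this flow_measurable] assms]
  show ?thesis by simp
qed

text \<open>At each fixed time the flow is a translation and preserves \<open>m\<close>; Tonelli's
  theorem does the rest. All passages between the group and its orbits rest on this
  identity.\<close>

lemma nn_integral_flow:
  assumes f: "f \<in> borel_measurable m" and [measurable]: "h \<in> borel_measurable borel"
  shows "(\<integral>\<^sup>+\<omega>. (\<integral>\<^sup>+t. f (\<omega> + \<beta> t) * h t \<partial>lborel) \<partial>m) = (\<integral>\<^sup>+\<omega>. f \<omega> \<partial>m) * (\<integral>\<^sup>+t. h t \<partial>lborel)"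
proof -
  note [measurable] = measurable_compose[OF flow_measurable f] f
  have "(\<integral>\<^sup>+\<omega>. (\<integral>\<^sup>+t. f (\<omega> + \<beta> t) * h t \<partial>lborel) \<partial>m) = (\<integral>\<^sup>+t. (\<integral>\<^sup>+\<omega>. f (\<omega> + \<beta> t) * h t \<partial>m) \<partial>lborel)"
    using line.Fubini[of "\<lambda>p. f (fst p + \<beta> (snd p)) * h (snd p)"] by simp
  also have "\<dots> = (\<integral>\<^sup>+t. (\<integral>\<^sup>+\<omega>. f \<omega> \<partial>m) * h t \<partial>lborel)"
  proof (rule nn_integral_cong)
    fix t
    have "(\<integral>\<^sup>+\<omega>. f (\<omega> + \<beta> t) * h t \<partial>m) = (\<integral>\<^sup>+\<omega>. f (\<beta> t + \<omega>) * h t \<partial>m)"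
      by (simp only: add.commute)
    also have "\<dots> = (\<integral>\<^sup>+\<omega>. f (\<beta> t + \<omega>) \<partial>m) * h t"
      by (intro nn_integral_multc) measurable
    finally show "(\<integral>\<^sup>+\<omega>. f (\<omega> + \<beta> t) * h t \<partial>m) = (\<integral>\<^sup>+\<omega>. f \<omega> \<partial>m) * h t"
      by (simp add: nn_integral_translation[OF f])
  qed
  also have "\<dots> = (\<integral>\<^sup>+\<omega>. f \<omega> \<partial>m) * (\<integral>\<^sup>+t. h t \<partial>lborel)"
    by (rule nn_integral_cmult) simp
  finally show ?thesis .
qed

lemma AE_orbit_weight_finite:
  fixes f :: "'g \<Rightarrow> complex"
  assumes f: "integrable m f" and "\<delta> > 0"
  shows "AE \<omega> in m. (\<integral>\<^sup>+t. norm (f (\<omega> + \<beta> t)) * weight \<delta> t \<partial>lborel) < \<infinity>"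
proof -
  have [measurable]: "f \<in> borel_measurable m" using f by auto
  note [measurable] = measurable_compose[OF flow_measurable \<open>f \<in> borel_measurable m\<close>]
  have w0: "weight \<delta> s \<ge> 0" for s using weight_pos[of \<delta> s] by simp
  have "(\<integral>\<^sup>+\<omega>. (\<integral>\<^sup>+t. norm (f (\<omega> + \<beta> t)) * weight \<delta> t \<partial>lborel) \<partial>m)
    = (\<integral>\<^sup>+\<omega>. norm (f \<omega>) \<partial>m) * (\<integral>\<^sup>+t. weight \<delta> t \<partial>lborel)"
    using nn_integral_flow[of "\<lambda>\<omega>. ennreal (norm (f \<omega>))" "\<lambda>t. ennreal (weight \<delta> t)"] w0
    by (simp add: ennreal_mult)
  also have "\<dots> = ennreal (LINT \<omega>|m. norm (f \<omega>)) * ennreal (LINT t|lborel. weight \<delta> t)"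
    using f integrable_weight[OF \<open>\<delta> > 0\<close>] w0 by (simp add: nn_integral_eq_integral)
  also have "\<dots> \<noteq> \<infinity>" by (simp add: ennreal_mult_eq_top_iff)
  finally have "AE \<omega> in m. (\<integral>\<^sup>+t. norm (f (\<omega> + \<beta> t)) * weight \<delta> t \<partial>lborel) \<noteq> \<infinity>"
    by (intro nn_integral_PInf_AE) measurable
  then show ?thesis by (simp add: less_top)
qed

text \<open>By \<open>nn_integral_flow\<close> the time that an orbit spends in a null set of the
  group integrates to 0, so it is 0 for almost every orbit.\<close>

lemma AE_orbit:
  assumes "AE \<omega> in m. Q \<omega>"
  shows "AE \<omega> in m. AE t in lborel. Q (\<omega> + \<beta> t)"
proof -
  obtain N where N: "{\<omega> \<in> space m. \<not> Q \<omega>} \<subseteq> N" "emeasure m N = 0" "N \<in> sets m"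
    using assms by (rule AE_E)
  note [measurable] = N(3) flow_measurable
  have m1: "(\<lambda>p. indicator N (fst p + \<beta> (snd p)) :: ennreal) \<in> borel_measurable (m \<Otimes>\<^sub>M lborel)"
    by (rule measurable_compose[OF flow_measurable borel_measurable_indicator[OF N(3)]])
  have "(\<integral>\<^sup>+\<omega>. (\<integral>\<^sup>+t. indicator N (\<omega> + \<beta> t) \<partial>lborel) \<partial>m) = 0"
    using nn_integral_flow[of "indicator N" "\<lambda>_. 1"] N by simp
  then have "AE \<omega> in m. (\<integral>\<^sup>+t. indicator N (\<omega> + \<beta> t) \<partial>lborel) = 0"
    by (subst (asm) nn_integral_0_iff_AE) (use lborel.borel_measurable_nn_integral_fst[OF m1] in simp_all)
  then show ?thesis
  proof eventually_elim
    case (elim \<omega>)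
    have "(\<lambda>t. indicator N (\<omega> + \<beta> t) :: ennreal) \<in> borel_measurable lborel"
      using orbit_measurable[OF borel_measurable_indicator[OF N(3)], of \<omega>] by simp
    then have "AE t in lborel. (indicator N (\<omega> + \<beta> t) :: ennreal) = 0"
      using elim by (simp add: nn_integral_0_iff_AE)
    then show ?case
      by eventually_elim (use N(1) in \<open>auto simp: indicator_def split: if_splits\<close>)
  qed
qed

text \<open>With times restricted to \<open>[0, 1]\<close> the time factor in
  \<open>nn_integral_flow\<close> is 1, and the double integral is the measure of
  \<open>- S\<close>. Measurability of \<open>S\<close> is what makes that identity
  applicable.\<close>

lemma AE_of_AE_orbit:
  assumes S: "S \<in> sets m" and AE: "AE \<omega> in m. AE t in lborel. \<omega> + \<beta> t \<in> S"
  shows "AE \<omega> in m. \<omega> \<in> S"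
proof -
  have "(\<integral>\<^sup>+\<omega>. (\<integral>\<^sup>+t. indicator (- S) (\<omega> + \<beta> t) * indicator {0..1} t \<partial>lborel) \<partial>m) = (\<integral>\<^sup>+\<omega>. 0 \<partial>m)"
  proof (rule nn_integral_cong_AE)
    show "AE \<omega> in m. (\<integral>\<^sup>+t. indicator (- S) (\<omega> + \<beta> t) * indicator {0..1} t \<partial>lborel) = 0"
      using AE
    proof eventually_elim
      case (elim \<omega>)
      then have "AE t in lborel. (indicator (- S) (\<omega> + \<beta> t) * indicator {0..1} t :: ennreal) = 0"
        by eventually_elim simp
      from nn_integral_cong_AE[OF this] show ?case by simp
    qed
  qed
  moreover have CS: "- S \<in> sets m" using S by (auto simp: sets_haar)
  ultimately have "emeasure m (- S) = 0"
    using nn_integral_flow[of "indicator (- S)" "indicator {0..1}"] by simp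
  then show ?thesis
    using CS by (subst AE_iff_measurable[of "- S"]) auto
qed

text \<open>Translation by \<open>\<beta> s\<close> multiplies the Fourier coefficient at
  \<open>\<gamma>\<close> by \<open>\<gamma> (\<beta> s)\<close>, so averaging along the flow is a
  Fourier multiplier.\<close>

lemma flow_average:
  fixes f :: "'g \<Rightarrow> complex" and K :: "real \<Rightarrow> real"
  assumes f: "integrable m f" and K: "integrable lborel K"
  shows "integrable m (\<lambda>\<omega>. LINT s|lborel. f (\<omega> + \<beta> s) * of_real (K s))"
    and "continuous_character \<gamma> \<Longrightarrow>
      fourier_coeff m (\<lambda>\<omega>. LINT s|lborel. f (\<omega> + \<beta> s) * of_real (K s)) \<gamma>
      = fourier_coeff m f \<gamma> * (LINT s|lborel. \<gamma> (\<beta> s) * of_real (K s))"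
proof -
  have fm: "f \<in> borel_measurable m" and [measurable]: "K \<in> borel_measurable borel" using f K by auto
  note [measurable] = measurable_compose[OF flow_measurable fm] fm
  have int: "integrable (m \<Otimes>\<^sub>M lborel) (\<lambda>p. f (fst p + \<beta> (snd p)) * of_real (K (snd p)))"
  proof (rule integrableI_bounded)
    have "(\<integral>\<^sup>+p. norm (f (fst p + \<beta> (snd p)) * of_real (K (snd p))) \<partial>(m \<Otimes>\<^sub>M lborel))
      = (\<integral>\<^sup>+\<omega>. (\<integral>\<^sup>+t. ennreal (norm (f (\<omega> + \<beta> t))) * ennreal \<bar>K t\<bar> \<partial>lborel) \<partial>m)"
      by (subst lborel.nn_integral_fst[symmetric]) (auto simp: norm_mult ennreal_mult)
    also have "\<dots> = (\<integral>\<^sup>+\<omega>. norm (f \<omega>) \<partial>m) * (\<integral>\<^sup>+t. \<bar>K t\<bar> \<partial>lborel)"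
      by (rule nn_integral_flow) measurable
    also have "\<dots> = ennreal (LINT \<omega>|m. norm (f \<omega>)) * ennreal (LINT t|lborel. \<bar>K t\<bar>)"
      using f K by (simp add: nn_integral_eq_integral)
    also have "\<dots> < \<infinity>" by (simp add: ennreal_mult_less_top)
    finally show "(\<integral>\<^sup>+p. norm (f (fst p + \<beta> (snd p)) * of_real (K (snd p))) \<partial>(m \<Otimes>\<^sub>M lborel)) < \<infinity>" .
  qed measurable
  show "integrable m (\<lambda>\<omega>. LINT s|lborel. f (\<omega> + \<beta> s) * of_real (K s))"
    using line.integrable_fst'[OF int] by simp
  assume \<gamma>: "continuous_character \<gamma>"
  have gc: "continuous_on UNIV \<gamma>" and mult: "\<And>x y. \<gamma> (x + y) = \<gamma> x * \<gamma> y" and g1: "\<And>x. norm (\<gamma> x) = 1"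
    using \<gamma> by (auto simp: continuous_character_def)
  have [measurable]: "\<gamma> \<in> borel_measurable m" "(\<lambda>\<omega>. cnj (\<gamma> \<omega>)) \<in> borel_measurable m"
    by (intro continuous_measurable gc continuous_intros)+
  have "integrable (m \<Otimes>\<^sub>M lborel) (\<lambda>p. f (fst p + \<beta> (snd p)) * of_real (K (snd p)) * cnj (\<gamma> (fst p)))"
    by (rule Bochner_Integration.integrable_bound[OF int]) (auto simp: norm_mult g1)
  then have sw: "(LINT \<omega>|m. (LINT s|lborel. f (\<omega> + \<beta> s) * of_real (K s) * cnj (\<gamma> \<omega>)))
    = (LINT s|lborel. (LINT \<omega>|m. f (\<omega> + \<beta> s) * of_real (K s) * cnj (\<gamma> \<omega>)))"
    using line.Fubini_integral[of "\<lambda>\<omega> s. f (\<omega> + \<beta> s) * of_real (K s) * cnj (\<gamma> \<omega>)"]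
    by (simp add: case_prod_beta')
  have inner: "(LINT \<omega>|m. f (\<omega> + \<beta> s) * of_real (K s) * cnj (\<gamma> \<omega>)) = fourier_coeff m f \<gamma> * (\<gamma> (\<beta> s) * of_real (K s))" for s
  proof -
    have "f (\<omega> + \<beta> s) * of_real (K s) * cnj (\<gamma> \<omega>)
      = f (\<beta> s + \<omega>) * cnj (\<gamma> (\<beta> s + \<omega>)) * (\<gamma> (\<beta> s) * of_real (K s))" for \<omega>
    proof -
      have "cnj (\<gamma> (\<beta> s + \<omega>)) * \<gamma> (\<beta> s) = cnj (\<gamma> \<omega>) * (\<gamma> (\<beta> s) * cnj (\<gamma> (\<beta> s)))"
        by (simp add: mult)
      also have "\<dots> = cnj (\<gamma> \<omega>)"
        by (simp add: complex_norm_square[symmetric] g1)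
      finally show ?thesis by (simp add: add.commute mult_ac)
    qed
    then have "(LINT \<omega>|m. f (\<omega> + \<beta> s) * of_real (K s) * cnj (\<gamma> \<omega>))
      = (LINT \<omega>|m. f (\<beta> s + \<omega>) * cnj (\<gamma> (\<beta> s + \<omega>))) * (\<gamma> (\<beta> s) * of_real (K s))"
      by (simp only: integral_mult_left_zero)
    also have "(LINT \<omega>|m. f (\<beta> s + \<omega>) * cnj (\<gamma> (\<beta> s + \<omega>))) = fourier_coeff m f \<gamma>"
      unfolding fourier_coeff_def
      using integral_translation[of "\<lambda>\<omega>. f \<omega> * cnj (\<gamma> \<omega>)" "\<beta> s"] by simp
    finally show ?thesis .
  qed
  show "fourier_coeff m (\<lambda>\<omega>. LINT s|lborel. f (\<omega> + \<beta> s) * of_real (K s)) \<gamma>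
      = fourier_coeff m f \<gamma> * (LINT s|lborel. \<gamma> (\<beta> s) * of_real (K s))"
    using sw unfolding inner integral_mult_right_zero integral_mult_left_zero
    unfolding fourier_coeff_def[of m "\<lambda>\<omega>. LINT s|lborel. f (\<omega> + \<beta> s) * of_real (K s)"] .
qed

lemma fourier_coeff_character:
  assumes "continuous_character \<eta>" "continuous_character \<gamma>"
  shows "fourier_coeff m \<eta> \<gamma> = (if \<eta> = \<gamma> then 1 else 0)"
proof (cases "\<eta> = \<gamma>")
  case True
  have "\<gamma> x * cnj (\<gamma> x) = 1" for x
    using assms(2) by (simp add: continuous_character_def flip: complex_norm_square)
  then show ?thesis using True by (simp add: fourier_coeff_def)
next
  case False
  then obtain a where a: "\<eta> a \<noteq> \<gamma> a" by auto
  have m: "\<And>x y. \<eta> (x + y) = \<eta> x * \<eta> y" "\<And>x y. \<gamma> (x + y) = \<gamma> x * \<gamma> y"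
    and c: "continuous_on UNIV \<eta>" "continuous_on UNIV \<gamma>" and 1: "\<And>x. norm (\<gamma> x) = 1"
    using assms by (auto simp: continuous_character_def)
  have "(\<lambda>\<omega>. \<eta> \<omega> * cnj (\<gamma> \<omega>)) \<in> borel_measurable m"
    by (intro continuous_measurable continuous_intros c)
  from integral_translation[OF this, of a]
  have "fourier_coeff m \<eta> \<gamma> = (LINT x|m. (\<eta> a * cnj (\<gamma> a)) * (\<eta> x * cnj (\<gamma> x)))"
    by (simp add: fourier_coeff_def m mult_ac)
  also have "\<dots> = \<eta> a * cnj (\<gamma> a) * fourier_coeff m \<eta> \<gamma>"
    by (simp only: integral_mult_right_zero fourier_coeff_def)
  finally have "fourier_coeff m \<eta> \<gamma> * (\<eta> a * cnj (\<gamma> a) - 1) = 0"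
    by (simp add: algebra_simps)
  moreover have "\<eta> a * cnj (\<gamma> a) \<noteq> 1"
  proof
    assume *: "\<eta> a * cnj (\<gamma> a) = 1"
    have "cnj (\<gamma> a) * \<gamma> a = 1" using complex_norm_square[of "\<gamma> a"] by (simp add: 1 mult.commute)
    then have "\<eta> a = (\<eta> a * cnj (\<gamma> a)) * \<gamma> a" by (simp add: mult.assoc)
    then show False using * a by simp
  qed
  ultimately show ?thesis using False by simp
qed

end

section \<open>Riesz means on the group\<close>

lemma extends_frequency_inj:
  assumes "extends_frequency \<beta> a \<gamma>" "extends_frequency \<beta> b \<gamma>"
  shows "a = b"
proof (rule ccontr)
  assume "a \<noteq> b"
  \<comment> \<open>At this time the two exponentials differ by the factor -1.\<close>
  define t where "t = pi / (a - b)"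
  have e: "exp (- \<i> * of_real c * of_real s) = cis (- (c * s))" for c s
    by (simp add: cis_conv_exp mult_ac)
  have "cis (- (a * t)) = cis (- (b * t))"
    using assms unfolding extends_frequency_def e by (metis (no_types))
  then have "cis (- (a * t)) * cis (b * t) = cis (- (b * t)) * cis (b * t)" by simp
  then have "cis (- (a * t) + b * t) = 1" by (simp add: cis_mult)
  moreover have "- (a * t) + b * t = - pi"
  proof -
    have "(a - b) * t = pi" using \<open>a \<noteq> b\<close> by (simp add: t_def)
    then show ?thesis by (simp add: left_diff_distrib)
  qed
  ultimately show False by (simp add: complex_eq_iff)
qed

text \<open>Moving along an orbit of the flow is moving along the imaginary axis; this links the
  assertion at 0 for almost all \<open>\<omega>\<close> with the assertion for almost all
  \<open>t\<close>.\<close>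

lemma riesz_mean_vertical_limit:
  assumes "lambda_dirichlet_group l \<beta>"
  shows "riesz_mean l k x (vertical_limit l \<beta> D (\<omega> + \<beta> t)) 0
    = riesz_mean l k x (vertical_limit l \<beta> D \<omega>) (\<i> * of_real t)"
proof -
  have "freq_char \<beta> (l n) (\<omega> + \<beta> t) = freq_char \<beta> (l n) \<omega> * exp (- of_real (l n) * (\<i> * of_real t))" for n
    using freq_char_extends[OF assms, of n]
    by (simp add: extends_frequency_def continuous_character_def mult_ac)
  then show ?thesis
    unfolding riesz_mean_def vertical_limit_def by (simp add: mult_ac)
qed

context dirichlet_flow
begin

text \<open>Fourier coefficients are compared. At \<open>h j\<close> the average has
  \<open>D j\<close> times the profile at \<open>l j / x\<close>; this is 0 for
  \<open>l j \<ge> x\<close>, matching the truncation of the Riesz mean. At all other characters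
  \<open>f\<close> has coefficient 0 by the definition of \<open>H1\<close>.\<close>

lemma AE_riesz_mean_eq_average:
  assumes l: "frequency l" and ldg: "lambda_dirichlet_group l \<beta>" and k: "k > 0" and x: "x > 0"
    and f: "f \<in> H1 l \<beta> m"
  shows "AE \<omega> in m. riesz_mean l k x (vertical_limit l \<beta> (associated_series l \<beta> m f) \<omega>) 0
    = (LINT s|lborel. f (\<omega> + \<beta> s) * of_real (x * riesz_kernel k (x * s)))"
proof -
  define D where "D = associated_series l \<beta> m f"
  define h where "h n = freq_char \<beta> (l n)" for n
  have h: "extends_frequency \<beta> (l n) (h n)" for n
    unfolding h_def by (rule freq_char_extends[OF ldg])
  then have hc: "continuous_character (h n)" for n by (simp add: extends_frequency_def)
  then have hcont: "continuous_on UNIV (h n)" for n by (simp add: continuous_character_def)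
  \<comment> \<open>Distinct indices must give distinct characters, so that a coefficient of the
    finite sum \<open>R\<close> is a single \<open>c j\<close>.\<close>
  have h_inj: "h n = h j \<longleftrightarrow> n = j" for n j
    using h[of n] h[of j] extends_frequency_inj l
    by (metis frequency_def strict_mono_eq)
  have fi: "integrable m f" using f by (simp add: H1_def)
  define K where "K s = x * riesz_kernel k (x * s)" for s
  have K: "integrable lborel K"
    using lborel_integrable_real_affine[OF riesz_kernel_integrable[OF k], of x 0] x
    unfolding K_def by simp
  define F where "F \<omega> = (LINT s|lborel. f (\<omega> + \<beta> s) * of_real (K s))" for \<omega>
  have F: "integrable m F" unfolding F_def by (rule flow_average(1)[OF fi K])
  define S where "S = {n. l n < x}"
  have S: "finite S" unfolding S_def by (rule frequency_finite_less[OF l])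
  define c where "c n = D n * of_real ((1 - l n / x) powr k)" for n
  define R where "R \<omega> = (\<Sum>n\<in>S. c n * h n \<omega>)" for \<omega>
  have R_eq: "riesz_mean l k x (vertical_limit l \<beta> D \<omega>) 0 = R \<omega>" for \<omega>
    by (simp add: riesz_mean_def vertical_limit_def R_def S_def c_def h_def mult_ac)
  have Rc: "continuous_on UNIV R" unfolding R_def by (intro continuous_intros hcont)
  have R: "integrable m R" by (rule continuous_integrable[OF Rc])
  have R_coeff: "fourier_coeff m R \<gamma> = (\<Sum>n\<in>S. c n * (if h n = \<gamma> then 1 else 0))"
    if \<gamma>: "continuous_character \<gamma>" for \<gamma>
  proof -
    have cg: "continuous_on UNIV (\<lambda>\<omega>. h n \<omega> * cnj (\<gamma> \<omega>))" for n
      using \<gamma> hcont by (intro continuous_intros) (auto simp: continuous_character_def)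
    have "fourier_coeff m R \<gamma> = (LINT \<omega>|m. (\<Sum>n\<in>S. c n * (h n \<omega> * cnj (\<gamma> \<omega>))))"
      by (simp add: fourier_coeff_def R_def sum_distrib_right mult.assoc)
    also have "\<dots> = (\<Sum>n\<in>S. c n * fourier_coeff m (h n) \<gamma>)"
    proof -
      have "integrable m (\<lambda>\<omega>. c n * (h n \<omega> * cnj (\<gamma> \<omega>)))" for n
        by (intro integrable_mult_right continuous_integrable cg)
      then show ?thesis by (simp add: Bochner_Integration.integral_sum fourier_coeff_def)
    qed
    finally show ?thesis by (simp add: fourier_coeff_character[OF hc \<gamma>])
  qed
  have K_coeff: "(LINT s|lborel. h n (\<beta> s) * of_real (K s)) = of_real (riesz_profile k (l n / x))" for n
  proof -
    have hs: "h n (\<beta> s) = cis (- (l n / x * (x * s)))" for s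
      using h[of n] x by (simp add: extends_frequency_def cis_conv_exp mult_ac)
    have "of_real (riesz_profile k (l n / x)) = (LINT t|lborel. of_real (riesz_kernel k t) * cis (- (l n / x * t)))"
      by (rule fourier_riesz_kernel[OF k, symmetric])
    also have "\<dots> = of_real x * (LINT s|lborel. of_real (riesz_kernel k (x * s)) * cis (- (l n / x * (x * s))))"
      using lborel_integral_real_affine[of x "\<lambda>t. of_real (riesz_kernel k t) * cis (- (l n / x * t))" 0] x
      by (simp add: scaleR_conv_of_real)
    also have "\<dots> = (LINT s|lborel. h n (\<beta> s) * of_real (K s))"
      unfolding integral_mult_right_zero[symmetric] hs K_def by (simp add: mult_ac)
    finally show ?thesis by simp
  qed
  have "AE \<omega> in m. F \<omega> - R \<omega> = 0"
  proof (rule fourier_uniqueness)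
    show "integrable m (\<lambda>\<omega>. F \<omega> - R \<omega>)" using F R by simp
    fix \<gamma> :: "'g \<Rightarrow> complex" assume \<gamma>: "continuous_character \<gamma>"
    have cg: "continuous_on UNIV (\<lambda>\<omega>. cnj (\<gamma> \<omega>))"
      using \<gamma> by (intro continuous_intros) (auto simp: continuous_character_def)
    have "fourier_coeff m (\<lambda>\<omega>. F \<omega> - R \<omega>) \<gamma> = fourier_coeff m F \<gamma> - fourier_coeff m R \<gamma>"
      unfolding fourier_coeff_def left_diff_distrib
      by (intro Bochner_Integration.integral_diff integrable_mult_continuous F R cg)
    also have "fourier_coeff m F \<gamma> = fourier_coeff m f \<gamma> * (LINT s|lborel. \<gamma> (\<beta> s) * of_real (K s))"
      unfolding F_def by (rule flow_average(2)[OF fi K \<gamma>])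
    also have "\<dots> = fourier_coeff m R \<gamma>"
    proof (cases "\<exists>n. \<gamma> = h n")
      case True
      then obtain j where j: "\<gamma> = h j" by blast
      have "fourier_coeff m R \<gamma> = (\<Sum>n\<in>S. if n = j then c n else 0)"
        unfolding R_coeff[OF \<gamma>] unfolding j h_inj by (intro sum.cong) auto
      also have "\<dots> = (if l j < x then c j else 0)"
        using S by (simp add: S_def)
      also have "\<dots> = D j * of_real (riesz_profile k (l j / x))"
        using x l by (auto simp: c_def riesz_profile_def max_def frequency_def field_simps)
      finally show ?thesis
        unfolding j K_coeff by (simp add: D_def associated_series_def h_def)
    next
      case False
      then have "fourier_coeff m f \<gamma> = 0"
        using f \<gamma> by (auto simp: H1_def h_def)
      moreover have "fourier_coeff m R \<gamma> = 0"
        unfolding R_coeff[OF \<gamma>] using False by (intro sum.neutral) auto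
      ultimately show ?thesis by simp
    qed
    finally show "fourier_coeff m (\<lambda>\<omega>. F \<omega> - R \<omega>) \<gamma> = 0" by simp
  qed
  then show ?thesis
    by eventually_elim (simp add: R_eq[unfolded D_def] F_def K_def)
qed

end

text \<open>Convergence along real \<open>x\<close> expressed by countably many conditions, so that
  the set of good points becomes measurable. The weak inequality passes from rational to real
  lengths by continuity.\<close>

lemma tendsto_at_top_rational:
  fixes r :: "real \<Rightarrow> complex"
  assumes r: "continuous_on {0<..} r"
  shows "(r \<longlongrightarrow> a) at_top \<longleftrightarrow>
    (\<forall>i::nat. \<exists>X::nat. \<forall>q\<in>{q\<in>\<rat>. real X \<le> q \<and> 0 < q}. norm (r q - a) \<le> inverse (Suc i))"
    (is "?L \<longleftrightarrow> ?R")
proof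
  assume L: ?L
  show ?R
  proof
    fix i :: nat
    have "\<forall>\<^sub>F x in at_top. dist (r x) a < inverse (Suc i)"
      using L by (rule tendstoD) simp
    then obtain X0 where X0: "\<And>x. x \<ge> X0 \<Longrightarrow> dist (r x) a < inverse (Suc i)"
      by (auto simp: eventually_at_top_linorder)
    obtain X :: nat where "X0 \<le> X" using real_arch_simple by blast
    then have "\<forall>q\<in>{q\<in>\<rat>. real X \<le> q \<and> 0 < q}. norm (r q - a) \<le> inverse (Suc i)"
      using X0 unfolding dist_norm by (auto intro!: less_imp_le order_trans[of X0])
    then show "\<exists>X::nat. \<forall>q\<in>{q\<in>\<rat>. real X \<le> q \<and> 0 < q}. norm (r q - a) \<le> inverse (Suc i)" ..
  qed
next
  assume R: ?R
  show ?L
  proof (rule tendstoI)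
    fix \<epsilon> :: real assume "\<epsilon> > 0"
    then obtain i where i: "inverse (real (Suc i)) < \<epsilon>" using reals_Archimedean by blast
    obtain X :: nat where X: "\<forall>q\<in>{q\<in>\<rat>. real X \<le> q \<and> 0 < q}. norm (r q - a) \<le> inverse (Suc i)"
      using R by blast
    show "\<forall>\<^sub>F x in at_top. dist (r x) a < \<epsilon>"
      using eventually_gt_at_top[of "real X"]
    proof eventually_elim
      case (elim x)
      then have x: "x > 0" by (meson le_less_trans of_nat_0_le_iff)
      obtain q where q: "\<forall>j. q j \<in> \<rat> \<and> x < q j \<and> q j < x + inverse (real (Suc j))" "q \<longlonglongrightarrow> x"
        using rational_sequence_from_right[of x] by blast
      have "(\<lambda>j. r (q j)) \<longlonglongrightarrow> r x"
        by (rule continuous_on_tendsto_compose[OF r q(2)])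
          (use x q(1) in \<open>auto intro!: always_eventually less_trans[OF x]\<close>)
      then have "(\<lambda>j. norm (r (q j) - a)) \<longlonglongrightarrow> norm (r x - a)"
        by (intro tendsto_intros)
      moreover have "norm (r (q j) - a) \<le> inverse (Suc i)" for j
      proof -
        have "q j \<in> {q\<in>\<rat>. real X \<le> q \<and> 0 < q}"
          using q(1)[rule_format, of j] elim x by auto
        then show ?thesis using X by blast
      qed
      ultimately have "norm (r x - a) \<le> inverse (Suc i)"
        by (intro LIMSEQ_le_const2) auto
      then show ?case using i by (simp add: dist_norm)
    qed
  qed
qed

context dirichlet_flow
begin

text \<open>The exceptional sets for the countably many rational lengths are united before passing
  to orbits. The extension to all \<open>x > 0\<close> takes place on a fixed orbit and adds no
  further exception.\<close>

lemma AE_riesz_mean_orbit: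
  assumes l: "frequency l" and ldg: "lambda_dirichlet_group l \<beta>" and k: "k > 0" and f: "f \<in> H1 l \<beta> m"
  shows "AE \<omega> in m. AE t in lborel. \<forall>x>0.
    riesz_mean l k x (vertical_limit l \<beta> (associated_series l \<beta> m f) \<omega>) (\<i> * of_real t)
    = (LINT s|lborel. f (\<omega> + \<beta> (t + s)) * of_real (x * riesz_kernel k (x * s)))"
proof -
  define D where "D = associated_series l \<beta> m f"
  have fi: "integrable m f" using f by (simp add: H1_def)
  have "\<forall>q\<in>\<rat> \<inter> {0<..}. AE \<omega> in m. riesz_mean l k q (vertical_limit l \<beta> D \<omega>) 0
    = (LINT s|lborel. f (\<omega> + \<beta> s) * of_real (q * riesz_kernel k (q * s)))"
    unfolding D_def by (intro ballI AE_riesz_mean_eq_average[OF l ldg k _ f]) auto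
  then have "AE \<omega> in m. \<forall>q\<in>\<rat> \<inter> {0<..}. riesz_mean l k q (vertical_limit l \<beta> D \<omega>) 0
    = (LINT s|lborel. f (\<omega> + \<beta> s) * of_real (q * riesz_kernel k (q * s)))"
    by (subst AE_ball_countable) (auto simp: countable_rat)
  from AE_orbit[OF this] AE_orbit_weight_finite[OF fi, of "min k 1"] k
  have "AE \<omega> in m. (AE t in lborel. \<forall>q\<in>\<rat> \<inter> {0<..}. riesz_mean l k q (vertical_limit l \<beta> D (\<omega> + \<beta> t)) 0
    = (LINT s|lborel. f (\<omega> + \<beta> t + \<beta> s) * of_real (q * riesz_kernel k (q * s))))
    \<and> (\<integral>\<^sup>+t. norm (f (\<omega> + \<beta> t)) * weight (min k 1) t \<partial>lborel) < \<infinity>"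
    by simp
  then show ?thesis
  proof eventually_elim
    case (elim \<omega>)
    have \<beta>: "\<beta> (t + s) = \<beta> t + \<beta> s" for t s using dirichlet by (simp add: dirichlet_group_def)
    have gm: "(\<lambda>t. f (\<omega> + \<beta> t)) \<in> borel_measurable borel"
      using fi by (intro orbit_measurable) auto
    from conjunct1[OF elim] show ?case
    proof eventually_elim
      case (elim t)
      show ?case
      proof (intro allI impI)
        fix x :: real assume "x > 0"
        show "riesz_mean l k x (vertical_limit l \<beta> (associated_series l \<beta> m f) \<omega>) (\<i> * of_real t)
          = (LINT s|lborel. f (\<omega> + \<beta> (t + s)) * of_real (x * riesz_kernel k (x * s)))"
        proof (rule riesz_kernel_average_rational_limit[OF l k gm])
          show "(\<integral>\<^sup>+t. norm (f (\<omega> + \<beta> t)) * weight (min k 1) t \<partial>lborel) < \<infinity>"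
            by (rule conjunct2[OF \<open>_ \<and> (\<integral>\<^sup>+t. norm (f (\<omega> + \<beta> t)) * weight (min k 1) t \<partial>lborel) < \<infinity>\<close>])
          fix q :: real assume "q \<in> \<rat>" "q > 0"
          then show "riesz_mean l k q (vertical_limit l \<beta> (associated_series l \<beta> m f) \<omega>) (\<i> * of_real t)
            = (LINT s|lborel. f (\<omega> + \<beta> (t + s)) * of_real (q * riesz_kernel k (q * s)))"
            using elim unfolding riesz_mean_vertical_limit[OF ldg] D_def by (simp add: \<beta> add.assoc)
        qed fact
      qed
    qed
  qed
qed

lemma AE_riesz_mean_tendsto:
  assumes l: "frequency l" and ldg: "lambda_dirichlet_group l \<beta>" and k: "k > 0" and f: "f \<in> H1 l \<beta> m"
  shows "AE \<omega> in m. ((\<lambda>x. riesz_mean l k x (vertical_limit l \<beta> (associated_series l \<beta> m f) \<omega>) 0) \<longlongrightarrow> f \<omega>) at_top"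
proof -
  define r where "r x \<omega> = riesz_mean l k x (vertical_limit l \<beta> (associated_series l \<beta> m f) \<omega>) 0" for x \<omega>
  have fi: "integrable m f" using f by (simp add: H1_def)
  then have [measurable]: "f \<in> borel_measurable m" by auto
  have [measurable]: "r x \<in> borel_measurable m" for x
  proof -
    have "continuous_on UNIV (freq_char \<beta> (l n))" for n
      using freq_char_extends[OF ldg, of n] by (simp add: extends_frequency_def continuous_character_def)
    then show ?thesis
      unfolding r_def riesz_mean_def vertical_limit_def
      by (intro continuous_measurable continuous_intros)
  qed
  define S where "S = {\<omega>. ((\<lambda>x. r x \<omega>) \<longlongrightarrow> f \<omega>) at_top}"
  \<comment> \<open>The rational description is a countable combination of measurable sets, which
    \<open>AE_of_AE_orbit\<close> will require.\<close>
  have "S = (\<Inter>i::nat. \<Union>X::nat. \<Inter>q\<in>{q\<in>\<rat>. real X \<le> q \<and> 0 < q}. {\<omega> \<in> space m. norm (r q \<omega> - f \<omega>) \<le> inverse (Suc i)})"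
    using tendsto_at_top_rational[OF continuous_riesz_mean[OF l k]] by (auto simp: S_def r_def)
  also have "\<dots> \<in> sets m"
  proof (intro sets.countable_INT'' sets.countable_UN'')
    show "countable {q \<in> \<rat>. real X \<le> q \<and> 0 < q}" for X
      by (rule countable_subset[OF _ countable_rat]) auto
    show "{\<omega> \<in> space m. norm (r q \<omega> - f \<omega>) \<le> inverse (Suc i)} \<in> sets m" for q i
      by measurable
  qed (auto simp: sets_haar)
  finally have S: "S \<in> sets m" .
  have \<delta>: "min k 1 > 0" using k by simp
  have "AE \<omega> in m. AE t in lborel. \<omega> + \<beta> t \<in> S"
    using AE_riesz_mean_orbit[OF l ldg k f] AE_orbit_weight_finite[OF fi \<delta>]
  proof eventually_elim
    case (elim \<omega>)
    have gm: "(\<lambda>t. f (\<omega> + \<beta> t)) \<in> borel_measurable borel"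
      by (intro orbit_measurable) measurable
    have fin: "(\<integral>\<^sup>+t. norm (f (\<omega> + \<beta> t)) * weight (min k 1) t \<partial>lborel) < \<infinity>"
      by (rule elim(2))
    from riesz_mean_line_tendsto[OF k gm fin elim(1)] show ?case
      by (simp add: S_def r_def riesz_mean_vertical_limit[OF ldg])
  qed
  from AE_of_AE_orbit[OF S this] show ?thesis by (simp add: S_def r_def)
qed

end

section \<open>From Borel orbits to arbitrary representatives\<close>

lemma integrable_lebesgue:
  fixes g :: "real \<Rightarrow> complex"
  assumes "integrable lborel g"
  shows "integrable lebesgue g" "(LINT x|lebesgue. g x) = (LINT x|lborel. g x)"
  using assms by (simp_all add: integrable_completion integral_completion)

lemma locally_integrable_measurable:
  assumes "locally_integrable g"
  shows "g \<in> borel_measurable lebesgue"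
proof (rule borel_measurable_LIMSEQ_metric)
  show "(\<lambda>t. indicator {- real n..real n} t *\<^sub>R g t) \<in> borel_measurable lebesgue" for n
  proof (rule borel_measurable_integrable)
    have "set_integrable lebesgue {- real n..real n} g"
      using assms compact_Icc unfolding locally_integrable_def by blast
    then show "integrable lebesgue (\<lambda>t. indicator {- real n..real n} t *\<^sub>R g t)"
      by (simp only: set_integrable_def)
  qed
  fix t :: real
  obtain N :: nat where "\<bar>t\<bar> \<le> real N" using real_arch_simple[of "\<bar>t\<bar>"] by auto
  then have "\<forall>\<^sub>F n in sequentially. indicator {- real n..real n} t *\<^sub>R g t = g t"
  proof (intro eventually_sequentiallyI[of N])
    fix n assume "N \<le> n"
    then have "\<bar>t\<bar> \<le> real n" using \<open>\<bar>t\<bar> \<le> real N\<close> by linarith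
    then have "t \<in> {- real n..real n}" by (simp add: abs_le_iff)
    then show "indicator {- real n..real n} t *\<^sub>R g t = g t" by simp
  qed
  then show "(\<lambda>n. indicator {- real n..real n} t *\<^sub>R g t) \<longlonglongrightarrow> g t"
    by (rule tendsto_eventually)
qed

lemma locally_integrable_of_weight:
  fixes g :: "real \<Rightarrow> complex"
  assumes "\<delta> > 0" "g \<in> borel_measurable borel" "(\<integral>\<^sup>+s. norm (g s) * weight \<delta> s \<partial>lborel) < \<infinity>"
  shows "locally_integrable g"
  unfolding locally_integrable_def
proof (intro allI impI)
  fix K :: "real set" assume K: "compact K"
  then obtain n where n: "K \<subseteq> ball 0 n"
    using compact_imp_bounded bounded_subset_ballD by blast
  have "set_integrable lborel (ball 0 n) g"
  proof -
    have "(\<lambda>x. indicat_real (ball 0 n) x *\<^sub>R g x) = (\<lambda>x. indicator (ball 0 n) x * g x)"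
      by (simp add: indicator_def fun_eq_iff)
    then show ?thesis
      using integrable_of_weight_finite(4)[OF assms, of n] by (simp only: set_integrable_def)
  qed
  then have "set_integrable lborel K g"
    by (rule set_integrable_subset) (use n borel_compact[OF K] in simp_all)
  then show "set_integrable lebesgue K g"
    unfolding set_integrable_def by (rule integrable_lebesgue)
qed

theorem corollary2p6:
  fixes l :: "nat \<Rightarrow> real"
    and \<beta> :: "real \<Rightarrow> 'g::{topological_ab_group_add, t2_space}"
    and m :: "'g measure"
    and k :: real
    and f :: "'g \<Rightarrow> complex"
    and D :: dirichlet_series
  assumes "frequency l"
    and "lambda_dirichlet_group l \<beta>"
    and "normalized_haar m"
    and "k > 0"
    and "f \<in> H1 l \<beta> m"
    and "D = associated_series l \<beta> m f"
  shows "\<exists>N\<in>null_sets m. \<forall>\<omega>. \<omega> \<notin> N \<longrightarrow>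
     ((\<lambda>x. riesz_mean l k x (vertical_limit l \<beta> D \<omega>) 0) \<longlongrightarrow> f \<omega>) at_top \<and>
     (\<exists>f\<omega>. is_orbit_function \<beta> f \<omega> f\<omega>) \<and>
     (\<forall>f\<omega>. is_orbit_function \<beta> f \<omega> f\<omega> \<longrightarrow>
        (AE t in lebesgue.
           ((\<lambda>x. riesz_mean l k x (vertical_limit l \<beta> D \<omega>) (\<i> * of_real t)) \<longlongrightarrow> f\<omega> t) at_top) \<and>
        (\<forall>u>0. AE t in lebesgue.
           convolution_exists f\<omega> (poisson_kernel u) t \<and>
           ((\<lambda>x. riesz_mean l k x (vertical_limit l \<beta> D \<omega>) (of_real u + \<i> * of_real t))
              \<longlongrightarrow> convolution f\<omega> (poisson_kernel u) t) at_top))"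
proof -
  interpret dirichlet_flow m \<beta>
    using assms(2,3) by unfold_locales (auto simp: lambda_dirichlet_group_def dirichlet_group_def)
  define \<delta> where "\<delta> = min k 1"
  have \<delta>: "\<delta> > 0" using \<open>k > 0\<close> by (simp add: \<delta>_def)
  have f: "integrable m f" using assms(5) by (simp add: H1_def)
  \<comment> \<open>At a good \<open>\<omega>\<close> the rest is deterministic: these three
    conditions imply every assertion, so one null set of the group serves all \<open>u\<close>, all
    \<open>t\<close> and all representatives.\<close>
  define good where "good \<omega> \<longleftrightarrow>
    ((\<lambda>x. riesz_mean l k x (vertical_limit l \<beta> D \<omega>) 0) \<longlongrightarrow> f \<omega>) at_top \<and>
    (\<integral>\<^sup>+t. norm (f (\<omega> + \<beta> t)) * weight \<delta> t \<partial>lborel) < \<infinity> \<and>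
    (AE t in lborel. \<forall>x>0. riesz_mean l k x (vertical_limit l \<beta> D \<omega>) (\<i> * of_real t)
      = (LINT s|lborel. f (\<omega> + \<beta> (t + s)) * of_real (x * riesz_kernel k (x * s))))" for \<omega>
  have "AE \<omega> in m. good \<omega>"
    unfolding good_def assms(6)
    by (intro AE_conjI AE_riesz_mean_tendsto AE_orbit_weight_finite AE_riesz_mean_orbit assms f \<delta>)
  then obtain N where N: "{\<omega> \<in> space m. \<not> good \<omega>} \<subseteq> N" "emeasure m N = 0" "N \<in> sets m"
    by (rule AE_E)
  show ?thesis
  proof (intro bexI[of _ N] allI impI)
    show "N \<in> null_sets m" using N by (intro null_setsI)
    fix \<omega> assume "\<omega> \<notin> N"
    then have good: "good \<omega>" using N(1) by auto
    \<comment> \<open>The restriction of \<open>f\<close> to the orbit is itself a Borel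
      representative. The analysis is done for \<open>g\<close> and then transferred to any other
      orbit function.\<close>
    define g where "g t = f (\<omega> + \<beta> t)" for t
    have gm: "g \<in> borel_measurable borel"
      unfolding g_def using f by (intro orbit_measurable) auto
    have fin: "(\<integral>\<^sup>+t. norm (g t) * weight \<delta> t \<partial>lborel) < \<infinity>"
      and id: "AE t in lborel. \<forall>x>0. riesz_mean l k x (vertical_limit l \<beta> D \<omega>) (\<i> * of_real t)
        = (LINT s|lborel. g (t + s) * of_real (x * riesz_kernel k (x * s)))"
      using good by (auto simp: good_def g_def)
    note line = riesz_mean_line_tendsto[OF \<open>k > 0\<close> gm fin[unfolded \<delta>_def] id]
    note poisson = riesz_mean_right_half_plane_tendsto[OF \<open>frequency l\<close> \<open>k > 0\<close> _ gm fin[unfolded \<delta>_def] id]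
    have orbit: "is_orbit_function \<beta> f \<omega> g"
      unfolding is_orbit_function_def
      using locally_integrable_of_weight[OF \<delta> gm fin] by (auto simp: g_def[abs_def])
    have "(AE t in lebesgue.
           ((\<lambda>x. riesz_mean l k x (vertical_limit l \<beta> D \<omega>) (\<i> * of_real t)) \<longlongrightarrow> f\<omega> t) at_top) \<and>
        (\<forall>u>0. AE t in lebesgue.
           convolution_exists f\<omega> (poisson_kernel u) t \<and>
           ((\<lambda>x. riesz_mean l k x (vertical_limit l \<beta> D \<omega>) (of_real u + \<i> * of_real t))
              \<longlongrightarrow> convolution f\<omega> (poisson_kernel u) t) at_top)"
      if f\<omega>: "is_orbit_function \<beta> f \<omega> f\<omega>" for f\<omega>
    proof (intro conjI allI impI)
      have eq: "AE t in lebesgue. g t = f\<omega> t"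
        using f\<omega> unfolding is_orbit_function_def g_def by (auto elim: eventually_mono)
      have [measurable]: "f\<omega> \<in> borel_measurable lebesgue"
        using f\<omega> by (intro locally_integrable_measurable) (simp add: is_orbit_function_def)
      show "AE t in lebesgue. ((\<lambda>x. riesz_mean l k x (vertical_limit l \<beta> D \<omega>) (\<i> * of_real t)) \<longlongrightarrow> f\<omega> t) at_top"
        using AE_completion[OF line] eq by eventually_elim simp
      fix u :: real assume u: "u > 0"
      \<comment> \<open>This holds for every \<open>t\<close>: an orbit function enters only through
        an integral, where replacing \<open>g\<close> by another representative changes
        nothing.\<close>
      have "convolution_exists f\<omega> (poisson_kernel u) t \<and>
        ((\<lambda>x. riesz_mean l k x (vertical_limit l \<beta> D \<omega>) (of_real u + \<i> * of_real t))
          \<longlongrightarrow> convolution f\<omega> (poisson_kernel u) t) at_top" for t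
      proof -
        have pm: "(\<lambda>y. complex_of_real (poisson_kernel u (t - y))) \<in> borel_measurable lebesgue"
          by (rule measurable_completion) simp
        have ae: "AE y in lebesgue. g y * of_real (poisson_kernel u (t - y)) = f\<omega> y * of_real (poisson_kernel u (t - y))"
          using eq by eventually_elim simp
        have fm: "(\<lambda>y. f\<omega> y * of_real (poisson_kernel u (t - y))) \<in> borel_measurable lebesgue"
          by (intro borel_measurable_times pm) measurable
        note gi = integrable_lebesgue[OF poisson(1)[OF u, of t]]
        have "integrable lebesgue (\<lambda>y. f\<omega> y * of_real (poisson_kernel u (t - y)))"
          by (rule integrable_cong_AE_imp[OF gi(1) fm]) (use ae in \<open>auto elim: eventually_mono\<close>)
        moreover have "convolution f\<omega> (poisson_kernel u) t = (LINT y|lborel. g y * of_real (poisson_kernel u (t - y)))"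
          unfolding convolution_def gi(2)[symmetric]
          by (rule integral_cong_AE[OF fm borel_measurable_integrable[OF gi(1)]]) (use ae in \<open>auto elim: eventually_mono\<close>)
        ultimately show ?thesis
          using poisson(2)[OF u, of t] by (simp add: convolution_exists_def)
      qed
      then show "AE t in lebesgue. convolution_exists f\<omega> (poisson_kernel u) t \<and>
        ((\<lambda>x. riesz_mean l k x (vertical_limit l \<beta> D \<omega>) (of_real u + \<i> * of_real t))
          \<longlongrightarrow> convolution f\<omega> (poisson_kernel u) t) at_top"
        by simp
    qed
    with good orbit show "((\<lambda>x. riesz_mean l k x (vertical_limit l \<beta> D \<omega>) 0) \<longlongrightarrow> f \<omega>) at_top \<and>
     (\<exists>f\<omega>. is_orbit_function \<beta> f \<omega> f\<omega>) \<and>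
     (\<forall>f\<omega>. is_orbit_function \<beta> f \<omega> f\<omega> \<longrightarrow>
        (AE t in lebesgue.
           ((\<lambda>x. riesz_mean l k x (vertical_limit l \<beta> D \<omega>) (\<i> * of_real t)) \<longlongrightarrow> f\<omega> t) at_top) \<and>
        (\<forall>u>0. AE t in lebesgue.
           convolution_exists f\<omega> (poisson_kernel u) t \<and>
           ((\<lambda>x. riesz_mean l k x (vertical_limit l \<beta> D \<omega>) (of_real u + \<i> * of_real t))
              \<longlongrightarrow> convolution f\<omega> (poisson_kernel u) t) at_top))"
      unfolding good_def by blast
  qed
qed

end
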